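(* Let $1\le k<n$ and let $\Omega\subset\mathbb{C}^n$ be a smooth bounded strongly pseudoconvex domain such that $0\in\Omega$ and $\overline\Omega$ is holomorphically convex in a ball centered at $0$. For sufficiently large $R$ let $\Sigma_R=B_R(0)\setminus\overline\Omega$, and for small $\varepsilon>0$ let $$f^\varepsilon(z)=C_{n,k}\,\varepsilon^2(1+\varepsilon^2)^{n-k}(|z|^2+\varepsilon^2)^{-n-1},$$ where $C_{n,k}>0$ is a constant depending only on $n,k$. Let $u^{\varepsilon,R}\in C^4(\Sigma_R)\cap C^2(\overline{\Sigma_R})$ be $k$-admissible solutions of $$\sigma_k\big(u^{\varepsilon,R}_{i\bar j}\big)=f^\varepsilon\ \text{ in }\Sigma_R,\qquad u^{\varepsilon,R}=-1\ \text{ on }\partial\Omega,$$ which satisfy, for a constant $C_0>0$ independent of $\varepsilon$ and $R$, $$C_0^{-1}|z|^{2-\frac{2n}{k}}<-u^{\varepsilon,R}<C_0|z|^{2-\frac{2n}{k}},\quad |Du^{\varepsilon,R}(z)|<C_0|z|^{1-\frac{2n}{k}}\quad\text{in }\Sigma_R,$$ $$|D^2u^{\varepsilon,R}(z)|<C_0|z|^{-\frac{2n}{k}}\quad\text{on }\partial\Sigma_R .$$ Then there is a positive constant $C$ independent of $\varepsilon$ and $R$ such that $$|D^2u^{\varepsilon,R}|\le C|z|^{-\frac{2n}{k}}\quad\text{in }\Sigma_R.$$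
   Context: $Du$ and $D^2u$ denote the real gradient and real Hessian under $\mathbb{C}^n\simeq\mathbb{R}^{2n}$, and $u_{i\bar j}=\partial^2u/\partial z_i\partial\bar z_j$. For a Hermitian matrix $A$, $\sigma_k(A)$ is the $k$-th elementary symmetric polynomial of its eigenvalues. A $C^2$ function $u$ is $k$-admissible if the eigenvalues of $(u_{i\bar j})$ lie in $\Gamma_k=\{\lambda\in\mathbb{R}^n:\sigma_1(\lambda)>0,\dots,\sigma_k(\lambda)>0\}$ at every point. $B_R(0)$ is the Euclidean ball of radius $R$ centered at the origin; $R$ is large enough that $\overline\Omega\subset B_R(0)$. The functions $u^{\varepsilon,R}$ are approximations (as $\varepsilon\to0$, $R\to\infty$) of the solution of the homogeneous complex $k$-Hessian equation in $\mathbb{C}^n\setminus\overline\Omega$ equal to $-1$ on $\partial\Omega$ and tending to $0$ at infinity; their data on $\partial B_R(0)$ enter only through the displayed estimates. *)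

theory Defs
  imports "HOL-Analysis.Analysis"
begin

section \<open>Partial derivatives and regularity classes\<close>

text \<open>The space \<open>complex^'n\<close> carries its real Euclidean structure: its \<^const>\<open>Basis\<close> consists of
  the vectors \<open>axis j 1\<close> and \<open>axis j \<i>\<close>, i.e. of the real coordinate directions
  \<open>x\<^sub>j\<close> and \<open>y\<^sub>j\<close> of \<open>z\<^sub>j = x\<^sub>j + \<i> y\<^sub>j\<close>.\<close>

definition pdiff :: "'a::euclidean_space \<Rightarrow> ('a \<Rightarrow> 'b::real_normed_vector) \<Rightarrow> 'a \<Rightarrow> 'b"
  where "pdiff b f = (\<lambda>x. frechet_derivative f (at x) b)"

abbreviation pdiffs :: "'a::euclidean_space list \<Rightarrow> ('a \<Rightarrow> 'b::real_normed_vector) \<Rightarrow> 'a \<Rightarrow> 'b"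
  where "pdiffs bs f \<equiv> foldr pdiff bs f"

text \<open>The classes \<open>C\<^sup>m(S)\<close>, \<open>C\<^sup>\<infinity>(S)\<close> and \<open>C\<^sup>m(closure S)\<close>, for open \<open>S\<close>. The last one
  is understood in the usual sense of boundary value problems: all partial derivatives of order at
  most \<open>m\<close>, taken in \<open>S\<close>, extend continuously to \<open>closure S\<close>.\<close>

definition C_on :: "nat \<Rightarrow> ('a::euclidean_space \<Rightarrow> 'b::real_normed_vector) \<Rightarrow> 'a set \<Rightarrow> bool"
  where "C_on m f S \<longleftrightarrow> (\<forall>bs \<in> lists Basis.
    (length bs < m \<longrightarrow> pdiffs bs f differentiable_on S) \<and>
    (length bs \<le> m \<longrightarrow> continuous_on S (pdiffs bs f)))"

definition smooth_on :: "('a::euclidean_space \<Rightarrow> 'b::real_normed_vector) \<Rightarrow> 'a set \<Rightarrow> bool"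
  where "smooth_on f S \<longleftrightarrow> (\<forall>m. C_on m f S)"

definition C_on_closure :: "nat \<Rightarrow> ('a::euclidean_space \<Rightarrow> 'b::real_normed_vector) \<Rightarrow> 'a set \<Rightarrow> bool"
  where "C_on_closure m f S \<longleftrightarrow> C_on m f S \<and> continuous_on (closure S) f \<and>
    (\<forall>bs \<in> lists Basis. length bs \<le> m \<longrightarrow>
      (\<exists>g. continuous_on (closure S) g \<and> (\<forall>x\<in>S. g x = pdiffs bs f x)))"

definition grad :: "('a::euclidean_space \<Rightarrow> real) \<Rightarrow> 'a \<Rightarrow> 'a"
  where "grad u x = (\<Sum>b\<in>Basis. pdiff b u x *\<^sub>R b)"

text \<open>The real Hessian as a matrix indexed by \<^const>\<open>Basis\<close>, and its boundary values, i.e. the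
  values at points of \<open>closure S\<close> of the continuous extension of its entries from \<open>S\<close>.\<close>

definition hess :: "('a::euclidean_space \<Rightarrow> real) \<Rightarrow> 'a \<Rightarrow> 'a \<Rightarrow> 'a \<Rightarrow> real"
  where "hess u x b c = pdiff b (pdiff c u) x"

definition hess_ext :: "'a::euclidean_space set \<Rightarrow> ('a \<Rightarrow> real) \<Rightarrow> 'a \<Rightarrow> 'a \<Rightarrow> 'a \<Rightarrow> real"
  where "hess_ext S u x b c = Lim (at x within S) (\<lambda>y. hess u y b c)"

definition hess_norm :: "('a::euclidean_space \<Rightarrow> 'a \<Rightarrow> real) \<Rightarrow> real"
  where "hess_norm H = sqrt (\<Sum>b\<in>Basis. \<Sum>c\<in>Basis. (H b c)\<^sup>2)"


section \<open>Complex derivatives\<close>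

text \<open>\<open>\<partial>/\<partial>z\<^sub>j = (\<partial>/\<partial>x\<^sub>j - \<i> \<partial>/\<partial>y\<^sub>j) / 2\<close> and
  \<open>\<partial>/\<partial>zbar\<^sub>j = (\<partial>/\<partial>x\<^sub>j + \<i> \<partial>/\<partial>y\<^sub>j) / 2\<close>.\<close>

definition dz :: "'n::finite \<Rightarrow> (complex^'n \<Rightarrow> complex) \<Rightarrow> complex^'n \<Rightarrow> complex"
  where "dz j f z = (pdiff (axis j 1) f z - \<i> * pdiff (axis j \<i>) f z) / 2"

definition dzbar :: "'n::finite \<Rightarrow> (complex^'n \<Rightarrow> complex) \<Rightarrow> complex^'n \<Rightarrow> complex"
  where "dzbar j f z = (pdiff (axis j 1) f z + \<i> * pdiff (axis j \<i>) f z) / 2"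

definition complex_hess :: "(complex^'n \<Rightarrow> real) \<Rightarrow> complex^'n \<Rightarrow> complex^'n^'n"
  where "complex_hess u z = (\<chi> i j. dz i (dzbar j (\<lambda>w. complex_of_real (u w))) z)"


section \<open>Elementary symmetric functions of eigenvalues\<close>

definition esym :: "nat \<Rightarrow> real^'n \<Rightarrow> real"
  where "esym k l = (\<Sum>I | card I = k. \<Prod>i\<in>I. l $ i)"

definition Gamma_cone :: "nat \<Rightarrow> (real^'n) set"
  where "Gamma_cone k = {l. \<forall>j\<in>{1..k}. esym j l > 0}"

text \<open>The eigenvalues of a Hermitian matrix, i.e. the roots of its characteristic polynomial listed
  with multiplicity. They are determined up to order only; \<open>esym k\<close> and \<open>Gamma_cone k\<close> are
  symmetric, so the choice of the order is immaterial.\<close>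

definition eigenvalues :: "complex^'n^'n \<Rightarrow> real^'n"
  where "eigenvalues A =
    (SOME l. \<forall>t::complex. det (mat t - A) = (\<Prod>i\<in>UNIV. t - complex_of_real (l $ i)))"

definition sigma_k :: "nat \<Rightarrow> complex^'n^'n \<Rightarrow> real"
  where "sigma_k k A = esym k (eigenvalues A)"

definition admissible :: "nat \<Rightarrow> (complex^'n) set \<Rightarrow> (complex^'n \<Rightarrow> real) \<Rightarrow> bool"
  where "admissible k S u \<longleftrightarrow>
    C_on 2 u S \<and> (\<forall>z\<in>S. eigenvalues (complex_hess u z) \<in> Gamma_cone k)"


section \<open>Pseudoconvexity and holomorphic convexity\<close>

definition defining_function ::
    "(complex^'n) set \<Rightarrow> (complex^'n) set \<Rightarrow> (complex^'n \<Rightarrow> real) \<Rightarrow> bool"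
  where "defining_function D U r \<longleftrightarrow>
    open U \<and> frontier D \<subseteq> U \<and> smooth_on r U \<and> D \<inter> U = {z\<in>U. r z < 0} \<and>
    (\<forall>p\<in>frontier D. grad r p \<noteq> 0)"

text \<open>The Levi form of a defining function is positive definite on the complex tangent spaces of
  the boundary.\<close>

definition smooth_bounded_strongly_pseudoconvex_domain :: "(complex^'n) set \<Rightarrow> bool"
  where "smooth_bounded_strongly_pseudoconvex_domain D \<longleftrightarrow>
    open D \<and> connected D \<and> D \<noteq> {} \<and> bounded D \<and>
    (\<exists>U r. defining_function D U r \<and>
      (\<forall>p\<in>frontier D. \<forall>w. w \<noteq> 0 \<and> (\<Sum>j\<in>UNIV. dz j (\<lambda>z. complex_of_real (r z)) p * w $ j) = 0 \<longrightarrow>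
        Re (\<Sum>i\<in>UNIV. \<Sum>j\<in>UNIV. complex_hess r p $ i $ j * w $ i * cnj (w $ j)) > 0))"

definition sc_holomorphic_on :: "(complex^'n \<Rightarrow> complex) \<Rightarrow> (complex^'n) set \<Rightarrow> bool"
  where "sc_holomorphic_on f S \<longleftrightarrow>
    (\<forall>z\<in>S. \<exists>f'. (f has_derivative f') (at z) \<and> (\<forall>c w. f' (c *s w) = c * f' w))"

definition holomorphic_hull :: "(complex^'n) set \<Rightarrow> (complex^'n) set \<Rightarrow> (complex^'n) set"
  where "holomorphic_hull B K =
    {z\<in>B. \<forall>f. sc_holomorphic_on f B \<longrightarrow> norm (f z) \<le> (SUP w\<in>K. norm (f w))}"

definition holomorphically_convex_in :: "(complex^'n) set \<Rightarrow> (complex^'n) set \<Rightarrow> bool"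
  where "holomorphically_convex_in B K \<longleftrightarrow> compact K \<and> K \<subseteq> B \<and> holomorphic_hull B K = K"


section \<open>The approximating problems\<close>

definition Sigma_dom :: "(complex^'n) set \<Rightarrow> real \<Rightarrow> (complex^'n) set"
  where "Sigma_dom D R = ball 0 R - closure D"

definition f_eps :: "real \<Rightarrow> nat \<Rightarrow> real \<Rightarrow> complex^'n \<Rightarrow> real"
  where "f_eps c k \<epsilon> z =
    c * \<epsilon>\<^sup>2 * (1 + \<epsilon>\<^sup>2) ^ (CARD('n) - k) / ((norm z)\<^sup>2 + \<epsilon>\<^sup>2) ^ (CARD('n) + 1)"

end

theory Submission
  imports Defs "HOL-Computational_Algebra.Fundamental_Theorem_Algebra"
begin

text \<open>For \<open>k > 1\<close> the equation loses its ellipticity as \<open>\<epsilon>\<close> tends to \<open>0\<close>, so rescaled interior estimates do not give uniform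
  constants, and comparing the second derivative in a fixed direction with a multiple of \<open>-u\<close> by the maximum principle
  yields only the decay \<open>|z|\<^sup>2\<^sup>-\<^sup>2\<^sup>n\<^sup>/\<^sup>k\<close> of \<open>-u\<close> itself. The missing factor \<open>|z|\<^sup>2\<close> comes from the symmetries of the equation. Let \<open>J\<close> be
  skew-Hermitian with \<open>J\<^sup>2 = -1\<close> and \<open>B = b + \<omega> J\<close> with \<open>b\<^sup>2 + \<omega>\<^sup>2 = 1\<close>. The flow \<open>T\<^sub>t = exp (t B)\<close> consists of unitary
  maps composed with dilations, and the second derivative of \<open>u\<close> along it is
  \<open>w(z) = D\<^sup>2u(Bz, Bz) + Du \<cdot> B\<^sup>2z\<close>, where \<open>|Bz| = |B\<^sup>2z| = |z|\<close>. An estimate \<open>w \<le> L (-u)\<close> therefore has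
  precisely the right strength. Every vector of length \<open>|z|\<close> has the form \<open>Bz\<close> for some \<open>B\<close>
  (\<open>direction_of_flow\<close>), so that all second derivatives are bounded from above; they are bounded from below
  because the trace of the Hessian is positive on \<open>\<Gamma>\<^sub>k\<close> (\<open>hess_norm_le_of_form_le\<close>).

  The estimate \<open>w \<le> L (-u)\<close> is a maximum principle (\<open>second_flow_derivative_bound\<close>), carried out with second
  differences. If it fails at an interior point, then for small \<open>t\<close> the function
  \<open>u \<circ> T\<^sub>t + u \<circ> T\<^sub>-\<^sub>t - 2 \<mu> u\<close> with \<open>\<mu> = 1 - L t\<^sup>2 / 2\<close> has a positive interior maximum: near the
  boundary the assumed estimates make it nonpositive. At such a maximum the sum of the Levi forms of
  \<open>u \<circ> T\<^sub>t\<close> and \<open>u \<circ> T\<^sub>-\<^sub>t\<close> is at most \<open>2 \<mu>\<close> times that of \<open>u\<close>. Since \<open>\<sigma>\<^sub>k\<close> is monotone and log-concave on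
  \<open>\<Gamma>\<^sub>k\<close> and the maps \<open>T\<^sub>t\<close> are unitary up to dilations, this gives
  \<open>f(T\<^sub>t z) f(T\<^sub>-\<^sub>t z) \<le> \<mu>\<^sup>2\<^sup>k f(z)\<^sup>2\<close> for the right-hand side \<open>f\<close> of the equation. But \<open>f\<close> varies along the flow
  in such a way that the left side is at least \<open>exp (- 4 (n + 1) t\<^sup>2) f(z)\<^sup>2\<close> (\<open>f_eps_symmetrized_strict\<close>), which is
  a contradiction as soon as \<open>L > 4 (n + 1)\<close>.

  Monotonicity and log-concavity of \<open>\<sigma>\<^sub>k\<close> are Garding's theory of hyperbolic polynomials: for
  \<open>A\<close> and \<open>B\<close> in \<open>\<Gamma>\<^sub>k\<close> the polynomial \<open>t \<mapsto> \<sigma>\<^sub>k(A + t B)\<close> has only negative real roots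
  (\<open>garding_negative_roots\<close>). For \<open>B = 1\<close> the roots are real by the Gauss--Lucas theorem applied to the characteristic polynomial,
  and negative because the coefficients are positive; the general case follows by deforming the matrices and following the roots.\<close>

section \<open>Sums of principal minors\<close>

text \<open>The coefficient of \<open>s\<^sup>n\<^sup>-\<^sup>k\<close> in \<open>det (A + s)\<close>. For Hermitian \<open>A\<close> it is \<open>\<sigma>\<^sub>k(A)\<close>, but unlike the eigenvalues it is a
  polynomial in the entries, which allows matrices \<open>A + t B\<close> with complex \<open>t\<close>.\<close>

definition minor_sum :: "nat \<Rightarrow> 'a::comm_ring_1^'n^'n \<Rightarrow> 'a"
  where "minor_sum k A =
    (\<Sum>I | card I = k. \<Sum>p | p permutes I. of_int (sign p) * (\<Prod>i\<in>I. A $ i $ p i))"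

definition elem_sym :: "nat \<Rightarrow> ('n::finite \<Rightarrow> 'a::comm_ring_1) \<Rightarrow> 'a"
  where "elem_sym k z = (\<Sum>I | card I = k. \<Prod>i\<in>I. z i)"

lemma sum_Pow_by_card:
  fixes F :: "'n::finite set \<Rightarrow> 'a::comm_ring_1"
  shows "(\<Sum>I\<in>UNIV. F I * s ^ (CARD('n) - card I)) =
    (\<Sum>k\<le>CARD('n). (\<Sum>I | card I = k. F I) * s ^ (CARD('n) - k))"
proof -
  have "(\<Sum>k\<le>CARD('n). \<Sum>I\<in>{I. I \<in> UNIV \<and> card I = k}. F I * s ^ (CARD('n) - card I)) =
     (\<Sum>I\<in>UNIV. F I * s ^ (CARD('n) - card I))"
    by (rule sum.group) (auto intro: card_mono)
  then show ?thesis by (auto simp: sum_distrib_right)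
qed

lemma prod_add_const_eq_elem_sym:
  fixes z :: "'n::finite \<Rightarrow> 'a::comm_ring_1"
  shows "(\<Prod>i\<in>UNIV. z i + s) = (\<Sum>k\<le>CARD('n). elem_sym k z * s ^ (CARD('n) - k))"
proof -
  have "(\<Prod>i\<in>UNIV. z i + s) = (\<Sum>I\<in>UNIV. (\<Prod>i\<in>I. z i) * s ^ (CARD('n) - card I))"
    by (simp add: prod_add card_Diff_subset)
  then show ?thesis
    by (simp add: sum_Pow_by_card elem_sym_def)
qed

lemma permutes_iff_fixes_complement:
  assumes "p permutes (UNIV :: 'n set)"
  shows "(\<forall>i\<in>-I. p i = i) \<longleftrightarrow> p permutes I"
  using assms by (auto simp: permutes_def)

text \<open>When each factor \<open>(A + s)\<^sub>i\<^sub>p\<^sub>(\<^sub>i\<^sub>)\<close> of the Leibniz formula is expanded, a permutation \<open>p\<close> contributes to the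
  power \<open>s\<^sup>n\<^sup>-\<^sup>k\<close> exactly through the \<open>k\<close>-element sets outside of which it is the identity.\<close>

lemma det_add_mat_eq_minor_sum:
  fixes A :: "'a::comm_ring_1^'n^'n"
  shows "det (A + mat s) = (\<Sum>k\<le>CARD('n). minor_sum k A * s ^ (CARD('n) - k))"
proof -
  let ?P = "{p. p permutes (UNIV :: 'n set)}"
  have *: "(\<Prod>i\<in>UNIV. (A + mat s) $ i $ p i) =
      (\<Sum>I\<in>UNIV. (if p permutes I then (\<Prod>i\<in>I. A $ i $ p i) * s ^ (CARD('n) - card I) else 0))"
    if p: "p \<in> ?P" for p
  proof -
    have "(\<Prod>i\<in>UNIV. (A + mat s) $ i $ p i) = (\<Prod>i\<in>UNIV. A $ i $ p i + (if p i = i then s else 0))"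
      by (intro prod.cong) (auto simp: mat_def)
    also have "\<dots> = (\<Sum>I\<in>UNIV. (\<Prod>i\<in>I. A $ i $ p i) * (\<Prod>i\<in>UNIV - I. if p i = i then s else 0))"
      by (simp add: prod_add)
    also have "\<dots> = (\<Sum>I\<in>UNIV. (if p permutes I then (\<Prod>i\<in>I. A $ i $ p i) * s ^ (CARD('n) - card I) else 0))"
    proof (intro sum.cong refl)
      fix I :: "'n set"
      show "(\<Prod>i\<in>I. A $ i $ p i) * (\<Prod>i\<in>UNIV - I. if p i = i then s else 0) =
        (if p permutes I then (\<Prod>i\<in>I. A $ i $ p i) * s ^ (CARD('n) - card I) else 0)"
      proof (cases "p permutes I")
        case True
        then have "\<forall>i\<in>-I. p i = i" by (auto simp: permutes_def)
        then have "(\<Prod>i\<in>UNIV - I. if p i = i then s else 0) = (\<Prod>i\<in>UNIV - I. s)"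
          by (intro prod.cong) auto
        with True show ?thesis by (simp add: card_Diff_subset)
      next
        case False
        then obtain i where "i \<in> -I" "p i \<noteq> i"
          using p permutes_iff_fixes_complement by blast
        then have "(\<Prod>i\<in>UNIV - I. if p i = i then s else 0) = 0"
          by (intro prod_zero) auto
        with False show ?thesis by simp
      qed
    qed
    finally show ?thesis .
  qed
  have "det (A + mat s) = (\<Sum>p\<in>?P. of_int (sign p) * (\<Prod>i\<in>UNIV. (A + mat s) $ i $ p i))"
    by (simp add: det_def)
  also have "\<dots> = (\<Sum>p\<in>?P. \<Sum>I\<in>UNIV. (if p permutes I then of_int (sign p) * (\<Prod>i\<in>I. A $ i $ p i) * s ^ (CARD('n) - card I) else 0))"
    by (intro sum.cong refl, subst *) (simp_all add: sum_distrib_left mult.assoc if_distrib[of "(*) _"] cong: if_cong)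
  also have "\<dots> = (\<Sum>I\<in>UNIV. \<Sum>p\<in>?P. (if p permutes I then of_int (sign p) * (\<Prod>i\<in>I. A $ i $ p i) * s ^ (CARD('n) - card I) else 0))"
    by (rule sum.swap)
  also have "\<dots> = (\<Sum>I\<in>UNIV. (\<Sum>p | p permutes I. of_int (sign p) * (\<Prod>i\<in>I. A $ i $ p i)) * s ^ (CARD('n) - card I))"
  proof (intro sum.cong refl)
    fix I :: "'n set"
    have "{p\<in>?P. p permutes I} = {p. p permutes I}"
      by (auto intro: permutes_subset)
    then show "(\<Sum>p\<in>?P. (if p permutes I then of_int (sign p) * (\<Prod>i\<in>I. A $ i $ p i) * s ^ (CARD('n) - card I) else 0))
      = (\<Sum>p | p permutes I. of_int (sign p) * (\<Prod>i\<in>I. A $ i $ p i)) * s ^ (CARD('n) - card I)"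
      by (simp add: sum.If_cases finite_permutations sum_distrib_right Int_def)
  qed
  finally show ?thesis
    by (simp add: sum_Pow_by_card minor_sum_def)
qed

lemma sum_rev_powers_eq:
  fixes c d :: "nat \<Rightarrow> complex"
  assumes "\<And>s. (\<Sum>k\<le>n. c k * s ^ (n - k)) = (\<Sum>k\<le>n. d k * s ^ (n - k))" and "k \<le> n"
  shows "c k = d k"
proof -
  have rev: "(\<Sum>k\<le>n. e k * s ^ (n - k)) = (\<Sum>k\<le>n. e (n - k) * s ^ k)" for e :: "nat \<Rightarrow> complex" and s
    by (rule sum.reindex_bij_witness[of _ "\<lambda>k. n - k" "\<lambda>k. n - k"]) auto
  have "\<forall>i\<le>n. c (n - i) = d (n - i)"
    using assms(1) unfolding rev polyfun_eq_coeffs[symmetric] by simp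
  then show ?thesis using assms(2)
    by (metis diff_diff_cancel diff_le_self)
qed

lemma minor_sum_eq_elem_sym:
  fixes A :: "complex^'n^'n" and z :: "'n \<Rightarrow> complex"
  assumes "\<And>s. det (A + mat s) = (\<Prod>i\<in>UNIV. z i + s)" and "k \<le> CARD('n)"
  shows "minor_sum k A = elem_sym k z"
  using assms sum_rev_powers_eq[of "\<lambda>k. minor_sum k A" "CARD('n)" "\<lambda>k. elem_sym k z" k]
  by (simp add: det_add_mat_eq_minor_sum prod_add_const_eq_elem_sym)

lemma minor_sum_0 [simp]: "minor_sum 0 (A :: 'a::comm_ring_1^'n^'n) = 1"
proof -
  have "{I :: 'n set. card I = 0} = {{}}" by auto
  then show ?thesis by (simp add: minor_sum_def)
qed

lemma det_add_mat_splits: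
  fixes A :: "complex^'n^'n"
  obtains z :: "'n \<Rightarrow> complex" where "\<And>s. det (A + mat s) = (\<Prod>i\<in>UNIV. z i + s)"
proof -
  let ?n = "CARD('n)"
  define P where "P = (\<Sum>k\<le>?n. monom (minor_sum k A) (?n - k))"
  have poly: "poly P s = det (A + mat s)" for s
    by (simp add: P_def poly_sum poly_monom det_add_mat_eq_minor_sum)
  have "coeff P ?n = (\<Sum>k\<le>?n. if k = 0 then minor_sum 0 A else 0)"
    unfolding P_def coeff_sum by (intro sum.cong) auto
  then have coeffn: "coeff P ?n = 1" by simp
  have "degree P \<le> ?n"
    unfolding P_def by (intro degree_sum_le) (auto intro: order.trans[OF degree_monom_le])
  moreover have "?n \<le> degree P" using coeffn by (intro le_degree) auto
  ultimately have deg: "degree P = ?n" by simp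
  have "P \<noteq> 0" using coeffn by auto
  from alg_closed_imp_factorization[OF this] obtain M
    where M: "size M = ?n" "P = (\<Prod>x\<in>#M. [:-x, 1:])"
    using deg coeffn by auto
  obtain xs where xs: "mset xs = M" using ex_mset by blast
  then have len: "length xs = ?n" using M by auto
  obtain h where h: "bij_betw h (UNIV :: 'n set) {0..<?n}"
    using ex_bij_betw_finite_nat[of "UNIV :: 'n set"] by auto
  have "det (A + mat s) = (\<Prod>i\<in>UNIV. - (xs ! h i) + s)" for s
  proof -
    have "det (A + mat s) = (\<Prod>x\<in>#M. s - x)"
      unfolding poly[symmetric] M(2) by (induction M) (auto simp: algebra_simps)
    also have "\<dots> = prod_list (map (\<lambda>x. s - x) xs)"
      by (simp add: xs[symmetric] prod_mset_prod_list flip: mset_map)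
    also have "\<dots> = (\<Prod>j\<in>{0..<?n}. s - xs ! j)"
      by (simp add: prod.list_conv_set_nth len)
    also have "\<dots> = (\<Prod>i\<in>UNIV. s - xs ! h i)"
      using prod.reindex_bij_betw[OF h, of "\<lambda>j. s - xs ! j"] by simp
    finally show ?thesis by (simp add: algebra_simps)
  qed
  then show ?thesis by (rule that)
qed

section \<open>Hermitian matrices\<close>

definition hermitian :: "complex^'n^'n \<Rightarrow> bool"
  where "hermitian A \<longleftrightarrow> (\<forall>i j. A $ j $ i = cnj (A $ i $ j))"

lemma hermitianD: "hermitian A \<Longrightarrow> cnj (A $ i $ j) = A $ j $ i"
  unfolding hermitian_def by metis
lemma hermitianI: "(\<And>i j. cnj (A $ i $ j) = A $ j $ i) \<Longrightarrow> hermitian A"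
  unfolding hermitian_def by metis

definition qform :: "complex^'n^'n \<Rightarrow> complex^'n \<Rightarrow> real"
  where "qform A w = Re (\<Sum>i\<in>UNIV. \<Sum>j\<in>UNIV. A $ i $ j * w $ i * cnj (w $ j))"

lemma norm_power2_vec: "(norm (w :: complex^'n))\<^sup>2 = (\<Sum>i\<in>UNIV. (cmod (w $ i))\<^sup>2)"
  by (simp add: norm_vec_def L2_set_def sum_nonneg)

text \<open>A Rayleigh quotient. The form \<^const>\<open>qform\<close> follows the convention of the Levi form, in which the
  vector is conjugated in the second index, so that \<open>w\<close> is the conjugate of an eigenvector.\<close>

lemma hermitian_char_root:
  assumes h: "hermitian A" and d: "det (A + mat s) = 0"
  obtains w where "w \<noteq> 0" "s = - of_real (qform A w / (norm w)\<^sup>2)"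
proof -
  from d have "\<not> invertible (A + mat s)" by (simp add: invertible_det_nz)
  then obtain x where x: "x \<noteq> 0" "(A + mat s) *v x = 0"
    unfolding invertible_left_inverse matrix_left_invertible_ker by auto
  define w where "w = (\<chi> i. cnj (x $ i))"
  have w: "w \<noteq> 0" using x(1) by (auto simp: w_def vec_eq_iff)
  define q where "q = (\<Sum>i\<in>UNIV. \<Sum>j\<in>UNIV. A $ i $ j * w $ i * cnj (w $ j))"
  have hc: "cnj (A $ i $ j) = A $ j $ i" for i j using h by (metis hermitian_def)
  have "cnj q = (\<Sum>i\<in>UNIV. \<Sum>j\<in>UNIV. A $ j $ i * cnj (w $ i) * w $ j)"
    by (simp add: q_def hc)
  also have "\<dots> = q"
    unfolding q_def by (subst sum.swap) (simp add: mult_ac)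
  finally have "q \<in> \<real>" by (simp add: Reals_cnj_iff)
  moreover have "qform A w = Re q" unfolding qform_def q_def ..
  ultimately have q: "q = of_real (qform A w)" by (simp add: of_real_Re)
  have row: "(\<Sum>j\<in>UNIV. A $ i $ j * x $ j) = - s * x $ i" for i
  proof -
    have "((A + mat s) *v x) $ i = (\<Sum>j\<in>UNIV. A $ i $ j * x $ j) + (\<Sum>j\<in>UNIV. mat s $ i $ j * x $ j)"
      by (simp add: matrix_vector_mult_def sum.distrib distrib_right)
    also have "(\<Sum>j\<in>UNIV. mat s $ i $ j * x $ j) = (\<Sum>j\<in>UNIV. if i = j then s * x $ j else 0)"
      by (intro sum.cong) (auto simp: mat_def)
    finally show ?thesis using x(2) by (simp add: eq_neg_iff_add_eq_0)
  qed
  have "q = (\<Sum>i\<in>UNIV. w $ i * (\<Sum>j\<in>UNIV. A $ i $ j * x $ j))"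
    unfolding q_def by (simp add: w_def sum_distrib_left mult_ac cong: sum.cong)
  also have "\<dots> = - s * (\<Sum>i\<in>UNIV. w $ i * cnj (w $ i))"
    unfolding row by (simp add: sum_distrib_left w_def mult_ac sum_negf)
  also have "\<dots> = - s * of_real ((norm w)\<^sup>2)"
    by (simp add: norm_power2_vec complex_norm_square del: of_real_power)
  finally have "s = - of_real (qform A w / (norm w)\<^sup>2)"
    using w q by (simp add: field_simps add_eq_0_iff)
  then show ?thesis using w that by blast
qed

lemma hermitian_splits:
  fixes A :: "complex^'n^'n"
  assumes h: "hermitian A"
  obtains l :: "real^'n" where "\<And>s. det (A + mat s) = (\<Prod>i\<in>UNIV. of_real (l $ i) + s)"
    and "\<And>i. \<exists>w. w \<noteq> 0 \<and> l $ i = qform A w / (norm w)\<^sup>2"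
proof -
  obtain z :: "'n \<Rightarrow> complex" where z: "\<And>s. det (A + mat s) = (\<Prod>i\<in>UNIV. z i + s)"
    using det_add_mat_splits[of A] by blast
  have *: "\<exists>w. w \<noteq> 0 \<and> z i = of_real (qform A w / (norm w)\<^sup>2)" for i
  proof -
    have "det (A + mat (- z i)) = 0" unfolding z by (intro prod_zero) auto
    then show ?thesis by (metis h hermitian_char_root minus_equation_iff)
  qed
  show ?thesis
  proof (rule that[of "\<chi> i. Re (z i)"])
    have "of_real (Re (z i)) = z i" for i using *[of i] by auto
    then show "det (A + mat s) = (\<Prod>i\<in>UNIV. of_real ((\<chi> i. Re (z i)) $ i) + s)" for s by (simp add: z)
    show "\<exists>w. w \<noteq> 0 \<and> (\<chi> i. Re (z i)) $ i = qform A w / (norm w)\<^sup>2" for i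
      using *[of i] by (metis Re_complex_of_real vec_lambda_beta)
  qed
qed

lemma det_uminus: "det (- A :: 'a::comm_ring_1^'n^'n) = (- 1) ^ CARD('n) * det A"
proof -
  have "(\<chi> i. (-1) *s (A $ i)) = - A" by (simp add: vec_eq_iff)
  then show ?thesis using det_rows_mul[of "\<lambda>_. - 1" "\<lambda>i. A $ i"] by simp
qed

lemma minor_sum_eq_sigma_k:
  fixes A :: "complex^'n^'n"
  assumes "hermitian A" "k \<le> CARD('n)"
  shows "minor_sum k A = of_real (sigma_k k A)"
proof -
  obtain l :: "real^'n" where l: "\<And>s. det (A + mat s) = (\<Prod>i\<in>UNIV. of_real (l $ i) + s)"
    using hermitian_splits[OF assms(1)] by blast
  have neg: "mat t - A = - (A + mat (- t))" for t by (simp add: vec_eq_iff mat_def)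
  have "det (mat t - A) = (\<Prod>i\<in>UNIV. t - of_real (l $ i))" for t
    unfolding neg det_uminus l prod_uminus[symmetric] by (intro prod.cong) auto
  then have "\<exists>l::real^'n. \<forall>t::complex. det (mat t - A) = (\<Prod>i\<in>UNIV. t - of_real (l $ i))" by blast
  then have e: "det (mat t - A) = (\<Prod>i\<in>UNIV. t - of_real (eigenvalues A $ i))" for t
    unfolding eigenvalues_def by (rule someI2_ex) auto
  have neg': "A + mat s = - (mat (- s) - A)" for s by (simp add: vec_eq_iff mat_def)
  have "det (A + mat s) = (\<Prod>i\<in>UNIV. of_real (eigenvalues A $ i) + s)" for s
    unfolding neg' det_uminus e prod_uminus[symmetric] by (intro prod.cong) auto
  from minor_sum_eq_elem_sym[OF this assms(2)] show ?thesis
    by (simp add: elem_sym_def sigma_k_def esym_def)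
qed

section \<open>Hyperbolicity in the direction of the identity\<close>

lemma log_derivative_upper_half_plane:
  fixes M :: "complex multiset"
  assumes "\<And>a. a \<in># M \<Longrightarrow> Im a < 0" and s: "0 \<le> Im s"
  defines "q \<equiv> (\<Prod>a\<in>#M. [:-a, 1:])"
  shows "poly q s \<noteq> 0 \<and> Im (poly (pderiv q) s / poly q s) \<le> 0 \<and>
    (M \<noteq> {#} \<longrightarrow> Im (poly (pderiv q) s / poly q s) < 0)"
  using assms(1) unfolding q_def
proof (induction M)
  case empty
  then show ?case by simp
next
  case (add a M)
  define r where "r = (\<Prod>a\<in>#M. [:-a, 1:])"
  have IH: "poly r s \<noteq> 0" "Im (poly (pderiv r) s / poly r s) \<le> 0"
    using add unfolding r_def by auto
  have a: "Im a < 0" using add.prems by simp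
  have sa: "s - a \<noteq> 0" using a s by auto
  have eq: "poly (pderiv ([:-a, 1:] * r)) s / poly ([:-a, 1:] * r) s =
    poly (pderiv r) s / poly r s + 1 / (s - a)"
    using IH(1) sa by (simp add: pderiv_mult pderiv_pCons pderiv_diff pderiv_smult field_simps)
  have "Im (1 / (s - a)) < 0"
    using a s sa by (simp add: Im_divide divide_less_0_iff sum_power2_gt_zero_iff complex_eq_iff)
  then show ?case
    using IH sa eq by (auto simp: r_def[symmetric])
qed

text \<open>Gauss--Lucas for a half plane: the logarithmic derivative \<open>\<Sum> 1 / (s - a)\<close> cannot vanish when all
  the \<open>s - a\<close> lie in the upper half plane.\<close>

lemma pderiv_nonzero_upper_half_plane:
  fixes p :: "complex poly"
  assumes deg: "0 < degree p" and nz: "\<And>s. 0 \<le> Im s \<Longrightarrow> poly p s \<noteq> 0" and s: "0 \<le> Im s"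
  shows "poly (pderiv p) s \<noteq> 0"
proof -
  have p0: "p \<noteq> 0" using deg by auto
  obtain M where M: "size M = degree p" "p = smult (lead_coeff p) (\<Prod>x\<in>#M. [:-x, 1:])"
    using alg_closed_imp_factorization[OF p0] by blast
  define q where "q = (\<Prod>x\<in>#M. [:-x, 1:])"
  have pq: "p = smult (lead_coeff p) q" using M(2) by (simp add: q_def)
  have "Im a < 0" if "a \<in># M" for a
  proof -
    have "poly q a = 0" unfolding q_def using that by (auto simp: poly_prod_mset prod_mset_zero_iff)
    then have "poly p a = 0" by (subst pq) simp
    then show ?thesis using nz[of a] by force
  qed
  then have "Im (poly (pderiv q) s / poly q s) < 0"
    using log_derivative_upper_half_plane[of M s] s M(1) deg by (auto simp: q_def)
  then have "poly (pderiv q) s \<noteq> 0" by auto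
  then show ?thesis using p0 by (subst pq) (simp add: pderiv_smult)
qed

text \<open>Up to a factorial, the \<open>k\<close>-th elementary symmetric function of the \<open>z\<^sub>i\<close> is the value at \<open>0\<close> of the
  \<open>(n - k)\<close>-th derivative of \<open>\<Prod> (x + z\<^sub>i)\<close>, whose roots lie in the lower half plane.\<close>

lemma elem_sym_nonzero_upper_half_plane:
  fixes z :: "'n::finite \<Rightarrow> complex"
  assumes z: "\<And>i. 0 < Im (z i)" and k: "k \<le> CARD('n)"
  shows "elem_sym k z \<noteq> 0"
proof -
  let ?n = "CARD('n)"
  define P where "P = (\<Prod>i\<in>UNIV. [:z i, 1:])"
  have deg: "degree P = ?n"
    unfolding P_def by (subst degree_prod_eq_sum_degree) auto
  have P_alt: "P = (\<Sum>k\<le>?n. monom (elem_sym k z) (?n - k))"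
  proof -
    have "poly P s = poly (\<Sum>k\<le>?n. monom (elem_sym k z) (?n - k)) s" for s
      by (simp add: P_def poly_prod poly_sum poly_monom prod_add_const_eq_elem_sym[symmetric])
    then show ?thesis by (simp add: poly_eq_poly_eq_iff[symmetric] fun_eq_iff)
  qed
  have nz: "0 \<le> Im s \<Longrightarrow> poly ((pderiv ^^ m) P) s \<noteq> 0" if "m \<le> ?n" for m s
    using that
  proof (induction m arbitrary: s)
    case 0
    have "z i + s \<noteq> 0" for i using z[of i] 0(1) by (auto simp: complex_eq_iff)
    then show ?case by (simp add: P_def poly_prod)
  next
    case (Suc m)
    have "0 < degree ((pderiv ^^ m) P)"
      using Suc.prems by (simp add: degree_higher_pderiv deg)
    then have "poly (pderiv ((pderiv ^^ m) P)) s \<noteq> 0"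
      by (rule pderiv_nonzero_upper_half_plane) (use Suc in auto)
    then show ?case by simp
  qed
  have "poly ((pderiv ^^ (?n - k)) P) 0 \<noteq> 0" by (rule nz) auto
  then have "coeff P (?n - k) \<noteq> 0"
    by (simp add: poly_0_coeff_0 coeff_higher_pderiv)
  moreover have "coeff P (?n - k) = (\<Sum>j\<le>?n. if j = k then elem_sym j z else 0)"
    unfolding P_alt coeff_sum using k by (intro sum.cong) auto
  ultimately show ?thesis using k by auto
qed

lemma mat_add: "mat (x + y) = mat x + (mat y :: 'a::comm_ring_1^'n^'n)"
  by (simp add: vec_eq_iff mat_def)

lemma minor_sum_add_mat_nonzero:
  fixes A :: "complex^'n^'n"
  assumes "hermitian A" and s: "0 < Im s" and k: "k \<le> CARD('n)"
  shows "minor_sum k (A + mat s) \<noteq> 0"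
proof -
  obtain l :: "real^'n" where l: "\<And>s. det (A + mat s) = (\<Prod>i\<in>UNIV. of_real (l $ i) + s)"
    using hermitian_splits[OF assms(1)] by blast
  have "det (A + mat s + mat t) = (\<Prod>i\<in>UNIV. (of_real (l $ i) + s) + t)" for t
    using l[of "s + t"] by (simp add: mat_add add.assoc)
  from minor_sum_eq_elem_sym[OF this k] show ?thesis
    using elem_sym_nonzero_upper_half_plane[of "\<lambda>i. of_real (l $ i) + s"] s k by simp
qed

definition cscale :: "complex \<Rightarrow> complex^'n^'n \<Rightarrow> complex^'n^'n"
  where "cscale t A = (\<chi> i j. t * A $ i $ j)"

lemma cscale_nth [simp]: "cscale t A $ i $ j = t * A $ i $ j"
  by (simp add: cscale_def)

lemma minor_sum_cscale: "minor_sum k (cscale t A) = t ^ k * minor_sum k A"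
  by (simp add: minor_sum_def prod.distrib sum_distrib_left mult_ac)

lemma cscale_cscale [simp]: "cscale s (cscale t A) = cscale (s * t) A"
  by (simp add: vec_eq_iff mult_ac)
lemma cscale_mat [simp]: "cscale s (mat t) = mat (s * t)"
  by (simp add: vec_eq_iff mat_def)
lemma cscale_add: "cscale s (A + B) = cscale s A + cscale s B"
  by (simp add: vec_eq_iff algebra_simps)
lemma cscale_1 [simp]: "cscale 1 A = A" by (simp add: vec_eq_iff)
lemma cscale_0 [simp]: "cscale 0 A = 0" by (simp add: vec_eq_iff)

lemma hermitian_add: "hermitian A \<Longrightarrow> hermitian B \<Longrightarrow> hermitian (A + B)"
  by (rule hermitianI) (simp add: hermitianD)
lemma hermitian_mat: "hermitian (mat (of_real x))"
  by (rule hermitianI) (simp add: mat_def)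
lemma hermitian_cscale: "hermitian A \<Longrightarrow> hermitian (cscale (of_real x) A)"
  by (rule hermitianI) (simp add: hermitianD)

lemma continuous_on_minor_sum [continuous_intros]:
  fixes f :: "'a::topological_space \<Rightarrow> complex^'n^'n"
  assumes "continuous_on S f"
  shows "continuous_on S (\<lambda>x. minor_sum k (f x))"
  unfolding minor_sum_def by (intro continuous_intros assms)

lemma continuous_on_cscale [continuous_intros]:
  fixes f :: "'a::topological_space \<Rightarrow> complex^'n^'n"
  assumes "continuous_on S f" "continuous_on S g"
  shows "continuous_on S (\<lambda>x. cscale (g x) (f x))"
  unfolding cscale_def by (intro continuous_intros assms)

lemma continuous_on_mat [continuous_intros]:
  fixes g :: "'a::topological_space \<Rightarrow> complex"
  assumes "continuous_on S g"
  shows "continuous_on S (\<lambda>x. mat (g x) :: complex^'n^'n)"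
proof -
  have "(\<lambda>x. mat (g x) :: complex^'n^'n) = (\<lambda>x. cscale (g x) (mat 1))" by simp
  then show ?thesis using assms by (simp only:) (intro continuous_intros)
qed

section \<open>Garding's theory of the cone \<open>\<Gamma>\<^sub>k\<close>\<close>

definition gamma_cone :: "nat \<Rightarrow> complex^'n^'n \<Rightarrow> bool"
  where "gamma_cone k A \<longleftrightarrow> hermitian A \<and> (\<forall>j\<in>{1..k}. 0 < sigma_k j A)"

text \<open>The Taylor expansion in \<open>x\<close>, read off from \<open>det (A + (x + s)) = \<Sum> \<sigma>\<^sub>i(A) (x + s)\<^sup>n\<^sup>-\<^sup>i\<close>. All its coefficients are
  nonnegative when \<open>A\<close> lies in the cone, which is how membership in \<open>\<Gamma>\<^sub>k\<close> enters the root counting below.\<close>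

lemma sigma_k_add_mat:
  fixes A :: "complex^'n^'n"
  assumes A: "hermitian A" and j: "j \<le> CARD('n)"
  shows "sigma_k j (A + mat (of_real x)) =
    (\<Sum>i\<le>CARD('n). sigma_k i A * of_nat ((CARD('n) - i) choose (CARD('n) - j)) * x ^ (j - i))"
proof -
  let ?n = "CARD('n)"
  define d where "d j = (\<Sum>i\<le>?n. minor_sum i A * of_nat ((?n - i) choose (?n - j)) * of_real x ^ (j - i))" for j
  have "minor_sum j (A + mat (of_real x)) = d j"
  proof (rule sum_rev_powers_eq[of "\<lambda>j. minor_sum j (A + mat (of_real x))" "?n"])
    fix s :: complex
    have "(\<Sum>k\<le>?n. minor_sum k (A + mat (of_real x)) * s ^ (?n - k)) = det (A + mat (of_real x + s))"
      by (simp add: det_add_mat_eq_minor_sum[symmetric] mat_add add.assoc)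
    also have "\<dots> = (\<Sum>i\<le>?n. minor_sum i A * (of_real x + s) ^ (?n - i))"
      by (simp add: det_add_mat_eq_minor_sum)
    also have "\<dots> = (\<Sum>i\<le>?n. \<Sum>k\<le>?n. minor_sum i A * of_nat ((?n - i) choose (?n - k)) * of_real x ^ (k - i) * s ^ (?n - k))"
    proof (intro sum.cong refl)
      fix i assume i: "i \<in> {..?n}"
      have "(s + of_real x) ^ (?n - i) = (\<Sum>m\<le>?n - i. of_nat ((?n - i) choose m) * s ^ m * of_real x ^ (?n - i - m))"
        by (rule binomial_ring)
      also have "\<dots> = (\<Sum>m\<le>?n. of_nat ((?n - i) choose m) * s ^ m * of_real x ^ (?n - i - m))"
        by (rule sum.mono_neutral_left) auto
      also have "\<dots> = (\<Sum>k\<le>?n. of_nat ((?n - i) choose (?n - k)) * s ^ (?n - k) * of_real x ^ (?n - i - (?n - k)))"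
        by (rule sum.reindex_bij_witness[of _ "\<lambda>k. ?n - k" "\<lambda>k. ?n - k"]) auto
      also have "\<dots> = (\<Sum>k\<le>?n. of_nat ((?n - i) choose (?n - k)) * s ^ (?n - k) * of_real x ^ (k - i))"
        using i by (intro sum.cong) auto
      finally show "minor_sum i A * (of_real x + s) ^ (?n - i) =
        (\<Sum>k\<le>?n. minor_sum i A * of_nat ((?n - i) choose (?n - k)) * of_real x ^ (k - i) * s ^ (?n - k))"
        by (simp add: add.commute sum_distrib_left mult_ac)
    qed
    also have "\<dots> = (\<Sum>k\<le>?n. d k * s ^ (?n - k))"
      by (subst sum.swap) (simp add: d_def sum_distrib_right)
    finally show "(\<Sum>k\<le>?n. minor_sum k (A + mat (of_real x)) * s ^ (?n - k)) = (\<Sum>k\<le>?n. d k * s ^ (?n - k))" .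
  qed (rule j)
  also have "d j = of_real (\<Sum>i\<le>CARD('n). sigma_k i A * of_nat ((CARD('n) - i) choose (CARD('n) - j)) * x ^ (j - i))"
    unfolding d_def of_real_sum using A by (intro sum.cong) (auto simp: minor_sum_eq_sigma_k)
  finally show ?thesis
    using A j by (simp add: minor_sum_eq_sigma_k hermitian_add hermitian_mat del: of_real_sum)
qed

lemma sigma_k_0: "hermitian A \<Longrightarrow> sigma_k 0 A = 1"
  using minor_sum_eq_sigma_k[of A 0] by simp

lemma gamma_cone_add_mat:
  fixes A :: "complex^'n^'n"
  assumes A: "gamma_cone k A" and x: "0 \<le> x" and k: "k \<le> CARD('n)"
  shows "gamma_cone k (A + mat (of_real x))"
proof -
  have h: "hermitian A" using A by (simp add: gamma_cone_def)
  have "0 < sigma_k j (A + mat (of_real x))" if j: "j \<in> {1..k}" for j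
  proof -
    have pos: "0 \<le> sigma_k i A * of_nat ((CARD('n) - i) choose (CARD('n) - j)) * x ^ (j - i)" if "i \<le> CARD('n)" for i
    proof (cases "i \<le> j")
      case True
      have "0 \<le> sigma_k i A"
        using True j A sigma_k_0[OF h] by (cases "i = 0") (auto simp: gamma_cone_def less_imp_le)
      then show ?thesis using x by simp
    next
      case False
      then have "CARD('n) - i < CARD('n) - j" using that by auto
      then show ?thesis by (simp add: binomial_eq_0)
    qed
    have "0 < sigma_k j A" using A j by (simp add: gamma_cone_def)
    also have "\<dots> = sigma_k j A * of_nat ((CARD('n) - j) choose (CARD('n) - j)) * x ^ (j - j)" by simp
    also have "\<dots> \<le> (\<Sum>i\<le>CARD('n). sigma_k i A * of_nat ((CARD('n) - i) choose (CARD('n) - j)) * x ^ (j - i))"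
      by (rule member_le_sum) (use j k pos in auto)
    finally show ?thesis using sigma_k_add_mat[OF h] j k by simp
  qed
  then show ?thesis using h by (simp add: gamma_cone_def hermitian_add hermitian_mat)
qed

lemma sigma_k_cscale:
  fixes A :: "complex^'n^'n"
  assumes "hermitian A" "k \<le> CARD('n)"
  shows "sigma_k k (cscale (of_real x) A) = x ^ k * sigma_k k A"
proof -
  have "complex_of_real (sigma_k k (cscale (of_real x) A)) = of_real (x ^ k * sigma_k k A)"
    using assms by (simp add: minor_sum_eq_sigma_k[symmetric] hermitian_cscale minor_sum_cscale)
  then show ?thesis by (simp only: of_real_eq_iff)
qed

lemma gamma_cone_cscale:
  fixes A :: "complex^'n^'n"
  assumes "gamma_cone k A" "0 < x" "k \<le> CARD('n)"
  shows "gamma_cone k (cscale (of_real x) A)"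
  using assms by (auto simp: gamma_cone_def hermitian_cscale sigma_k_cscale)

lemma gamma_cone_mat: "0 < x \<Longrightarrow> k \<le> CARD('n) \<Longrightarrow> gamma_cone k (mat (of_real x) :: complex^'n^'n)"
proof -
  assume x: "0 < x" and k: "k \<le> CARD('n)"
  have h: "hermitian (0 :: complex^'n^'n)" by (rule hermitianI) simp
  have z: "sigma_k i (0 :: complex^'n^'n) = (if i = 0 then 1 else 0)" if "i \<le> CARD('n)" for i
    using sigma_k_cscale[OF h that, of 0] sigma_k_0[OF h] by (auto simp: power_0_left)
  have "0 < sigma_k j (0 + mat (of_real x) :: complex^'n^'n)" if "j \<in> {1..k}" for j
  proof -
    have j: "j \<le> CARD('n)" using that k by simp
    have "sigma_k j (0 + mat (of_real x) :: complex^'n^'n) =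
        (\<Sum>i\<le>CARD('n). if i = 0 then of_nat (CARD('n) choose (CARD('n) - j)) * x ^ j else 0)"
      unfolding sigma_k_add_mat[OF h j] by (intro sum.cong) (auto simp: z)
    then show ?thesis using x j by (simp add: zero_less_binomial)
  qed
  then show "gamma_cone k (mat (of_real x) :: complex^'n^'n)"
    by (simp add: gamma_cone_def hermitian_mat)
qed

lemma gamma_cone_mono: "gamma_cone k A \<Longrightarrow> j \<le> k \<Longrightarrow> gamma_cone j A"
  by (auto simp: gamma_cone_def)

lemma gamma_cone_minor_sum_nonzero:
  fixes A :: "complex^'n^'n"
  assumes "gamma_cone k A" "k \<le> CARD('n)"
  shows "minor_sum k A \<noteq> 0"
proof (cases "k = 0")
  case False
  then have "0 < sigma_k k A" using assms by (simp add: gamma_cone_def)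
  then show ?thesis using assms by (simp add: minor_sum_eq_sigma_k gamma_cone_def)
qed simp

lemma gamma_cone_add_mat_root:
  fixes B :: "complex^'n^'n"
  assumes B: "gamma_cone k B" and k: "k \<le> CARD('n)" and root: "minor_sum k (B + mat x) = 0"
  shows "Im x = 0 \<and> Re x < 0"
proof -
  have hB: "hermitian B" using B by (simp add: gamma_cone_def)
  have hmB: "hermitian (cscale (-1) B)" using hermitian_cscale[OF hB, of "-1"] by simp
  have "\<not> 0 < Im x" using minor_sum_add_mat_nonzero[OF hB _ k] root by blast
  moreover have "\<not> Im x < 0"
  proof
    assume "Im x < 0"
    then have "minor_sum k (cscale (-1) B + mat (- x)) \<noteq> 0"
      using minor_sum_add_mat_nonzero[OF hmB _ k] by simp
    moreover have "cscale (-1) B + mat (- x) = cscale (-1) (B + mat x)" by (simp add: cscale_add)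
    ultimately show False using root by (simp add: minor_sum_cscale)
  qed
  ultimately have im: "Im x = 0" by simp
  then have "x = of_real (Re x)" by (simp add: complex_eq_iff)
  moreover have "minor_sum k (B + mat (of_real (Re x))) \<noteq> 0" if "0 \<le> Re x"
    using gamma_cone_minor_sum_nonzero[OF gamma_cone_add_mat[OF B that k] k] .
  ultimately have "Re x < 0" using root by force
  with im show ?thesis by simp
qed

lemma coeff_prod_linear:
  fixes a b :: "'i \<Rightarrow> complex"
  assumes "finite I"
  shows "degree (\<Prod>i\<in>I. [:a i, b i:]) \<le> card I \<and> coeff (\<Prod>i\<in>I. [:a i, b i:]) (card I) = (\<Prod>i\<in>I. b i)"
  using assms
proof induction
  case empty
  then show ?case by simp
next
  case (insert x I)
  define q where "q = (\<Prod>i\<in>I. [:a i, b i:])"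
  have q: "degree q \<le> card I" "coeff q (card I) = prod b I" using insert by (auto simp: q_def)
  have "degree ([:a x, b x:] * q) \<le> Suc (card I)"
    using degree_mult_le[of "[:a x, b x:]" q] q(1) by (auto intro: order.trans split: if_splits)
  moreover have "coeff ([:a x, b x:] * q) (Suc (card I)) = b x * prod b I"
    using q by (simp add: coeff_eq_0)
  ultimately show ?case using insert by (simp add: q_def[symmetric])
qed

text \<open>The degree in \<open>t\<close> is at most \<open>k\<close> because each minor has \<open>k\<close> rows, and the coefficient of \<open>t\<^sup>k\<close> is the minor
  sum of \<open>B\<close>.\<close>

lemma minor_sum_line_splits:
  fixes X B :: "complex^'n^'n"
  assumes nz: "minor_sum k B \<noteq> 0"
  obtains rs where "length rs = k"
    "\<And>t. minor_sum k (X + cscale t B) = minor_sum k B * prod_list (map (\<lambda>r. t - r) rs)"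
proof -
  define Q where "Q = (\<Sum>I | card I = k. \<Sum>p | p permutes I.
     smult (of_int (sign p)) (\<Prod>i\<in>I. [:X $ i $ p i, B $ i $ p i:]))"
  have polyQ: "poly Q t = minor_sum k (X + cscale t B)" for t
    by (simp add: Q_def minor_sum_def poly_sum poly_prod)
  have fin: "finite (I :: 'n set)" for I by simp
  have "degree Q \<le> k"
    unfolding Q_def
    by (intro degree_sum_le order.trans[OF degree_smult_le] order.trans[OF coeff_prod_linear[OF fin, THEN conjunct1]])
       (auto simp: finite_permutations)
  moreover have coeff: "coeff Q k = minor_sum k B"
  proof -
    have "coeff Q k = (\<Sum>I | card I = k. \<Sum>p | p permutes I.
       of_int (sign p) * coeff (\<Prod>i\<in>I. [:X $ i $ p i, B $ i $ p i:]) (card I))"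
      unfolding Q_def coeff_sum coeff_smult by (intro sum.cong refl) auto
    then show ?thesis
      unfolding coeff_prod_linear[OF fin, THEN conjunct2] minor_sum_def .
  qed
  ultimately have deg: "degree Q = k" using nz
    by (metis le_antisym le_degree)
  have "Q \<noteq> 0" using nz coeff by auto
  from alg_closed_imp_factorization[OF this] obtain M
    where M: "size M = k" "Q = smult (minor_sum k B) (\<Prod>x\<in>#M. [:-x, 1:])"
    using deg coeff by auto
  obtain rs where rs: "mset rs = M" using ex_mset by blast
  have "minor_sum k (X + cscale t B) = minor_sum k B * prod_list (map (\<lambda>r. t - r) rs)" for t
  proof -
    have "poly (prod_list (map (\<lambda>x. [:-x, 1:]) rs)) t = prod_list (map (\<lambda>r. t - r) rs)"
      by (induction rs) (auto simp: algebra_simps)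
    moreover have "(\<Prod>x\<in>#M. [:-x, 1:]) = prod_list (map (\<lambda>x. [:-x, 1:]) rs)"
      by (simp add: rs[symmetric] prod_mset_prod_list flip: mset_map)
    ultimately show ?thesis by (simp add: polyQ[symmetric] M(2))
  qed
  moreover have "length rs = k" using rs M(1) by auto
  ultimately show ?thesis using that by blast
qed

lemma norm_prod_list_ge:
  fixes rs :: "complex list"
  assumes "\<And>r. r \<in> set rs \<Longrightarrow> \<rho> \<le> norm (t - r)" and "0 \<le> \<rho>"
  shows "\<rho> ^ length rs \<le> norm (prod_list (map (\<lambda>r. t - r) rs))"
  using assms(1)
proof (induction rs)
  case (Cons r rs)
  then have "\<rho> * \<rho> ^ length rs \<le> norm (t - r) * norm (prod_list (map (\<lambda>r. t - r) rs))"
    using \<open>0 \<le> \<rho>\<close> by (intro mult_mono) auto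
  then show ?case by (simp add: norm_mult)
qed simp

text \<open>Persistence of roots: the modulus of a polynomial at \<open>t\<close> bounds the distance from \<open>t\<close> to the nearest root.\<close>

lemma root_persists:
  fixes X :: "real \<Rightarrow> complex^'n^'n"
  assumes X: "continuous_on S X" and s0: "s0 \<in> S" and nz: "minor_sum k B \<noteq> 0"
    and U: "open U" "t0 \<in> U" and root: "minor_sum k (X s0 + cscale t0 B) = 0"
  obtains d where "0 < d" "\<And>s. s \<in> S \<Longrightarrow> dist s s0 < d \<Longrightarrow> \<exists>t\<in>U. minor_sum k (X s + cscale t B) = 0"
proof -
  obtain \<rho> where \<rho>: "0 < \<rho>" "ball t0 \<rho> \<subseteq> U" using U openE by blast
  have "continuous_on S (\<lambda>s. minor_sum k (X s + cscale t0 B))"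
    by (intro continuous_intros X)
  moreover have pos: "0 < norm (minor_sum k B) * \<rho> ^ k" using nz \<rho> by simp
  ultimately obtain d where d: "0 < d" "\<And>s. s \<in> S \<Longrightarrow> dist s s0 < d \<Longrightarrow>
      dist (minor_sum k (X s + cscale t0 B)) (minor_sum k (X s0 + cscale t0 B)) < norm (minor_sum k B) * \<rho> ^ k"
    using s0 unfolding continuous_on_iff by meson
  show ?thesis
  proof (rule that[OF d(1)])
    fix s assume s: "s \<in> S" "dist s s0 < d"
    have small: "norm (minor_sum k (X s + cscale t0 B)) < norm (minor_sum k B) * \<rho> ^ k"
      using d(2)[OF s] root by simp
    obtain rs where rs: "length rs = k"
      "\<And>t. minor_sum k (X s + cscale t B) = minor_sum k B * prod_list (map (\<lambda>r. t - r) rs)"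
      using minor_sum_line_splits[OF nz, of "X s"] by metis
    have "\<exists>r\<in>set rs. norm (t0 - r) < \<rho>"
    proof (rule ccontr)
      assume "\<not> ?thesis"
      then have "\<rho> ^ k \<le> norm (prod_list (map (\<lambda>r. t0 - r) rs))"
        using norm_prod_list_ge[of rs \<rho> t0] \<rho> rs(1) by force
      then have "norm (minor_sum k B) * \<rho> ^ k \<le> norm (minor_sum k (X s + cscale t0 B))"
        unfolding rs(2) norm_mult by (rule mult_left_mono) simp
      with small show False by simp
    qed
    then obtain r where r: "r \<in> set rs" "norm (t0 - r) < \<rho>" by blast
    have "r \<in> U" using r \<rho> by (auto simp: dist_norm)
    moreover have "prod_list (map (\<lambda>x. r - x) rs) = 0" using r(1) by (auto simp: prod_list_zero_iff)
    then have "minor_sum k (X s + cscale r B) = 0" by (simp add: rs(2))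
    ultimately show "\<exists>t\<in>U. minor_sum k (X s + cscale t B) = 0" by blast
  qed
qed

lemma norm_cscale:
  fixes A :: "complex^'n^'n"
  shows "norm (cscale t A) = norm t * norm A"
proof -
  have "cscale t A $ i = t *s (A $ i)" for i by (simp add: vec_eq_iff)
  moreover have "norm (t *s v) = norm t * norm v" for v :: "complex^'n"
    by (simp add: norm_vec_def norm_mult L2_set_right_distrib)
  ultimately have "norm (cscale t A) = L2_set (\<lambda>i. norm t * norm (A $ i)) UNIV"
    by (simp only: norm_vec_def[of "cscale t A"])
  then show ?thesis by (simp add: norm_vec_def[of A] L2_set_right_distrib)
qed

text \<open>By homogeneity \<open>minor_sum k (X + t B) = t\<^sup>k minor_sum k (B + X / t)\<close>, and for large \<open>t\<close> the argument is close
  to \<open>B\<close>.\<close>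

lemma roots_bounded:
  fixes X :: "real \<Rightarrow> complex^'n^'n"
  assumes X: "continuous_on S X" and S: "compact S" and nz: "minor_sum k B \<noteq> 0"
  obtains M where "\<And>s t. s \<in> S \<Longrightarrow> minor_sum k (X s + cscale t B) = 0 \<Longrightarrow> norm t \<le> M"
proof -
  have "bounded (X ` S)" using compact_continuous_image[OF X S] compact_imp_bounded by blast
  then obtain N where N: "0 < N" "\<And>s. s \<in> S \<Longrightarrow> norm (X s) \<le> N"
    unfolding bounded_pos by auto
  have "continuous_on UNIV (\<lambda>Y :: complex^'n^'n. minor_sum k Y)" by (intro continuous_intros)
  then obtain d where d: "0 < d" "\<And>Y. dist Y B < d \<Longrightarrow> dist (minor_sum k Y) (minor_sum k B) < norm (minor_sum k B)"
    using nz unfolding continuous_on_iff by (metis UNIV_I zero_less_norm_iff)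
  have "norm t \<le> N / d" if s: "s \<in> S" and r: "minor_sum k (X s + cscale t B) = 0" for s t
  proof (rule ccontr)
    assume "\<not> ?thesis"
    then have t: "N / d < norm t" by simp
    then have t0: "t \<noteq> 0" using N(1) d(1) by (auto simp: divide_less_0_iff)
    have "X s + cscale t B = cscale t (B + cscale (1 / t) (X s))"
      using t0 by (simp add: cscale_add add.commute)
    then have "minor_sum k (B + cscale (1 / t) (X s)) = 0"
      using r t0 by (simp add: minor_sum_cscale)
    moreover have "dist (B + cscale (1 / t) (X s)) B < d"
    proof -
      have "norm (X s) / norm t \<le> N / norm t" by (intro divide_right_mono N s) simp
      also have "\<dots> < d" using t t0 d(1) by (simp add: field_simps)
      finally show ?thesis by (simp add: dist_norm norm_cscale norm_divide)
    qed
    ultimately show False using d(2) by force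
  qed
  then show ?thesis using that by blast
qed

text \<open>The parameters \<open>s\<close> for which some root lies in \<open>U\<close> form a subset of \<open>[0, 1]\<close> that is open, because roots persist, and
  closed, because roots are bounded and never lie on the boundary of \<open>U\<close>.\<close>

lemma root_free_homotopy:
  fixes X :: "real \<Rightarrow> complex^'n^'n"
  assumes X: "continuous_on {0..1} X" and nz: "minor_sum k B \<noteq> 0" and U: "open U"
    and front: "\<And>s t. s \<in> {0..1} \<Longrightarrow> t \<in> frontier U \<Longrightarrow> minor_sum k (X s + cscale t B) \<noteq> 0"
    and start: "\<And>t. t \<in> U \<Longrightarrow> minor_sum k (X 0 + cscale t B) \<noteq> 0"
    and t: "t \<in> U"
  shows "minor_sum k (X 1 + cscale t B) \<noteq> 0"
proof
  assume root1: "minor_sum k (X 1 + cscale t B) = 0"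
  define T where "T = {s \<in> {0..1}. \<exists>t\<in>U. minor_sum k (X s + cscale t B) = 0}"
  obtain M where M: "\<And>s t. s \<in> {0..1} \<Longrightarrow> minor_sum k (X s + cscale t B) = 0 \<Longrightarrow> norm t \<le> M"
    using roots_bounded[OF X _ nz] by blast
  define Z where "Z = {z \<in> {0..1} \<times> (cball 0 M \<inter> closure U). minor_sum k (X (fst z) + cscale (snd z) B) = 0}"
  have T_eq: "T = fst ` Z"
  proof
    show "T \<subseteq> fst ` Z"
    proof
      fix s assume "s \<in> T"
      then obtain t where "s \<in> {0..1}" "t \<in> U" "minor_sum k (X s + cscale t B) = 0" by (auto simp: T_def)
      then have "(s, t) \<in> Z" using M[of s t] closure_subset by (auto simp: Z_def)
      then show "s \<in> fst ` Z" by force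
    qed
    show "fst ` Z \<subseteq> T"
    proof
      fix s assume "s \<in> fst ` Z"
      then obtain t where "s \<in> {0..1}" "t \<in> closure U" "minor_sum k (X s + cscale t B) = 0"
        by (auto simp: Z_def)
      moreover have "closure U = U \<union> frontier U" using closure_Un_frontier by blast
      ultimately show "s \<in> T" using front[of s t] by (auto simp: T_def)
    qed
  qed
  have comp: "compact ({0..1::real} \<times> (cball 0 M \<inter> closure U))"
    by (intro compact_Times compact_Int_closed) auto
  have "continuous_on ({0..1} \<times> (cball 0 M \<inter> closure U)) (\<lambda>z. minor_sum k (X (fst z) + cscale (snd z) B))"
    by (intro continuous_intros continuous_on_compose2[OF X]) auto
  then have "closed Z"
    unfolding Z_def using comp continuous_closed_preimage_constant compact_imp_closed by blast
  from compact_Int_closed[OF comp this] have "compact Z"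
    by (simp add: Int_absorb1 Z_def Collect_conj_eq Int_assoc[symmetric])
  then have "compact T" unfolding T_eq by (intro compact_continuous_image continuous_intros)
  then have closedin: "closedin (top_of_set {0..1}) T"
    by (intro closed_subset compact_imp_closed) (auto simp: T_def)
  have openin: "openin (top_of_set {0..1}) T"
    unfolding openin_euclidean_subtopology_iff
  proof (intro conjI ballI)
    show "T \<subseteq> {0..1}" by (auto simp: T_def)
    fix s0 assume "s0 \<in> T"
    then obtain t0 where *: "s0 \<in> {0..1}" "t0 \<in> U" "minor_sum k (X s0 + cscale t0 B) = 0" by (auto simp: T_def)
    obtain d where "0 < d" "\<And>s. s \<in> {0..1} \<Longrightarrow> dist s s0 < d \<Longrightarrow> \<exists>t\<in>U. minor_sum k (X s + cscale t B) = 0"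
      using root_persists[OF X *(1) nz U *(2,3)] by blast
    then show "\<exists>e>0. \<forall>x'\<in>{0..1}. dist x' s0 < e \<longrightarrow> x' \<in> T" by (auto simp: T_def)
  qed
  have "connected {0..1::real}" by simp
  then have "T = {} \<or> T = {0..1}" using closedin openin unfolding connected_clopen by blast
  moreover have "1 \<in> T" using root1 t by (auto simp: T_def)
  moreover have "0 \<notin> T" using start by (auto simp: T_def)
  ultimately show False by force
qed

text \<open>Garding's argument: contract \<open>A\<close> to \<open>0\<close> and follow the roots \<open>t\<close>. They cannot cross the real axis, because for real
  \<open>t\<close> the matrix \<open>A + t B\<close> is Hermitian and hyperbolicity in the direction of the identity applies; and for \<open>A = 0\<close>
  they are negative multiples of \<open>s\<close>.\<close>

lemma garding_upper_half_plane:
  fixes A B :: "complex^'n^'n"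
  assumes A: "hermitian A" and B: "gamma_cone k B" and k: "k \<le> CARD('n)"
    and s: "0 < Im s" and t: "0 < Im t"
  shows "minor_sum k (A + mat s + cscale t B) \<noteq> 0"
proof -
  have hB: "hermitian B" using B by (simp add: gamma_cone_def)
  define X where "X \<tau> = cscale (of_real \<tau>) A + mat s" for \<tau>
  have "minor_sum k (X 1 + cscale t B) \<noteq> 0"
  proof (rule root_free_homotopy[of X k B "{t. 0 < Im t}"])
    show "continuous_on {0..1} X" unfolding X_def by (intro continuous_intros)
    show "minor_sum k B \<noteq> 0" by (rule gamma_cone_minor_sum_nonzero[OF B k])
    show "open {t. 0 < Im t}" by (rule open_halfspace_Im_gt)
    show "t \<in> {t. 0 < Im t}" using t by simp
  next
    fix \<tau> t assume "t \<in> frontier {t. 0 < Im t}"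
    moreover have "frontier {t. 0 < Im t} \<subseteq> {t. Im t = 0}"
    proof -
      have "closure {t. 0 < Im t} \<subseteq> {t. 0 \<le> Im t}"
        by (rule closure_minimal) (auto simp: closed_halfspace_Im_ge)
      then show ?thesis by (auto simp: frontier_def interior_open[OF open_halfspace_Im_gt])
    qed
    ultimately have t: "t = of_real (Re t)" by (auto simp: complex_eq_iff)
    have h: "hermitian (cscale (of_real \<tau>) A + cscale (of_real (Re t)) B)"
      by (intro hermitian_add hermitian_cscale A hB)
    have "X \<tau> + cscale t B = cscale (of_real \<tau>) A + cscale (of_real (Re t)) B + mat s"
      by (subst t) (simp add: X_def)
    then show "minor_sum k (X \<tau> + cscale t B) \<noteq> 0"
      using minor_sum_add_mat_nonzero[OF h s k] by simp
  next
    fix t assume t: "t \<in> {t. 0 < Im t}"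
    then have t0: "t \<noteq> 0" by auto
    show "minor_sum k (X 0 + cscale t B) \<noteq> 0"
    proof
      assume r: "minor_sum k (X 0 + cscale t B) = 0"
      have "X 0 + cscale t B = cscale t (B + mat (s / t))" using t0 by (simp add: X_def cscale_add)
      then have "minor_sum k (B + mat (s / t)) = 0" using r t0 by (simp add: minor_sum_cscale)
      from gamma_cone_add_mat_root[OF B k this] have *: "s / t = of_real (Re (s / t))" "Re (s / t) < 0"
        by (auto simp: complex_eq_iff)
      then have "s = of_real (Re (s / t)) * t" using t0 by (metis nonzero_eq_divide_eq)
      then have "Im s = Re (s / t) * Im t" by (metis Im_complex_of_real Re_complex_of_real mult_zero_left add_0_right times_complex.sel(2))
      then show False using s t * by (simp add: mult_less_0_iff) (metis less_asym mult_neg_pos)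
    qed
  qed
  then show ?thesis by (simp add: X_def)
qed

text \<open>Let \<open>s\<close> tend to \<open>0\<close> along the positive imaginary axis: a root in the upper half plane would persist.\<close>

lemma garding_real_roots:
  fixes A B :: "complex^'n^'n"
  assumes A: "hermitian A" and B: "gamma_cone k B" and k: "k \<le> CARD('n)"
    and root: "minor_sum k (A + cscale t B) = 0"
  shows "Im t = 0"
proof -
  have pos: "\<not> 0 < Im t" if A: "hermitian A" and root: "minor_sum k (A + cscale t B) = 0" for A t
  proof
    assume t: "0 < Im t"
    define X where "X \<tau> = A + mat (of_real \<tau> * \<i>)" for \<tau>
    have cont: "continuous_on {0..1} X" unfolding X_def by (intro continuous_intros)
    have root0: "minor_sum k (X 0 + cscale t B) = 0" using root by (simp add: X_def)
    obtain d where d: "0 < d" "\<And>\<tau>. \<tau> \<in> {0..1} \<Longrightarrow> dist \<tau> 0 < d \<Longrightarrow> \<exists>t\<in>{t. 0 < Im t}. minor_sum k (X \<tau> + cscale t B) = 0"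
      using root_persists[OF cont _ gamma_cone_minor_sum_nonzero[OF B k] open_halfspace_Im_gt _ root0, of 0] t by auto
    define \<tau> where "\<tau> = min 1 (d / 2)"
    have \<tau>: "\<tau> \<in> {0..1}" "dist \<tau> 0 < d" "0 < \<tau>" using d(1) by (auto simp: \<tau>_def min_def)
    from d(2)[OF \<tau>(1,2)] obtain t' where "0 < Im t'" "minor_sum k (X \<tau> + cscale t' B) = 0" by auto
    then show False
      using garding_upper_half_plane[OF A B k, of "of_real \<tau> * \<i>" t'] \<tau>(3) by (simp add: X_def)
  qed
  have "\<not> 0 < Im t" by (rule pos[OF A root])
  moreover have "\<not> 0 < Im (- t)"
  proof (rule pos)
    show "hermitian (cscale (of_real (-1)) A)" by (rule hermitian_cscale[OF A])
    have "cscale (of_real (-1)) A + cscale (- t) B = cscale (-1) (A + cscale t B)" by (simp add: cscale_add)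
    then show "minor_sum k (cscale (of_real (-1)) A + cscale (- t) B) = 0" using root by (simp add: minor_sum_cscale)
  qed
  ultimately show ?thesis by simp
qed

text \<open>Deform \<open>A\<close> inside the cone to the identity, where the roots are known to be negative. All roots stay real, and \<open>0\<close> is never a root because
  \<open>\<sigma>\<^sub>k\<close> is positive on the cone, so no root enters the right half plane.\<close>

lemma garding_negative_roots:
  fixes A B :: "complex^'n^'n"
  assumes A: "gamma_cone k A" and B: "gamma_cone k B" and k: "k \<le> CARD('n)"
    and root: "minor_sum k (A + cscale t B) = 0"
  shows "Im t = 0 \<and> Re t < 0"
proof -
  have hA: "hermitian A" using A by (simp add: gamma_cone_def)
  define X where "X \<tau> = cscale (of_real \<tau>) A + mat (of_real (1 - \<tau>))" for \<tau> :: real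
  have X: "gamma_cone k (X \<tau>)" if "\<tau> \<in> {0..1}" for \<tau>
  proof (cases "\<tau> = 0")
    case True
    then show ?thesis using gamma_cone_mat[of 1 k, where 'n='n] k by (simp add: X_def)
  next
    case False
    then show ?thesis unfolding X_def using that
      by (intro gamma_cone_add_mat gamma_cone_cscale A k) auto
  qed
  have right: "minor_sum k (X 1 + cscale t B) \<noteq> 0" if t: "0 < Re t" for t
  proof (rule root_free_homotopy[of X k B "{t. 0 < Re t}"])
    show "continuous_on {0..1} X" unfolding X_def by (intro continuous_intros)
    show "minor_sum k B \<noteq> 0" by (rule gamma_cone_minor_sum_nonzero[OF B k])
    show "open {t. 0 < Re t}" by (rule open_halfspace_Re_gt)
    show "t \<in> {t. 0 < Re t}" using t by simp
  next
    fix \<tau> :: real and t assume \<tau>: "\<tau> \<in> {0..1}" and "t \<in> frontier {t. 0 < Re t}"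
    moreover have "frontier {t. 0 < Re t} \<subseteq> {t. Re t = 0}"
    proof -
      have "closure {t. 0 < Re t} \<subseteq> {t. 0 \<le> Re t}"
        by (rule closure_minimal) (auto simp: closed_halfspace_Re_ge)
      then show ?thesis by (auto simp: frontier_def interior_open[OF open_halfspace_Re_gt])
    qed
    ultimately have Re: "Re t = 0" by auto
    show "minor_sum k (X \<tau> + cscale t B) \<noteq> 0"
    proof
      assume r: "minor_sum k (X \<tau> + cscale t B) = 0"
      have "hermitian (X \<tau>)" using X[OF \<tau>] by (simp add: gamma_cone_def)
      from garding_real_roots[OF this B k r] Re have "t = 0" by (simp add: complex_eq_iff)
      then show False using r gamma_cone_minor_sum_nonzero[OF X[OF \<tau>] k] by simp
    qed
  next
    fix t assume t: "t \<in> {t. 0 < Re t}"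
    then have t0: "t \<noteq> 0" by auto
    show "minor_sum k (X 0 + cscale t B) \<noteq> 0"
    proof
      assume r: "minor_sum k (X 0 + cscale t B) = 0"
      have "X 0 + cscale t B = cscale t (B + mat (1 / t))" using t0 by (simp add: X_def cscale_add)
      then have "minor_sum k (B + mat (1 / t)) = 0" using r t0 by (simp add: minor_sum_cscale)
      from gamma_cone_add_mat_root[OF B k this] have "Re (1 / t) < 0" by simp
      then show False using t by (simp add: Re_divide divide_less_0_iff) (smt (verit) zero_le_power2)
    qed
  qed
  have im: "Im t = 0" by (rule garding_real_roots[OF hA B k root])
  have "\<not> 0 < Re t" using right[of t] root by (auto simp: X_def)
  moreover have "Re t \<noteq> 0"
  proof
    assume "Re t = 0"
    then have "t = 0" using im by (simp add: complex_eq_iff)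
    then show False using root gamma_cone_minor_sum_nonzero[OF A k] by simp
  qed
  ultimately show ?thesis using im by simp
qed

lemma sigma_k_pencil_splits:
  fixes A B :: "complex^'n^'n"
  assumes A: "gamma_cone k A" and B: "gamma_cone k B" and k: "k \<le> CARD('n)"
  obtains \<rho>s where "length \<rho>s = k" "\<And>\<rho>. \<rho> \<in> set \<rho>s \<Longrightarrow> 0 < \<rho>"
    "\<And>t. sigma_k k (A + cscale (of_real t) B) = sigma_k k B * prod_list (map (\<lambda>\<rho>. t + \<rho>) \<rho>s)"
proof -
  have hA: "hermitian A" and hB: "hermitian B" using A B by (auto simp: gamma_cone_def)
  obtain rs where rs: "length rs = k"
    "\<And>t. minor_sum k (A + cscale t B) = minor_sum k B * prod_list (map (\<lambda>r. t - r) rs)"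
    using minor_sum_line_splits[OF gamma_cone_minor_sum_nonzero[OF B k], of A] by metis
  have r: "Im r = 0 \<and> Re r < 0" if "r \<in> set rs" for r
  proof -
    have "prod_list (map (\<lambda>x. r - x) rs) = 0" using that by (auto simp: prod_list_zero_iff)
    then have "minor_sum k (A + cscale r B) = 0" by (simp add: rs(2))
    then show ?thesis by (rule garding_negative_roots[OF A B k])
  qed
  show ?thesis
  proof (rule that[of "map (\<lambda>r. - Re r) rs"])
    show "length (map (\<lambda>r. - Re r) rs) = k" using rs by simp
    show "\<And>\<rho>. \<rho> \<in> set (map (\<lambda>r. - Re r) rs) \<Longrightarrow> 0 < \<rho>" using r by auto
    fix t
    have "prod_list (map (\<lambda>r. of_real t - r) rs) = of_real (prod_list (map (\<lambda>\<rho>. t + \<rho>) (map (\<lambda>r. - Re r) rs)))"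
      using r by (induction rs) (auto simp: complex_eq_iff)
    then have "complex_of_real (sigma_k k (A + cscale (of_real t) B)) =
        of_real (sigma_k k B * prod_list (map (\<lambda>\<rho>. t + \<rho>) (map (\<lambda>r. - Re r) rs)))"
      using rs(2)[of "of_real t"] k by (simp add: minor_sum_eq_sigma_k hA hB hermitian_add hermitian_cscale)
    then show "sigma_k k (A + cscale (of_real t) B) = sigma_k k B * prod_list (map (\<lambda>\<rho>. t + \<rho>) (map (\<lambda>r. - Re r) rs))"
      by (simp only: of_real_eq_iff)
  qed
qed

lemma gamma_cone_sigma_k_pos:
  fixes A :: "complex^'n^'n"
  shows "gamma_cone k A \<Longrightarrow> 0 < sigma_k k A"
  by (cases "k = 0") (auto simp: gamma_cone_def sigma_k_0)

lemma gamma_cone_add: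
  fixes A B :: "complex^'n^'n"
  assumes A: "gamma_cone k A" and B: "gamma_cone k B" and k: "k \<le> CARD('n)"
  shows "gamma_cone k (A + B)"
proof -
  have "0 < sigma_k j (A + B)" if j: "j \<in> {1..k}" for j
  proof -
    have Aj: "gamma_cone j A" and Bj: "gamma_cone j B" using A B j by (auto intro: gamma_cone_mono)
    have jn: "j \<le> CARD('n)" using j k by simp
    obtain \<rho>s where \<rho>s: "length \<rho>s = j" "\<And>\<rho>. \<rho> \<in> set \<rho>s \<Longrightarrow> 0 < \<rho>"
        "\<And>t. sigma_k j (A + cscale (of_real t) B) = sigma_k j B * prod_list (map (\<lambda>\<rho>. t + \<rho>) \<rho>s)"
      using sigma_k_pencil_splits[OF Aj Bj jn] by metis
    have "0 < prod_list (map (\<lambda>\<rho>. 1 + \<rho>) \<rho>s)"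
      using \<rho>s(2) by (induction \<rho>s) (auto intro!: mult_pos_pos add_pos_pos)
    then show ?thesis using \<rho>s(3)[of 1] gamma_cone_sigma_k_pos[OF Bj] by simp
  qed
  then show ?thesis using A B by (auto simp: gamma_cone_def hermitian_add)
qed

text \<open>Midpoint log-concavity: factor by factor this is \<open>(1 + \<rho>)\<^sup>2 \<ge> 4 \<rho>\<close>.\<close>

lemma sigma_k_log_concave:
  fixes A B :: "complex^'n^'n"
  assumes A: "gamma_cone k A" and B: "gamma_cone k B" and k: "k \<le> CARD('n)"
  shows "4 ^ k * (sigma_k k A * sigma_k k B) \<le> (sigma_k k (A + B))\<^sup>2"
proof -
  obtain \<rho>s where \<rho>s: "length \<rho>s = k" "\<And>\<rho>. \<rho> \<in> set \<rho>s \<Longrightarrow> 0 < \<rho>"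
      "\<And>t. sigma_k k (A + cscale (of_real t) B) = sigma_k k B * prod_list (map (\<lambda>\<rho>. t + \<rho>) \<rho>s)"
    using sigma_k_pencil_splits[OF A B k] by metis
  have *: "4 ^ length \<rho>s * prod_list \<rho>s \<le> (prod_list (map (\<lambda>\<rho>. 1 + \<rho>) \<rho>s))\<^sup>2"
    using \<rho>s(2)
  proof (induction \<rho>s)
    case (Cons \<rho> \<rho>s)
    have nn: "0 \<le> prod_list \<rho>s" using Cons.prems by (intro prod_list_nonneg) (auto intro: less_imp_le)
    have "0 \<le> (1 - \<rho>)\<^sup>2" by simp
    then have "4 * \<rho> \<le> (1 + \<rho>)\<^sup>2" by (simp add: power2_eq_square algebra_simps)
    then have "(4 * \<rho>) * (4 ^ length \<rho>s * prod_list \<rho>s) \<le> (1 + \<rho>)\<^sup>2 * (prod_list (map (\<lambda>\<rho>. 1 + \<rho>) \<rho>s))\<^sup>2"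
      using Cons nn by (intro mult_mono) auto
    then show ?case by (simp add: power_mult_distrib mult_ac)
  qed simp
  have "4 ^ k * (sigma_k k A * sigma_k k B) = (sigma_k k B)\<^sup>2 * (4 ^ length \<rho>s * prod_list \<rho>s)"
    using \<rho>s(3)[of 0] \<rho>s(1) by (simp add: power2_eq_square)
  also have "\<dots> \<le> (sigma_k k B)\<^sup>2 * (prod_list (map (\<lambda>\<rho>. 1 + \<rho>) \<rho>s))\<^sup>2"
    using * by (rule mult_left_mono) simp
  also have "\<dots> = (sigma_k k (A + B))\<^sup>2"
    using \<rho>s(3)[of 1] by (simp add: power_mult_distrib)
  finally show ?thesis .
qed

lemma qform_add: "qform (A + B) w = qform A w + qform B w"
  by (simp add: qform_def distrib_right sum.distrib)

lemma qform_cscale: "qform (cscale (of_real x) A) w = x * qform A w"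
proof -
  have "(\<Sum>i\<in>UNIV. \<Sum>j\<in>UNIV. cscale (of_real x) A $ i $ j * w $ i * cnj (w $ j)) =
     of_real x * (\<Sum>i\<in>UNIV. \<Sum>j\<in>UNIV. A $ i $ j * w $ i * cnj (w $ j))"
    by (simp add: sum_distrib_left mult.assoc)
  moreover have "Re (of_real x * q) = x * Re q" for q by simp
  ultimately show ?thesis by (simp only: qform_def)
qed

lemma positive_definite_gamma_cone:
  fixes P :: "complex^'n^'n"
  assumes P: "hermitian P" and pos: "\<And>w. 0 \<le> qform P w" and d: "0 < \<delta>" and k: "k \<le> CARD('n)"
  shows "gamma_cone k (P + mat (of_real \<delta>))"
proof -
  obtain l :: "real^'n" where l: "\<And>s. det (P + mat s) = (\<Prod>i\<in>UNIV. of_real (l $ i) + s)"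
    "\<And>i. \<exists>w. w \<noteq> 0 \<and> l $ i = qform P w / (norm w)\<^sup>2"
    using hermitian_splits[OF P] by metis
  have nn: "0 \<le> l $ i" for i using l(2)[of i] pos by auto
  have "0 \<le> sigma_k j P" if j: "j \<le> CARD('n)" for j
  proof -
    have "complex_of_real (sigma_k j P) = elem_sym j (\<lambda>i. of_real (l $ i))"
      using minor_sum_eq_elem_sym[OF l(1) j] minor_sum_eq_sigma_k[OF P j] by simp
    also have "\<dots> = of_real (esym j l)" by (simp add: elem_sym_def esym_def)
    finally have "sigma_k j P = esym j l" by (simp only: of_real_eq_iff)
    also have "\<dots> \<ge> 0" unfolding esym_def using nn by (intro sum_nonneg prod_nonneg) auto
    finally show ?thesis .
  qed
  note sig = this
  have "0 < sigma_k j (P + mat (of_real \<delta>))" if j: "j \<in> {1..k}" for j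
  proof -
    have jn: "j \<le> CARD('n)" using j k by simp
    have "0 < sigma_k 0 P * of_nat ((CARD('n) - 0) choose (CARD('n) - j)) * \<delta> ^ (j - 0)"
      using d jn by (simp add: sigma_k_0[OF P] zero_less_binomial)
    also have "\<dots> \<le> (\<Sum>i\<le>CARD('n). sigma_k i P * of_nat ((CARD('n) - i) choose (CARD('n) - j)) * \<delta> ^ (j - i))"
      by (rule member_le_sum) (use sig d in auto)
    finally show ?thesis using sigma_k_add_mat[OF P jn] by simp
  qed
  then show ?thesis using P by (simp add: gamma_cone_def hermitian_add hermitian_mat)
qed

text \<open>After adding a small multiple of the identity, \<open>P\<close> lies in the cone, and then
  \<open>t \<mapsto> \<sigma>\<^sub>k(A + t P)\<close> increases for \<open>t \<ge> 0\<close> since its roots are negative.\<close>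

lemma sigma_k_mono:
  fixes A P :: "complex^'n^'n"
  assumes A: "gamma_cone k A" and P: "hermitian P" and pos: "\<And>w. 0 \<le> qform P w" and k: "k \<le> CARD('n)"
  shows "sigma_k k A \<le> sigma_k k (A + P)"
proof -
  have hA: "hermitian A" using A by (simp add: gamma_cone_def)
  have le: "sigma_k k A \<le> sigma_k k (A + (P + mat (of_real \<delta>)))" if d: "0 < \<delta>" for \<delta>
  proof -
    have B: "gamma_cone k (P + mat (of_real \<delta>))" (is "gamma_cone k ?B")
      by (rule positive_definite_gamma_cone[OF P pos d k])
    obtain \<rho>s where \<rho>s: "length \<rho>s = k" "\<And>\<rho>. \<rho> \<in> set \<rho>s \<Longrightarrow> 0 < \<rho>"
        "\<And>t. sigma_k k (A + cscale (of_real t) ?B) = sigma_k k ?B * prod_list (map (\<lambda>\<rho>. t + \<rho>) \<rho>s)"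
      using sigma_k_pencil_splits[OF A B k] by metis
    have "0 \<le> prod_list \<rho>s \<and> prod_list \<rho>s \<le> prod_list (map (\<lambda>\<rho>. 1 + \<rho>) \<rho>s)"
      using \<rho>s(2)
    proof (induction \<rho>s)
      case (Cons \<rho> \<rho>s)
      then have "0 \<le> prod_list \<rho>s" "prod_list \<rho>s \<le> prod_list (map (\<lambda>\<rho>. 1 + \<rho>) \<rho>s)" by auto
      moreover have "0 < \<rho>" using Cons.prems by simp
      ultimately show ?case by (auto intro!: mult_mono mult_nonneg_nonneg)
    qed simp
    then have "sigma_k k ?B * prod_list \<rho>s \<le> sigma_k k ?B * prod_list (map (\<lambda>\<rho>. 1 + \<rho>) \<rho>s)"
      using gamma_cone_sigma_k_pos[OF B] by (intro mult_left_mono) auto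
    then show ?thesis using \<rho>s(3)[of 0] \<rho>s(3)[of 1] by simp
  qed
  have cont: "continuous_on {0..1} (\<lambda>\<delta>. Re (minor_sum k (A + (P + mat (of_real \<delta>)))))"
    by (intro continuous_intros)
  have eq: "Re (minor_sum k (A + (P + mat (of_real \<delta>)))) = sigma_k k (A + (P + mat (of_real \<delta>)))" for \<delta>
    by (simp add: minor_sum_eq_sigma_k k hA P hermitian_add hermitian_mat)
  have "((\<lambda>\<delta>. Re (minor_sum k (A + (P + mat (of_real \<delta>))))) \<longlongrightarrow> Re (minor_sum k (A + (P + mat (of_real 0))))) (at 0 within {0..1})"
    using cont[unfolded continuous_on, rule_format, of 0] by simp
  then have lim: "((\<lambda>\<delta>. sigma_k k (A + (P + mat (of_real \<delta>)))) \<longlongrightarrow> sigma_k k (A + P)) (at 0 within {0..1})"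
    unfolding eq by simp
  show ?thesis
  proof (rule tendsto_lowerbound[OF lim])
    show "\<forall>\<^sub>F \<delta> in at 0 within {0..1}. sigma_k k A \<le> sigma_k k (A + (P + mat (of_real \<delta>)))"
      unfolding eventually_at using le by (intro exI[of _ 1]) auto
    show "at (0::real) within {0..1} \<noteq> bot" by (simp add: trivial_limit_within islimpt_Icc)
  qed
qed

section \<open>Second derivatives\<close>

definition hess_form :: "('a::euclidean_space \<Rightarrow> real) \<Rightarrow> 'a \<Rightarrow> 'a \<Rightarrow> real"
  where "hess_form u x h = (\<Sum>b\<in>Basis. \<Sum>c\<in>Basis. hess u x b c * (h \<bullet> b) * (h \<bullet> c))"

lemma grad_inner: "grad u x \<bullet> h = (\<Sum>b\<in>Basis. pdiff b u x * (h \<bullet> b))"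
  by (simp add: grad_def inner_sum_left inner_commute[of h])

lemma differentiable_has_derivative_pdiff:
  fixes f :: "'a::euclidean_space \<Rightarrow> 'b::real_normed_vector"
  assumes "f differentiable (at x)"
  shows "(f has_derivative (\<lambda>h. \<Sum>b\<in>Basis. (h \<bullet> b) *\<^sub>R pdiff b f x)) (at x)"
proof -
  have d: "(f has_derivative frechet_derivative f (at x)) (at x)"
    using assms frechet_derivative_works by blast
  then have lin: "linear (frechet_derivative f (at x))" by (rule has_derivative_linear)
  have "frechet_derivative f (at x) h = (\<Sum>b\<in>Basis. (h \<bullet> b) *\<^sub>R pdiff b f x)" for h
  proof -
    have "frechet_derivative f (at x) h = frechet_derivative f (at x) (\<Sum>b\<in>Basis. (h \<bullet> b) *\<^sub>R b)"
      by (simp add: euclidean_representation)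
    then show ?thesis by (simp add: linear_sum[OF lin] linear_cmul[OF lin] pdiff_def)
  qed
  with d show ?thesis by (metis (no_types, lifting) ext)
qed

lemma C_on_2_derivatives:
  fixes u :: "'a::euclidean_space \<Rightarrow> real"
  assumes u: "C_on 2 u S" and S: "open S"
  shows C_on_2_grad: "x \<in> S \<Longrightarrow> (u has_derivative (\<lambda>h. grad u x \<bullet> h)) (at x)"
    and C_on_2_pdiff: "x \<in> S \<Longrightarrow> c \<in> Basis \<Longrightarrow>
      (pdiff c u has_derivative (\<lambda>h. \<Sum>b\<in>Basis. (h \<bullet> b) * hess u x b c)) (at x)"
    and C_on_2_hess: "b \<in> Basis \<Longrightarrow> c \<in> Basis \<Longrightarrow> continuous_on S (\<lambda>x. hess u x b c)"
    and C_on_2_cont_pdiff: "c \<in> Basis \<Longrightarrow> continuous_on S (pdiff c u)"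
proof -
  have 0: "pdiffs [] u differentiable_on S" using u unfolding C_on_def by (force dest: bspec[of _ _ "[]"])
  have 1: "c \<in> Basis \<Longrightarrow> pdiffs [c] u differentiable_on S \<and> continuous_on S (pdiffs [c] u)" for c
    using u unfolding C_on_def by (force dest: bspec[of _ _ "[c]"])
  have 2: "b \<in> Basis \<Longrightarrow> c \<in> Basis \<Longrightarrow> continuous_on S (pdiffs [b, c] u)" for b c
    using u unfolding C_on_def by (force dest: bspec[of _ _ "[b, c]"])
  show "x \<in> S \<Longrightarrow> (u has_derivative (\<lambda>h. grad u x \<bullet> h)) (at x)"
    using differentiable_has_derivative_pdiff[of u x] 0 S
    by (simp add: differentiable_on_eq_differentiable_at grad_inner mult.commute)
  show "x \<in> S \<Longrightarrow> c \<in> Basis \<Longrightarrow>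
      (pdiff c u has_derivative (\<lambda>h. \<Sum>b\<in>Basis. (h \<bullet> b) * hess u x b c)) (at x)"
    using differentiable_has_derivative_pdiff[of "pdiff c u" x] 1[of c] S
    by (simp add: differentiable_on_eq_differentiable_at hess_def)
  show "b \<in> Basis \<Longrightarrow> c \<in> Basis \<Longrightarrow> continuous_on S (\<lambda>x. hess u x b c)"
    using 2[of b c] by (simp add: hess_def)
  show "c \<in> Basis \<Longrightarrow> continuous_on S (pdiff c u)" using 1[of c] by simp
qed

lemma curve_derivative:
  fixes f :: "'a::euclidean_space \<Rightarrow> real"
  assumes g: "(\<gamma> has_vector_derivative v) (at t)" and f: "(f has_derivative f') (at (\<gamma> t))"
  shows "((\<lambda>t. f (\<gamma> t)) has_real_derivative f' v) (at t)"
proof -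
  have "((\<lambda>t. f (\<gamma> t)) has_derivative (\<lambda>s. f' (s *\<^sub>R v))) (at t)"
    using has_derivative_compose[OF g[unfolded has_vector_derivative_def] f] .
  moreover have "(\<lambda>s. f' (s *\<^sub>R v)) = (\<lambda>s. f' v * s)"
    using linear_cmul[OF has_derivative_linear[OF f]] by (auto simp: mult.commute)
  ultimately show ?thesis by (simp add: has_field_derivative_def)
qed

lemma curve_second_derivative:
  fixes u :: "'a::euclidean_space \<Rightarrow> real"
  assumes u: "C_on 2 u S" and S: "open S" and x: "\<gamma> t \<in> S"
    and g: "(\<gamma> has_vector_derivative \<gamma>1 t) (at t)" and g1: "(\<gamma>1 has_vector_derivative v) (at t)"
  shows "((\<lambda>t. grad u (\<gamma> t) \<bullet> \<gamma>1 t) has_real_derivative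
    hess_form u (\<gamma> t) (\<gamma>1 t) + grad u (\<gamma> t) \<bullet> v) (at t)"
proof -
  have p: "((\<lambda>t. pdiff c u (\<gamma> t)) has_real_derivative (\<Sum>b\<in>Basis. (\<gamma>1 t \<bullet> b) * hess u (\<gamma> t) b c)) (at t)"
    if "c \<in> Basis" for c
    by (rule curve_derivative[OF g C_on_2_pdiff[OF u S x that]])
  have q: "((\<lambda>t. \<gamma>1 t \<bullet> c) has_real_derivative v \<bullet> c) (at t)" for c
  proof (rule curve_derivative[OF g1])
    show "((\<lambda>x. x \<bullet> c) has_derivative (\<lambda>x. x \<bullet> c)) (at (\<gamma>1 t))"
      by (rule bounded_linear.has_derivative[OF bounded_linear_inner_left has_derivative_ident])
  qed
  have "((\<lambda>t. \<Sum>c\<in>Basis. pdiff c u (\<gamma> t) * (\<gamma>1 t \<bullet> c)) has_real_derivative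
    (\<Sum>c\<in>Basis. (\<Sum>b\<in>Basis. (\<gamma>1 t \<bullet> b) * hess u (\<gamma> t) b c) * (\<gamma>1 t \<bullet> c) + (v \<bullet> c) * pdiff c u (\<gamma> t))) (at t)"
    by (intro DERIV_sum DERIV_mult p q)
  moreover have "(\<Sum>c\<in>Basis. (\<Sum>b\<in>Basis. (\<gamma>1 t \<bullet> b) * hess u (\<gamma> t) b c) * (\<gamma>1 t \<bullet> c) + (v \<bullet> c) * pdiff c u (\<gamma> t))
    = hess_form u (\<gamma> t) (\<gamma>1 t) + grad u (\<gamma> t) \<bullet> v"
  proof -
    have "(\<Sum>c\<in>Basis. (\<Sum>b\<in>Basis. (\<gamma>1 t \<bullet> b) * hess u (\<gamma> t) b c) * (\<gamma>1 t \<bullet> c)) = hess_form u (\<gamma> t) (\<gamma>1 t)"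
      unfolding hess_form_def by (subst sum.swap) (simp add: sum_distrib_left sum_distrib_right mult_ac)
    then show ?thesis by (simp add: sum.distrib grad_inner mult.commute)
  qed
  ultimately show ?thesis by (simp add: grad_inner)
qed

text \<open>The second difference \<open>u(x + hb + hc) - u(x + hb) - u(x + hc) + u(x)\<close> is symmetric in the two
  directions, and by two applications of the mean value theorem it is \<open>h\<^sup>2\<close> times a mixed second derivative
  at a nearby point, in either order.\<close>

lemma mixed_difference:
  fixes u :: "'a::euclidean_space \<Rightarrow> real"
  assumes u: "C_on 2 u S" and S: "open S" and b: "b \<in> Basis" and c: "c \<in> Basis"
    and h: "0 < h" and ball: "cball x (2 * h) \<subseteq> S"
  obtains y where "dist x y \<le> 2 * h"
    "u (x + h *\<^sub>R b + h *\<^sub>R c) - u (x + h *\<^sub>R b) - u (x + h *\<^sub>R c) + u x = h * h * hess u y c b"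
proof -
  have inS: "x + s *\<^sub>R b + r *\<^sub>R c \<in> cball x (2 * h)" if "0 \<le> s" "s \<le> h" "0 \<le> r" "r \<le> h" for s r
  proof -
    have "norm (s *\<^sub>R b + r *\<^sub>R c) \<le> norm (s *\<^sub>R b) + norm (r *\<^sub>R c)" by (rule norm_triangle_ineq)
    also have "\<dots> = s + r" using that b c by simp
    finally have "norm (s *\<^sub>R b + r *\<^sub>R c) \<le> 2 * h" using that by simp
    moreover have "dist x (x + s *\<^sub>R b + r *\<^sub>R c) = norm (s *\<^sub>R b + r *\<^sub>R c)"
      by (metis add.assoc add_diff_cancel_left' dist_commute dist_norm)
    ultimately show ?thesis by simp
  qed
  define \<phi> where "\<phi> s = u (x + s *\<^sub>R b + h *\<^sub>R c) - u (x + s *\<^sub>R b + 0 *\<^sub>R c)" for s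
  define \<phi>' where "\<phi>' s = pdiff b u (x + s *\<^sub>R b + h *\<^sub>R c) - pdiff b u (x + s *\<^sub>R b + 0 *\<^sub>R c)" for s
  have gb: "grad u y \<bullet> b = pdiff b u y" for y
    using b by (simp add: grad_inner inner_Basis if_distrib cong: if_cong)
  have d1: "((\<lambda>s. u (x + s *\<^sub>R b + r *\<^sub>R c)) has_real_derivative pdiff b u (x + s *\<^sub>R b + r *\<^sub>R c)) (at s)"
    if "0 \<le> s" "s \<le> h" "0 \<le> r" "r \<le> h" for s r
  proof -
    have "x + s *\<^sub>R b + r *\<^sub>R c \<in> S" using inS[OF that] ball by blast
    moreover have "((\<lambda>s. x + s *\<^sub>R b + r *\<^sub>R c) has_vector_derivative b) (at s)"
      by (auto intro!: derivative_eq_intros)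
    ultimately show ?thesis
      using curve_derivative[OF _ C_on_2_grad[OF u S], of "\<lambda>s. x + s *\<^sub>R b + r *\<^sub>R c" b s] gb by simp
  qed
  have "\<exists>s. 0 < s \<and> s < h \<and> \<phi> h - \<phi> 0 = (h - 0) * \<phi>' s"
  proof (rule MVT2[OF h])
    fix s assume "0 \<le> s" "s \<le> h"
    then show "(\<phi> has_real_derivative \<phi>' s) (at s)"
      unfolding \<phi>_def \<phi>'_def using h by (intro DERIV_diff d1) auto
  qed
  then obtain s where s: "0 < s" "s < h" "\<phi> h - \<phi> 0 = h * \<phi>' s" by auto
  have "\<exists>r. 0 < r \<and> r < h \<and> pdiff b u (x + s *\<^sub>R b + h *\<^sub>R c) - pdiff b u (x + s *\<^sub>R b + 0 *\<^sub>R c)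
      = (h - 0) * hess u (x + s *\<^sub>R b + r *\<^sub>R c) c b"
  proof (rule MVT2[OF h])
    fix r assume r: "0 \<le> r" "r \<le> h"
    have inS': "x + s *\<^sub>R b + r *\<^sub>R c \<in> S" using inS[of s r] r s ball by auto
    have "((\<lambda>r. x + s *\<^sub>R b + r *\<^sub>R c) has_vector_derivative c) (at r)"
      by (auto intro!: derivative_eq_intros)
    from curve_derivative[OF this C_on_2_pdiff[OF u S inS' b]]
    have "((\<lambda>r. pdiff b u (x + s *\<^sub>R b + r *\<^sub>R c)) has_real_derivative
        (\<Sum>b'\<in>Basis. (c \<bullet> b') * hess u (x + s *\<^sub>R b + r *\<^sub>R c) b' b)) (at r)" .
    moreover have "(\<Sum>b'\<in>Basis. (c \<bullet> b') * hess u (x + s *\<^sub>R b + r *\<^sub>R c) b' b) = hess u (x + s *\<^sub>R b + r *\<^sub>R c) c b"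
      using c by (simp add: inner_Basis if_distrib[of "\<lambda>t. t * _"] cong: if_cong)
    ultimately show "((\<lambda>r. pdiff b u (x + s *\<^sub>R b + r *\<^sub>R c)) has_real_derivative
        hess u (x + s *\<^sub>R b + r *\<^sub>R c) c b) (at r)" by simp
  qed
  then obtain r where r: "0 < r" "r < h" "\<phi>' s = h * hess u (x + s *\<^sub>R b + r *\<^sub>R c) c b"
    by (auto simp: \<phi>'_def)
  show ?thesis
  proof (rule that)
    show "dist x (x + s *\<^sub>R b + r *\<^sub>R c) \<le> 2 * h" using inS[of s r] r s by auto
    have "\<phi> h - \<phi> 0 = h * h * hess u (x + s *\<^sub>R b + r *\<^sub>R c) c b" using s(3) r(3) by simp
    then show "u (x + h *\<^sub>R b + h *\<^sub>R c) - u (x + h *\<^sub>R b) - u (x + h *\<^sub>R c) + u x =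
      h * h * hess u (x + s *\<^sub>R b + r *\<^sub>R c) c b" by (simp add: \<phi>_def)
  qed
qed

lemma hess_symmetric:
  fixes u :: "'a::euclidean_space \<Rightarrow> real"
  assumes u: "C_on 2 u S" and S: "open S" and x: "x \<in> S" and b: "b \<in> Basis" and c: "c \<in> Basis"
  shows "hess u x b c = hess u x c b"
proof -
  have "\<bar>hess u x b c - hess u x c b\<bar> \<le> e" if e: "0 < e" for e
  proof -
    have at: "continuous (at x) (\<lambda>x. hess u x b c)" "continuous (at x) (\<lambda>x. hess u x c b)"
      using C_on_2_hess[OF u S b c] C_on_2_hess[OF u S c b] x S continuous_on_eq_continuous_at by auto
    obtain d1 where d1: "0 < d1" "\<And>y. dist y x < d1 \<Longrightarrow> \<bar>hess u y b c - hess u x b c\<bar> < e / 2"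
      using at(1) e unfolding continuous_at_eps_delta by (metis dist_commute dist_real_def half_gt_zero)
    obtain d2 where d2: "0 < d2" "\<And>y. dist y x < d2 \<Longrightarrow> \<bar>hess u y c b - hess u x c b\<bar> < e / 2"
      using at(2) e unfolding continuous_at_eps_delta by (metis dist_commute dist_real_def half_gt_zero)
    obtain d3 where d3: "0 < d3" "cball x d3 \<subseteq> S" using S x open_contains_cball by blast
    define h where "h = min d3 (min d1 d2 / 2) / 2"
    have h: "0 < h" "2 * h \<le> d3" "2 * h < d1" "2 * h < d2" using d1 d2 d3 by (auto simp: h_def min_def)
    have ball: "cball x (2 * h) \<subseteq> S" using h(2) d3(2) by (meson order.trans subset_cball)
    obtain y where y: "dist x y \<le> 2 * h"
      "u (x + h *\<^sub>R b + h *\<^sub>R c) - u (x + h *\<^sub>R b) - u (x + h *\<^sub>R c) + u x = h * h * hess u y c b"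
      using mixed_difference[OF u S b c h(1) ball] .
    obtain y' where y': "dist x y' \<le> 2 * h"
      "u (x + h *\<^sub>R c + h *\<^sub>R b) - u (x + h *\<^sub>R c) - u (x + h *\<^sub>R b) + u x = h * h * hess u y' b c"
      using mixed_difference[OF u S c b h(1) ball] .
    have comm: "x + h *\<^sub>R c + h *\<^sub>R b = x + h *\<^sub>R b + h *\<^sub>R c" by simp
    have "h * h * hess u y c b = h * h * hess u y' b c" using y(2) y'(2) unfolding comm by linarith
    then have eq: "hess u y c b = hess u y' b c" using h(1) by simp
    have "\<bar>hess u y' b c - hess u x b c\<bar> < e / 2" using d1(2)[of y'] y' h by (simp add: dist_commute)
    moreover have "\<bar>hess u y c b - hess u x c b\<bar> < e / 2" using d2(2)[of y] y h by (simp add: dist_commute)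
    ultimately show ?thesis using eq by linarith
  qed
  then have "\<bar>hess u x b c - hess u x c b\<bar> \<le> 0" by (rule field_le_epsilon[of _ 0, simplified])
  then show ?thesis by simp
qed

section \<open>The Levi form\<close>

lemma sum_Basis_complex_vec:
  fixes f :: "complex^'n \<Rightarrow> 'b::comm_monoid_add"
  shows "(\<Sum>b\<in>Basis. f b) = (\<Sum>i\<in>UNIV. f (axis i 1) + f (axis i \<i>))"
proof -
  have "(\<Sum>b\<in>Basis. f b) = (\<Sum>i\<in>UNIV. \<Sum>b\<in>{axis i 1, axis i \<i>}. f b)"
    unfolding Basis_vec_def
    by (subst sum.UNION_disjoint[symmetric]) (auto simp: Basis_complex_def axis_eq_axis intro!: sum.cong)
  also have "\<dots> = (\<Sum>i\<in>UNIV. f (axis i 1) + f (axis i \<i>))"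
    by (intro sum.cong) (auto simp: axis_eq_axis)
  finally show ?thesis .
qed

lemma axis_Basis: "axis i 1 \<in> (Basis :: (complex^'n) set)" "axis i \<i> \<in> (Basis :: (complex^'n) set)"
  by (auto simp: Basis_vec_def Basis_complex_def)

lemma inner_axis_complex: "w \<bullet> axis i 1 = Re (w $ i)" "w \<bullet> axis i \<i> = Im (w $ i)"
  by (simp_all add: inner_axis inner_complex_def)

lemma pdiff_of_real:
  fixes g :: "'a::euclidean_space \<Rightarrow> real"
  assumes "g differentiable (at z)"
  shows "pdiff b (\<lambda>w. complex_of_real (g w)) z = of_real (pdiff b g z)"
proof -
  have "(g has_derivative frechet_derivative g (at z)) (at z)" using assms frechet_derivative_works by blast
  then have "((\<lambda>w. complex_of_real (g w)) has_derivative (\<lambda>h. of_real (frechet_derivative g (at z) h))) (at z)"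
    by (rule has_derivative_of_real)
  from frechet_derivative_at[OF this] show ?thesis by (metis pdiff_def)
qed

lemma complex_hess_nth:
  fixes u :: "complex^'n \<Rightarrow> real"
  assumes u: "C_on 2 u S" and S: "open S" and z: "z \<in> S"
  shows "complex_hess u z $ i $ j =
    Complex (hess u z (axis i 1) (axis j 1) + hess u z (axis i \<i>) (axis j \<i>))
            (hess u z (axis i 1) (axis j \<i>) - hess u z (axis i \<i>) (axis j 1)) / 4"
proof -
  define g where "g w = (of_real (pdiff (axis j 1) u w) + \<i> * of_real (pdiff (axis j \<i>) u w)) / 2" for w
  have eq: "dzbar j (\<lambda>w. complex_of_real (u w)) w = g w" if "w \<in> S" for w
  proof -
    have "u differentiable (at w)" using C_on_2_grad[OF u S that] differentiable_def by blast
    then show ?thesis by (simp add: dzbar_def g_def pdiff_of_real)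
  qed
  have d: "((\<lambda>w. complex_of_real (pdiff (axis j c) u w)) has_derivative
       (\<lambda>h. of_real (\<Sum>b\<in>Basis. (h \<bullet> b) * hess u z b (axis j c)))) (at z)" if "c = 1 \<or> c = \<i>" for c
    using that C_on_2_pdiff[OF u S z, of "axis j c"] axis_Basis[of j] by (intro has_derivative_of_real) auto
  define g' where "g' h = (of_real (\<Sum>b\<in>Basis. (h \<bullet> b) * hess u z b (axis j 1))
       + \<i> * of_real (\<Sum>b\<in>Basis. (h \<bullet> b) * hess u z b (axis j \<i>))) / 2" for h
  have "(g has_derivative g') (at z)"
    unfolding g_def g'_def
    by (rule has_derivative_eq_rhs)
       (rule has_derivative_divide has_derivative_add has_derivative_mult has_derivative_const d disjI1 disjI2 refl | simp)+
  then have "(dzbar j (\<lambda>w. complex_of_real (u w)) has_derivative g') (at z)"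
    by (rule has_derivative_transform_within_open[OF _ S z]) (simp add: eq)
  from frechet_derivative_at[OF this]
  have p: "pdiff b (dzbar j (\<lambda>w. complex_of_real (u w))) z = g' b" for b by (simp add: pdiff_def)
  have g': "g' b = (of_real (hess u z b (axis j 1)) + \<i> * of_real (hess u z b (axis j \<i>))) / 2" if "b \<in> Basis" for b
    unfolding g'_def using that by (simp add: inner_Basis if_distrib[of "\<lambda>t. t * _"] cong: if_cong)
  show ?thesis
    unfolding complex_hess_def by (simp add: dz_def p g' axis_Basis complex_eq_iff)
qed

lemma complex_hess_hermitian:
  fixes u :: "complex^'n \<Rightarrow> real"
  assumes u: "C_on 2 u S" and S: "open S" and z: "z \<in> S"
  shows "hermitian (complex_hess u z)"
proof (rule hermitianI)
  fix i j
  show "cnj (complex_hess u z $ i $ j) = complex_hess u z $ j $ i"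
    unfolding complex_hess_nth[OF assms]
    using hess_symmetric[OF u S z] axis_Basis by (simp add: complex_eq_iff)
qed

text \<open>The Levi form averages the real Hessian over the complex line spanned by \<open>w\<close>; this turns second derivative tests
  along real lines into inequalities between Hermitian matrices.\<close>

lemma qform_complex_hess:
  fixes u :: "complex^'n \<Rightarrow> real"
  assumes u: "C_on 2 u S" and S: "open S" and z: "z \<in> S"
  shows "qform (complex_hess u z) w = (hess_form u z w + hess_form u z (\<i> *s w)) / 4"
proof -
  define X where "X w i j =
      hess u z (axis i 1) (axis j 1) * Re (w $ i) * Re (w $ j) + hess u z (axis i 1) (axis j \<i>) * Re (w $ i) * Im (w $ j)
    + (hess u z (axis i \<i>) (axis j 1) * Im (w $ i) * Re (w $ j) + hess u z (axis i \<i>) (axis j \<i>) * Im (w $ i) * Im (w $ j))"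
    for w :: "complex^'n" and i j
  have X: "hess_form u z w = (\<Sum>i\<in>UNIV. \<Sum>j\<in>UNIV. X w i j)" for w
    by (simp only: hess_form_def sum_Basis_complex_vec inner_axis_complex X_def sum.distrib)
  have t: "Re (complex_hess u z $ i $ j * w $ i * cnj (w $ j)) = (X w i j + X (\<i> *s w) i j) / 4" for i j
    by (simp add: complex_hess_nth[OF assms] X_def algebra_simps add_divide_distrib diff_divide_distrib)
  show ?thesis
    by (simp only: qform_def Re_sum t X sum.distrib sum_divide_distrib[symmetric])
qed

lemma minor_sum_1:
  fixes A :: "'a::comm_ring_1^'n^'n"
  shows "minor_sum 1 A = (\<Sum>i\<in>UNIV. A $ i $ i)"
proof -
  have S: "{I :: 'n set. card I = Suc 0} = (\<lambda>i. {i}) ` UNIV" by (auto simp: card_1_singleton_iff)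
  have "minor_sum 1 A = (\<Sum>i\<in>UNIV. \<Sum>p | p permutes {i}. of_int (sign p) * (\<Prod>i\<in>{i}. A $ i $ p i))"
    unfolding minor_sum_def One_nat_def S by (simp add: sum.reindex)
  then show ?thesis by (simp add: sign_id)
qed

lemma sigma_1_complex_hess:
  fixes u :: "complex^'n \<Rightarrow> real"
  assumes u: "C_on 2 u S" and S: "open S" and z: "z \<in> S"
  shows "(\<Sum>b\<in>Basis. hess u z b b) = 4 * sigma_k 1 (complex_hess u z)"
proof -
  have "complex_of_real (sigma_k 1 (complex_hess u z)) = minor_sum 1 (complex_hess u z)"
    using minor_sum_eq_sigma_k[OF complex_hess_hermitian[OF assms], of 1] by simp
  then have "sigma_k 1 (complex_hess u z) = Re (\<Sum>i\<in>UNIV. complex_hess u z $ i $ i)"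
    unfolding minor_sum_1 by (metis Re_complex_of_real)
  then show ?thesis
    by (simp add: sum_Basis_complex_vec complex_hess_nth[OF assms] sum_divide_distrib[symmetric])
qed

section \<open>Complex structures and similarities\<close>

text \<open>The conjugate transpose of \<open>J\<close> is \<open>-J\<close>; together with \<open>J\<^sup>2 = -1\<close> this makes \<open>J\<close> unitary.\<close>

definition complex_structure :: "complex^'n^'n \<Rightarrow> bool"
  where "complex_structure J \<longleftrightarrow> J ** J = - mat 1 \<and> (\<forall>i j. cnj (J $ i $ j) = - J $ j $ i)"

lemma complex_structure_square:
  assumes "complex_structure J"
  shows "J *v (J *v x) = - x"
proof -
  have "(- mat 1) *v x = - x"
    by (simp add: matrix_vector_mult_def mat_def vec_eq_iff if_distrib[of "\<lambda>t. - t * _"] sum_negf if_distrib[of "\<lambda>t. t * _"] cong: if_cong)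
  then show ?thesis using assms by (simp add: complex_structure_def matrix_vector_mul_assoc)
qed

lemma inner_vec_complex: "x \<bullet> y = Re (\<Sum>i\<in>UNIV. x $ i * cnj (y $ i))" for x :: "complex^'n"
  by (simp add: inner_vec_def inner_complex_def)

lemma complex_structure_skew:
  assumes J: "complex_structure J"
  shows "x \<bullet> (J *v y) = - ((J *v x) \<bullet> y)"
proof -
  have c: "cnj (J $ i $ j) = - J $ j $ i" for i j using J by (simp add: complex_structure_def)
  have "(\<Sum>i\<in>UNIV. x $ i * cnj ((J *v y) $ i)) = (\<Sum>i\<in>UNIV. \<Sum>j\<in>UNIV. - (J $ j $ i * x $ i * cnj (y $ j)))"
    by (simp add: matrix_vector_mult_def c sum_distrib_left mult_ac)
  also have "\<dots> = - (\<Sum>j\<in>UNIV. (J *v x) $ j * cnj (y $ j))"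
    by (subst sum.swap) (simp add: matrix_vector_mult_def sum_distrib_right sum_negf)
  finally show ?thesis unfolding inner_vec_complex by simp
qed

lemma complex_structure_orthogonal: "complex_structure J \<Longrightarrow> x \<bullet> (J *v x) = 0"
  using complex_structure_skew[of J x x] by (simp add: inner_commute)

lemma complex_structure_norm:
  assumes J: "complex_structure J"
  shows "norm (J *v x) = norm x"
proof -
  have "(J *v x) \<bullet> (J *v x) = x \<bullet> x"
    unfolding complex_structure_skew[OF J] complex_structure_square[OF J] by simp
  then show ?thesis by (simp only: norm_eq_sqrt_inner)
qed

text \<open>Linear combinations \<open>\<alpha> + \<beta> J\<close> are unitary up to the factor \<open>(\<alpha>\<^sup>2 + \<beta>\<^sup>2)\<^sup>1\<^sup>/\<^sup>2\<close>.\<close>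

definition similarity :: "complex^'n^'n \<Rightarrow> real \<Rightarrow> real \<Rightarrow> complex^'n \<Rightarrow> complex^'n"
  where "similarity J \<alpha> \<beta> x = \<alpha> *\<^sub>R x + \<beta> *\<^sub>R (J *v x)"

lemma norm_similarity:
  assumes "complex_structure J"
  shows "(norm (similarity J \<alpha> \<beta> x))\<^sup>2 = (\<alpha>\<^sup>2 + \<beta>\<^sup>2) * (norm x)\<^sup>2"
proof -
  have "(norm (similarity J \<alpha> \<beta> x))\<^sup>2 = \<alpha>\<^sup>2 * (x \<bullet> x) + \<beta>\<^sup>2 * ((J *v x) \<bullet> (J *v x)) + 2 * \<alpha> * \<beta> * (x \<bullet> (J *v x))"
    unfolding power2_norm_eq_inner similarity_def by (simp add: inner_add_left inner_add_right inner_commute[of "J *v x" x] power2_eq_square algebra_simps)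
  then show ?thesis
    using complex_structure_orthogonal[OF assms, of x] complex_structure_norm[OF assms, of x]
    by (simp add: power2_norm_eq_inner[symmetric] algebra_simps)
qed

definition similarity_mat :: "complex^'n^'n \<Rightarrow> real \<Rightarrow> real \<Rightarrow> complex^'n^'n"
  where "similarity_mat J \<alpha> \<beta> = mat (of_real \<alpha>) + cscale (of_real \<beta>) J"

lemma mat_mult_vec: "mat a *v x = a *s x" for a :: complex
  by (simp add: matrix_vector_mult_def mat_def vec_eq_iff if_distrib[of "\<lambda>t. t * _"] cong: if_cong)

lemma similarity_eq_mat: "similarity J \<alpha> \<beta> x = similarity_mat J \<alpha> \<beta> *v x"
proof -
  have "cscale a J *v x = a *s (J *v x)" for a
    by (simp add: matrix_vector_mult_def vec_eq_iff sum_distrib_left mult_ac)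
  moreover have "of_real a *s y = a *\<^sub>R y" for a and y :: "complex^'a"
    by (simp add: vec_eq_iff) (simp add: scaleR_conv_of_real)
  ultimately show ?thesis
    by (simp add: similarity_def similarity_mat_def matrix_vector_mult_add_rdistrib mat_mult_vec)
qed

text \<open>The complex Hessian at \<open>z\<close> of \<open>u \<circ> T\<close> for a complex linear map \<open>T\<close>, in terms of the complex Hessian \<open>A\<close> of \<open>u\<close> at \<open>T z\<close>.\<close>

definition pullback :: "complex^'n^'n \<Rightarrow> complex^'n^'n \<Rightarrow> complex^'n^'n"
  where "pullback T A = transpose T ** A ** (\<chi> i j. cnj (T $ i $ j))"

lemma pullback_nth: "pullback T A $ i $ j = (\<Sum>p\<in>UNIV. \<Sum>q\<in>UNIV. T $ p $ i * A $ p $ q * cnj (T $ q $ j))"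
  unfolding pullback_def matrix_matrix_mult_def transpose_def
  by (simp add: sum_distrib_right, rule sum.swap)

lemma qform_pullback: "qform (pullback T A) w = qform A (T *v w)"
proof -
  have "(\<Sum>i\<in>UNIV. \<Sum>j\<in>UNIV. pullback T A $ i $ j * w $ i * cnj (w $ j)) =
     (\<Sum>i\<in>UNIV. \<Sum>j\<in>UNIV. \<Sum>p\<in>UNIV. \<Sum>q\<in>UNIV. A $ p $ q * (T $ p $ i * w $ i) * cnj (T $ q $ j * w $ j))"
    by (simp add: pullback_nth sum_distrib_left sum_distrib_right mult_ac)
  also have "\<dots> = (\<Sum>i\<in>UNIV. \<Sum>p\<in>UNIV. \<Sum>j\<in>UNIV. \<Sum>q\<in>UNIV. A $ p $ q * (T $ p $ i * w $ i) * cnj (T $ q $ j * w $ j))"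
    by (rule sum.cong[OF refl], rule sum.swap)
  also have "\<dots> = (\<Sum>p\<in>UNIV. \<Sum>i\<in>UNIV. \<Sum>q\<in>UNIV. \<Sum>j\<in>UNIV. A $ p $ q * (T $ p $ i * w $ i) * cnj (T $ q $ j * w $ j))"
    by (subst sum.swap, rule sum.cong[OF refl], rule sum.cong[OF refl], rule sum.swap)
  also have "\<dots> = (\<Sum>p\<in>UNIV. \<Sum>q\<in>UNIV. \<Sum>i\<in>UNIV. \<Sum>j\<in>UNIV. A $ p $ q * (T $ p $ i * w $ i) * cnj (T $ q $ j * w $ j))"
    by (rule sum.cong[OF refl], rule sum.swap)
  also have "\<dots> = (\<Sum>p\<in>UNIV. \<Sum>q\<in>UNIV. A $ p $ q * (T *v w) $ p * cnj ((T *v w) $ q))"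
    by (simp add: matrix_vector_mult_def sum_distrib_left sum_distrib_right mult_ac)
  finally show ?thesis by (simp add: qform_def)
qed

lemma hermitian_pullback:
  assumes "hermitian A"
  shows "hermitian (pullback T A)"
proof (rule hermitianI)
  fix i j
  have "cnj (pullback T A $ i $ j) = (\<Sum>p\<in>UNIV. \<Sum>q\<in>UNIV. cnj (T $ p $ i) * A $ q $ p * T $ q $ j)"
    by (simp add: pullback_nth hermitianD[OF assms])
  also have "\<dots> = pullback T A $ j $ i"
    unfolding pullback_nth by (subst sum.swap) (simp add: mult_ac)
  finally show "cnj (pullback T A $ i $ j) = pullback T A $ j $ i" .
qed

lemma det_mat: "det (mat x :: complex^'n^'n) = x ^ CARD('n)"
proof -
  have "det (mat x :: complex^'n^'n) = (\<Prod>i\<in>UNIV. (mat x :: complex^'n^'n) $ i $ i)"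
    by (rule det_diagonal) (simp add: mat_def)
  then show ?thesis by (simp add: mat_def)
qed

text \<open>Compare coefficients in \<open>det (T\<^sup>T (A + s) N) = r\<^sup>n det (A + s)\<close>, where \<open>N\<close> is the complex conjugate of \<open>T\<close> and
  \<open>T\<^sup>T N = r\<close>.\<close>

lemma minor_sum_pullback:
  fixes A T :: "complex^'n^'n"
  assumes T: "transpose T ** (\<chi> i j. cnj (T $ i $ j)) = mat r" and r: "r \<noteq> 0" and k: "k \<le> CARD('n)"
  shows "minor_sum k (pullback T A) = r ^ k * minor_sum k A"
proof -
  let ?n = "CARD('n)"
  define N where "N = (\<chi> i j. cnj (T $ i $ j))"
  have TN: "transpose T ** N = mat r" using T by (simp add: N_def)
  have dd: "det (transpose T) * det N = r ^ ?n" using TN det_mul[of "transpose T" N] det_mat[of r, where 'n='n] by simp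
  have "minor_sum k (pullback T A) * r ^ (?n - k) = r ^ ?n * minor_sum k A"
  proof (rule sum_rev_powers_eq[of "\<lambda>k. minor_sum k (pullback T A) * r ^ (?n - k)" ?n])
    fix s
    have ms: "mat (r * s) = transpose T ** mat s ** N"
    proof -
      have "transpose T ** mat s = cscale s (transpose T)"
        by (simp add: vec_eq_iff matrix_matrix_mult_def mat_def if_distrib[of "\<lambda>t. _ * t"] mult.commute cong: if_cong)
      moreover have "cscale s M ** N = cscale s (M ** N)" for M
        by (simp add: vec_eq_iff matrix_matrix_mult_def sum_distrib_left mult_ac)
      ultimately show ?thesis by (simp add: TN mult.commute)
    qed
    have rd: "(X + Y) ** N = X ** N + Y ** N" for X Y
      by (simp add: vec_eq_iff matrix_matrix_mult_def algebra_simps sum.distrib)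
    have "pullback T A + mat (r * s) = transpose T ** (A + mat s) ** N"
      by (simp add: pullback_def N_def[symmetric] matrix_add_ldistrib rd ms)
    then have "det (pullback T A + mat (r * s)) = r ^ ?n * det (A + mat s)"
      by (simp add: det_mul dd[symmetric])
    then have "(\<Sum>k\<le>?n. minor_sum k (pullback T A) * (r * s) ^ (?n - k)) = r ^ ?n * (\<Sum>k\<le>?n. minor_sum k A * s ^ (?n - k))"
      by (simp add: det_add_mat_eq_minor_sum)
    then show "(\<Sum>k\<le>?n. minor_sum k (pullback T A) * r ^ (?n - k) * s ^ (?n - k)) = (\<Sum>k\<le>?n. r ^ ?n * minor_sum k A * s ^ (?n - k))"
      by (simp add: power_mult_distrib sum_distrib_left mult_ac)
  qed (rule k)
  moreover have "r ^ ?n = r ^ k * r ^ (?n - k)" using k by (simp flip: power_add)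
  ultimately show ?thesis using r by simp
qed

lemma similarity_mat_unitary:
  assumes J: "complex_structure J"
  shows "transpose (similarity_mat J \<alpha> \<beta>) ** (\<chi> i j. cnj (similarity_mat J \<alpha> \<beta> $ i $ j)) = mat (of_real (\<alpha>\<^sup>2 + \<beta>\<^sup>2))"
proof -
  have c: "cnj (J $ i $ j) = - J $ j $ i" for i j using J by (simp add: complex_structure_def)
  have JJ: "(\<Sum>p\<in>UNIV. J $ i $ p * J $ p $ j) = (if i = j then - 1 else 0)" for i j
    using J unfolding complex_structure_def by (auto simp: vec_eq_iff matrix_matrix_mult_def mat_def)
  have t: "similarity_mat J \<alpha> \<beta> $ p $ i * cnj (similarity_mat J \<alpha> \<beta> $ p $ j) =
     (if p = i then of_real \<alpha> * (if i = j then of_real \<alpha> else 0) - of_real (\<alpha> * \<beta>) * J $ j $ i else 0)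
     + (if p = j then of_real (\<alpha> * \<beta>) * J $ j $ i else 0) - of_real (\<beta>\<^sup>2) * (J $ j $ p * J $ p $ i)" for i j p
    by (auto simp: similarity_mat_def mat_def c algebra_simps power2_eq_square)
  have "(\<Sum>p\<in>UNIV. similarity_mat J \<alpha> \<beta> $ p $ i * cnj (similarity_mat J \<alpha> \<beta> $ p $ j)) =
      (if i = j then of_real (\<alpha>\<^sup>2 + \<beta>\<^sup>2) else 0)" for i j
    unfolding t sum.distrib sum_subtractf sum_distrib_left[symmetric] JJ
    by (simp add: power2_eq_square)
  then show ?thesis
    by (simp add: vec_eq_iff matrix_matrix_mult_def transpose_def mat_def)
qed

lemma complex_structure_i: "complex_structure (mat \<i> :: complex^'n^'n)"
proof -
  have "mat \<i> ** mat \<i> = (- mat 1 :: complex^'n^'n)"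
    by (simp add: vec_eq_iff matrix_matrix_mult_def mat_def if_distrib[of "\<lambda>t. t * _"] cong: if_cong)
  then show ?thesis by (simp add: complex_structure_def mat_def)
qed

text \<open>Here \<open>J\<close> is \<open>\<i>\<close> times the Householder reflection in the complex hyperplane orthogonal to \<open>a\<close>.\<close>

lemma reflection_complex_structure:
  fixes a :: "complex^'n"
  assumes N: "(\<Sum>i\<in>UNIV. cnj (a $ i) * a $ i) = of_real N" and N0: "N \<noteq> 0"
  defines "J \<equiv> (\<chi> i j. \<i> * ((if i = j then 1 else 0) - 2 * a $ i * cnj (a $ j) / of_real N))"
  shows "complex_structure J"
    and "J *v x = \<i> *s (x - (2 * (\<Sum>i\<in>UNIV. cnj (a $ i) * x $ i) / of_real N) *s a)"
proof -
  have act: "J *v x = \<i> *s (x - (2 * (\<Sum>i\<in>UNIV. cnj (a $ i) * x $ i) / of_real N) *s a)" for x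
  proof -
    have "(J *v x) $ i = (\<Sum>j\<in>UNIV. (if i = j then \<i> * x $ j else 0) - (2 * \<i> * a $ i / of_real N) * (cnj (a $ j) * x $ j))" for i
      unfolding J_def matrix_vector_mult_def by (simp, intro sum.cong) (auto simp: algebra_simps)
    then have "(J *v x) $ i = \<i> * x $ i - (2 * \<i> * a $ i / of_real N) * (\<Sum>j\<in>UNIV. cnj (a $ j) * x $ j)" for i
      unfolding sum_subtractf sum_distrib_left[symmetric] by simp
    then show ?thesis
      by (simp add: vec_eq_iff algebra_simps)
  qed
  then show "J *v x = \<i> *s (x - (2 * (\<Sum>i\<in>UNIV. cnj (a $ i) * x $ i) / of_real N) *s a)" .
  have "J *v (J *v x) = - x" for x
  proof -
    define s where "s = (\<Sum>i\<in>UNIV. cnj (a $ i) * x $ i)"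
    have "(\<Sum>i\<in>UNIV. cnj (a $ i) * (J *v x) $ i) = \<i> * (s - (2 * s / of_real N) * (\<Sum>i\<in>UNIV. cnj (a $ i) * a $ i))"
    proof -
      have "cnj (a $ i) * (J *v x) $ i = \<i> * (cnj (a $ i) * x $ i) - (\<i> * (2 * s / of_real N)) * (cnj (a $ i) * a $ i)" for i
        unfolding act s_def[symmetric] by (simp add: algebra_simps)
      then show ?thesis
        by (simp only: sum_subtractf sum_distrib_left[symmetric] s_def[symmetric]) (simp add: algebra_simps)
    qed
    also have "\<dots> = - \<i> * s" using N N0 by simp
    finally have s': "(\<Sum>i\<in>UNIV. cnj (a $ i) * (J *v x) $ i) = - \<i> * s" .
    show ?thesis
      unfolding act[of "J *v x"] s' unfolding act s_def[symmetric] by (simp add: vec_eq_iff algebra_simps)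
  qed
  moreover have "(- mat 1 :: complex^'n^'n) *v x = - x" for x
  proof -
    have "- mat 1 = (mat (-1) :: complex^'n^'n)" by (simp add: vec_eq_iff mat_def)
    then have "(- mat 1 :: complex^'n^'n) *v x = (- 1) *s x" by (simp only: mat_mult_vec)
    then show ?thesis by (simp add: vec_eq_iff)
  qed
  ultimately have "J ** J = - mat 1"
    by (simp add: matrix_eq matrix_vector_mul_assoc[symmetric])
  then show "complex_structure J"
    by (simp add: complex_structure_def J_def)
qed

text \<open>Unitary complex structures act transitively on pairs of real-orthogonal vectors of equal length: \<open>- \<i>\<close>
  times the sought matrix is the Householder reflection exchanging \<open>z\<close> and \<open>- \<i> \<zeta>\<close>, and it exists
  because the Hermitian product of these two vectors is real.\<close>

lemma complex_structure_transitive: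
  fixes z \<zeta> :: "complex^'n"
  assumes orth: "z \<bullet> \<zeta> = 0" and len: "norm \<zeta> = norm z"
  obtains J where "complex_structure J" "J *v z = \<zeta>"
proof -
  define a where "a = z + \<i> *s \<zeta>"
  define N where "N = (norm a)\<^sup>2"
  have N: "(\<Sum>i\<in>UNIV. cnj (a $ i) * a $ i) = of_real N"
    unfolding N_def norm_power2_vec by (simp add: complex_norm_square mult.commute del: of_real_power)
  show ?thesis
  proof (cases "N = 0")
    case True
    then have "a = 0" by (simp add: N_def)
    then have "\<i> *s z = \<zeta>" unfolding a_def by (auto simp: vec_eq_iff complex_eq_iff neg_eq_iff_add_eq_0)
    then show ?thesis using that[OF complex_structure_i] by (simp add: mat_mult_vec)
  next
    case False
    define X where "X = (\<Sum>i\<in>UNIV. cnj (z $ i) * (\<i> * \<zeta> $ i))"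
    have "X = \<i> * cnj (\<Sum>i\<in>UNIV. z $ i * cnj (\<zeta> $ i))"
      by (simp add: X_def sum_distrib_left mult_ac)
    then have "Im X = 0" using orth unfolding inner_vec_complex by simp
    then have X: "cnj X = X" by (simp add: complex_eq_iff)
    have sq: "(\<Sum>i\<in>UNIV. cnj (v $ i) * v $ i) = of_real ((norm v)\<^sup>2)" for v :: "complex^'n"
      unfolding norm_power2_vec by (simp add: complex_norm_square mult.commute del: of_real_power)
    have sz: "(\<Sum>i\<in>UNIV. cnj (a $ i) * z $ i) = of_real ((norm z)\<^sup>2) + X"
    proof -
      have "(\<Sum>i\<in>UNIV. cnj (a $ i) * z $ i) = (\<Sum>i\<in>UNIV. cnj (z $ i) * z $ i) + cnj X"
        by (simp add: a_def X_def sum.distrib[symmetric] algebra_simps)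
      then show ?thesis by (simp only: X sq)
    qed
    have "of_real N = (\<Sum>i\<in>UNIV. cnj (z $ i) * z $ i) + X + cnj X + (\<Sum>i\<in>UNIV. cnj (\<zeta> $ i) * \<zeta> $ i)"
      unfolding N[symmetric] by (simp add: a_def X_def sum.distrib[symmetric] algebra_simps)
    then have N2: "of_real N = 2 * (\<Sum>i\<in>UNIV. cnj (a $ i) * z $ i)"
      unfolding sz X sq len by simp
    define J where "J = (\<chi> i j. \<i> * ((if i = j then 1 else 0) - 2 * a $ i * cnj (a $ j) / of_real N))"
    have "J *v z = \<i> *s (z - (2 * (\<Sum>i\<in>UNIV. cnj (a $ i) * z $ i) / of_real N) *s a)"
      unfolding J_def by (rule reflection_complex_structure(2)[OF N False])
    also have "\<dots> = \<i> *s (z - a)" unfolding N2[symmetric] using False by simp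
    also have "\<dots> = \<zeta>" by (simp add: a_def vec_eq_iff)
    finally show ?thesis using that reflection_complex_structure(1)[OF N False] unfolding J_def by blast
  qed
qed

section \<open>Flows of similarities\<close>

lemma similarity_similarity:
  assumes J: "complex_structure J"
  shows "similarity J a b (similarity J c d x) = similarity J (a * c - b * d) (a * d + b * c) x"
proof -
  have "J *v (r *\<^sub>R y) = r *\<^sub>R (J *v y)" for r y
    by (rule linear_cmul[OF bounded_linear.linear[OF matrix_vector_mul_bounded_linear]])
  then show ?thesis
    unfolding similarity_def
    by (simp add: matrix_vector_right_distrib complex_structure_square[OF J] algebra_simps)
qed

lemma similarity_bounded_linear: "bounded_linear (similarity J a b)"
  unfolding similarity_def
  by (intro bounded_linear_add bounded_linear_const_scaleR bounded_linear_ident matrix_vector_mul_bounded_linear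
      bounded_linear_compose[OF bounded_linear_scaleR_right])

text \<open>The one-parameter group generated by \<open>b + \<omega> J\<close>: rotations by \<open>exp (\<omega> t J)\<close> and dilations by \<open>exp (b t)\<close>.\<close>

definition flow :: "complex^'n^'n \<Rightarrow> real \<Rightarrow> real \<Rightarrow> real \<Rightarrow> complex^'n \<Rightarrow> complex^'n"
  where "flow J b \<omega> t = similarity J (exp (b * t) * cos (\<omega> * t)) (exp (b * t) * sin (\<omega> * t))"

lemma flow_0 [simp]: "flow J b \<omega> 0 x = x"
  by (simp add: flow_def similarity_def)

lemma exp_cos_sin: "(exp (b * t) * cos (\<omega> * t))\<^sup>2 + (exp (b * t) * sin (\<omega> * t))\<^sup>2 = exp (2 * b * t)" for t :: real
proof -
  have "(exp (b * t) * cos (\<omega> * t))\<^sup>2 + (exp (b * t) * sin (\<omega> * t))\<^sup>2 = (exp (b * t))\<^sup>2 * ((cos (\<omega> * t))\<^sup>2 + (sin (\<omega> * t))\<^sup>2)"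
    by (simp only: power_mult_distrib distrib_left)
  also have "\<dots> = exp (2 * b * t)" by (simp add: exp_double mult.assoc)
  finally show ?thesis .
qed

lemma norm_flow: "complex_structure J \<Longrightarrow> norm (flow J b \<omega> t x) = exp (b * t) * norm x"
proof -
  assume J: "complex_structure J"
  have "(norm (flow J b \<omega> t x))\<^sup>2 = (exp (b * t) * norm x)\<^sup>2"
    unfolding flow_def norm_similarity[OF J] exp_cos_sin by (simp add: power_mult_distrib exp_double mult.assoc)
  then show ?thesis by (simp add: power2_eq_iff_nonneg)
qed

lemma norm_similarity_unit:
  assumes "complex_structure J" "b\<^sup>2 + \<omega>\<^sup>2 = 1"
  shows "norm (similarity J b \<omega> x) = norm x"
proof -
  have "(norm (similarity J b \<omega> x))\<^sup>2 = (norm x)\<^sup>2"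
    unfolding norm_similarity[OF assms(1)] assms(2) by simp
  then show ?thesis by (simp add: power2_eq_iff_nonneg)
qed

lemma flow_derivative:
  assumes J: "complex_structure J"
  shows "((\<lambda>t. flow J b \<omega> t x) has_vector_derivative similarity J b \<omega> (flow J b \<omega> t x)) (at t)"
proof -
  have "((\<lambda>t. exp (b * t) * cos (\<omega> * t)) has_real_derivative
      b * (exp (b * t) * cos (\<omega> * t)) - \<omega> * (exp (b * t) * sin (\<omega> * t))) (at t)"
    by (auto intro!: derivative_eq_intros)
  moreover have "((\<lambda>t. exp (b * t) * sin (\<omega> * t)) has_real_derivative
      b * (exp (b * t) * sin (\<omega> * t)) + \<omega> * (exp (b * t) * cos (\<omega> * t))) (at t)"
    by (auto intro!: derivative_eq_intros)
  ultimately have "((\<lambda>t. (exp (b * t) * cos (\<omega> * t)) *\<^sub>R x + (exp (b * t) * sin (\<omega> * t)) *\<^sub>R (J *v x)) has_vector_derivative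
    (b * (exp (b * t) * cos (\<omega> * t)) - \<omega> * (exp (b * t) * sin (\<omega> * t))) *\<^sub>R x
    + (b * (exp (b * t) * sin (\<omega> * t)) + \<omega> * (exp (b * t) * cos (\<omega> * t))) *\<^sub>R (J *v x)) (at t)"
    by (intro has_vector_derivative_add has_vector_derivative_scaleR[where f'="_" and g'=0, simplified] ) auto
  then show ?thesis
    unfolding flow_def similarity_similarity[OF J] by (simp add: similarity_def)
qed

definition second_flow_derivative :: "complex^'n^'n \<Rightarrow> real \<Rightarrow> real \<Rightarrow> (complex^'n \<Rightarrow> real) \<Rightarrow> complex^'n \<Rightarrow> real"
  where "second_flow_derivative J b \<omega> u y = hess_form u y (similarity J b \<omega> y)
    + grad u y \<bullet> similarity J b \<omega> (similarity J b \<omega> y)"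

lemma flow_derivatives:
  assumes J: "complex_structure J" and u: "C_on 2 u S" and S: "open S" and x: "flow J b \<omega> t x \<in> S"
  shows "((\<lambda>t. u (flow J b \<omega> t x)) has_real_derivative
      grad u (flow J b \<omega> t x) \<bullet> similarity J b \<omega> (flow J b \<omega> t x)) (at t)"
    and "((\<lambda>t. grad u (flow J b \<omega> t x) \<bullet> similarity J b \<omega> (flow J b \<omega> t x)) has_real_derivative
      second_flow_derivative J b \<omega> u (flow J b \<omega> t x)) (at t)"
proof -
  show "((\<lambda>t. u (flow J b \<omega> t x)) has_real_derivative
      grad u (flow J b \<omega> t x) \<bullet> similarity J b \<omega> (flow J b \<omega> t x)) (at t)"
    by (rule curve_derivative[OF flow_derivative[OF J] C_on_2_grad[OF u S x]])
  have "((\<lambda>t. similarity J b \<omega> (flow J b \<omega> t x)) has_vector_derivative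
     similarity J b \<omega> (similarity J b \<omega> (flow J b \<omega> t x))) (at t)"
    by (rule bounded_linear.has_vector_derivative[OF similarity_bounded_linear flow_derivative[OF J]])
  then show "((\<lambda>t. grad u (flow J b \<omega> t x) \<bullet> similarity J b \<omega> (flow J b \<omega> t x)) has_real_derivative
      second_flow_derivative J b \<omega> u (flow J b \<omega> t x)) (at t)"
    unfolding second_flow_derivative_def
    by (rule curve_second_derivative[of u S "\<lambda>t. flow J b \<omega> t x" t "\<lambda>t. similarity J b \<omega> (flow J b \<omega> t x)",
          OF u S x flow_derivative[OF J]])
qed

section \<open>Second differences in one variable\<close>

text \<open>The function \<open>s \<mapsto> \<phi>(s) + \<phi>(-s) - M s\<^sup>2\<close> is decreasing for \<open>s \<ge> 0\<close>, by the mean value theorem for \<open>\<phi>'\<close> on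
  \<open>[-s, s]\<close>.\<close>

lemma second_difference_le:
  fixes \<phi> :: "real \<Rightarrow> real"
  assumes t: "0 \<le> t"
    and d1: "\<And>s. \<bar>s\<bar> \<le> t \<Longrightarrow> (\<phi> has_real_derivative \<phi>1 s) (at s)"
    and d2: "\<And>s. \<bar>s\<bar> \<le> t \<Longrightarrow> (\<phi>1 has_real_derivative \<phi>2 s) (at s)"
    and M: "\<And>s. \<bar>s\<bar> \<le> t \<Longrightarrow> \<phi>2 s \<le> M"
  shows "\<phi> t + \<phi> (- t) - 2 * \<phi> 0 \<le> M * t\<^sup>2"
proof -
  define g where "g s = \<phi> s + \<phi> (- s) - M * s\<^sup>2" for s
  have "g t \<le> g 0"
  proof (rule DERIV_nonpos_imp_nonincreasing[OF t])
    fix s assume s: "0 \<le> s" "s \<le> t"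
    have "(g has_real_derivative \<phi>1 s + \<phi>1 (- s) * (- 1) - M * (2 * s)) (at s)"
    proof -
      have "(\<phi> has_real_derivative \<phi>1 s) (at s)" by (rule d1) (use s in auto)
      moreover have "((\<lambda>s. \<phi> (- s)) has_real_derivative \<phi>1 (- s) * (- 1)) (at s)"
        by (rule DERIV_chain2[OF d1]) (use s in \<open>auto intro!: derivative_eq_intros\<close>)
      moreover have "((\<lambda>s. M * s\<^sup>2) has_real_derivative M * (2 * s)) (at s)"
        by (auto intro!: derivative_eq_intros)
      ultimately show ?thesis unfolding g_def by (intro DERIV_diff DERIV_add)
    qed
    moreover have "\<phi>1 s + \<phi>1 (- s) * (- 1) - M * (2 * s) \<le> 0"
    proof (cases "s = 0")
      case False
      then have lt: "- s < s" using s by simp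
      have "\<exists>r. - s < r \<and> r < s \<and> \<phi>1 s - \<phi>1 (- s) = (s - (- s)) * \<phi>2 r"
        by (rule MVT2[OF lt]) (use s in \<open>auto intro!: d2\<close>)
      then obtain r where r: "- s < r" "r < s" "\<phi>1 s - \<phi>1 (- s) = 2 * s * \<phi>2 r" by auto
      have "2 * s * \<phi>2 r \<le> 2 * s * M" using r s by (intro mult_left_mono M) auto
      then show ?thesis using r(3) by (simp add: algebra_simps)
    qed simp
    ultimately show "\<exists>y. (g has_real_derivative y) (at s) \<and> y \<le> 0" by blast
  qed
  then show ?thesis by (simp add: g_def)
qed

lemma second_derivative_at_local_max:
  fixes \<psi> :: "real \<Rightarrow> real"
  assumes d: "0 < d"
    and d1: "\<And>s. \<bar>s\<bar> < d \<Longrightarrow> (\<psi> has_real_derivative \<psi>1 s) (at s)"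
    and d2: "(\<psi>1 has_real_derivative l) (at 0)"
    and max: "\<And>s. \<bar>s\<bar> < d \<Longrightarrow> \<psi> s \<le> \<psi> 0"
  shows "l \<le> 0"
proof (rule ccontr)
  assume "\<not> l \<le> 0"
  then have l: "0 < l" by simp
  have z: "\<psi>1 0 = 0" by (rule DERIV_local_max[OF d1[of 0] d]) (use d max in auto)
  obtain e where e: "0 < e" "\<And>h. 0 < h \<Longrightarrow> h < e \<Longrightarrow> 0 < \<psi>1 h"
    using DERIV_pos_inc_right[OF d2 l] z by auto
  define h where "h = min d e / 2"
  have h: "0 < h" "h < d" "h < e" using d e by (auto simp: h_def min_def)
  have "\<exists>s. 0 < s \<and> s < h \<and> \<psi> h - \<psi> 0 = (h - 0) * \<psi>1 s"
    by (rule MVT2[OF h(1)]) (use h in \<open>auto intro!: d1\<close>)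
  then obtain s where "0 < s" "s < h" "\<psi> h - \<psi> 0 = h * \<psi>1 s" by auto
  then have "0 < \<psi> h - \<psi> 0" using e(2)[of s] h by simp
  then show False using max[of h] h by simp
qed

lemma exp_add_exp_minus_le:
  fixes x :: real
  assumes "\<bar>x\<bar> \<le> 1"
  shows "exp x + exp (- x) \<le> 2 + 2 * x\<^sup>2"
proof -
  have *: "exp y + exp (- y) \<le> 2 + 2 * y\<^sup>2" if y: "0 \<le> y" "y \<le> 1" for y :: real
  proof -
    have a: "exp y \<le> 1 + y + y\<^sup>2" using exp_bound[OF y] .
    have "1 + y + y\<^sup>2 / 2 \<le> exp y" using exp_lower_Taylor_quadratic[OF y(1)] by simp
    moreover have "0 < 1 - y + y\<^sup>2"
    proof -
      have "1 - y + y\<^sup>2 = (y - 1 / 2)\<^sup>2 + 3 / 4" by (simp add: power2_eq_square algebra_simps)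
      then show ?thesis by (simp add: add_nonneg_pos)
    qed
    ultimately have "(1 - y + y\<^sup>2) * (1 + y + y\<^sup>2 / 2) \<le> (1 - y + y\<^sup>2) * exp y" by simp
    moreover have "(1 - y + y\<^sup>2) * (1 + y + y\<^sup>2 / 2) = 1 + y\<^sup>2 / 2 + y^3 / 2 + y^4 / 2"
      by (simp add: field_simps power2_eq_square power3_eq_cube power4_eq_xxxx)
    moreover have "0 \<le> y\<^sup>2 / 2 + y^3 / 2 + y^4 / 2" using y by simp
    ultimately have "1 \<le> (1 - y + y\<^sup>2) * exp y" by linarith
    then have "exp (- y) \<le> 1 - y + y\<^sup>2" by (simp add: exp_minus field_simps)
    with a show ?thesis by simp
  qed
  show ?thesis
    using *[of "\<bar>x\<bar>"] assms by (cases "0 \<le> x") (auto simp: add.commute)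
qed

section \<open>The maximum principle along a flow\<close>

lemma similarity_i: "similarity J a b (\<i> *s w) = \<i> *s similarity J a b w"
  by (simp add: similarity_def vec_eq_iff vector_smult_lzero matrix_vector_mult_def sum_distrib_left algebra_simps)

lemma hess_form_along_line:
  assumes u: "C_on 2 u S" and S: "open S" and x: "x + s *\<^sub>R h \<in> S"
  shows "((\<lambda>s. u (x + s *\<^sub>R h)) has_real_derivative grad u (x + s *\<^sub>R h) \<bullet> h) (at s)"
    and "((\<lambda>s. grad u (x + s *\<^sub>R h) \<bullet> h) has_real_derivative hess_form u (x + s *\<^sub>R h) h) (at s)"
proof -
  have g: "((\<lambda>s. x + s *\<^sub>R h) has_vector_derivative h) (at s)" by (auto intro!: derivative_eq_intros)
  show "((\<lambda>s. u (x + s *\<^sub>R h)) has_real_derivative grad u (x + s *\<^sub>R h) \<bullet> h) (at s)"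
    by (rule curve_derivative[OF g C_on_2_grad[OF u S x]])
  show "((\<lambda>s. grad u (x + s *\<^sub>R h) \<bullet> h) has_real_derivative hess_form u (x + s *\<^sub>R h) h) (at s)"
    using curve_second_derivative[of u S "\<lambda>s. x + s *\<^sub>R h" s "\<lambda>_. h" 0, OF u S x g] by simp
qed

lemma hess_form_at_local_max:
  fixes u :: "complex^'n \<Rightarrow> real"
  assumes u: "C_on 2 u S" and S: "open S" and z: "z \<in> S"
    and P: "bounded_linear P" and Pz: "P z \<in> S" and Q: "bounded_linear Q" and Qz: "Q z \<in> S"
    and d: "0 < d" and max: "\<And>y. dist z y < d \<Longrightarrow> u (P y) + u (Q y) - 2 * \<mu> * u y \<le> u (P z) + u (Q z) - 2 * \<mu> * u z"
  shows "hess_form u (P z) (P w) + hess_form u (Q z) (Q w) \<le> 2 * \<mu> * hess_form u z w"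
proof -
  have near: "\<exists>e>0. \<forall>s. \<bar>s\<bar> < e \<longrightarrow> x + s *\<^sub>R h \<in> T" if "x \<in> T" "open T" for x h :: "complex^'n" and T
  proof -
    have "open ((\<lambda>s. x + s *\<^sub>R h) -` T)" by (rule open_vimage[OF that(2)]) (intro continuous_intros)
    moreover have "0 \<in> (\<lambda>s. x + s *\<^sub>R h) -` T" using that by simp
    ultimately obtain e where "0 < e" "ball 0 e \<subseteq> (\<lambda>s. x + s *\<^sub>R h) -` T" using openE by blast
    then show ?thesis by (intro exI[of _ e]) (auto simp: subset_iff)
  qed
  obtain e1 where e1: "0 < e1" "\<And>s. \<bar>s\<bar> < e1 \<Longrightarrow> P z + s *\<^sub>R P w \<in> S" using near[OF Pz S] by blast
  obtain e2 where e2: "0 < e2" "\<And>s. \<bar>s\<bar> < e2 \<Longrightarrow> Q z + s *\<^sub>R Q w \<in> S" using near[OF Qz S] by blast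
  obtain e3 where e3: "0 < e3" "\<And>s. \<bar>s\<bar> < e3 \<Longrightarrow> z + s *\<^sub>R w \<in> S" using near[OF z S] by blast
  obtain e4 where e4: "0 < e4" "\<And>s. \<bar>s\<bar> < e4 \<Longrightarrow> z + s *\<^sub>R w \<in> ball z d" using near[of z "ball z d" w] d by auto
  define e where "e = min (min e1 e2) (min e3 e4)"
  have e: "0 < e" using e1 e2 e3 e4 by (simp add: e_def)
  have linP: "P (z + s *\<^sub>R w) = P z + s *\<^sub>R P w" and linQ: "Q (z + s *\<^sub>R w) = Q z + s *\<^sub>R Q w" for s
    using P Q by (simp_all add: bounded_linear.linear linear_add linear_cmul)
  define \<psi> where "\<psi> s = u (P z + s *\<^sub>R P w) + u (Q z + s *\<^sub>R Q w) - 2 * \<mu> * u (z + s *\<^sub>R w)" for s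
  define \<psi>1 where "\<psi>1 s = grad u (P z + s *\<^sub>R P w) \<bullet> P w + grad u (Q z + s *\<^sub>R Q w) \<bullet> Q w
     - 2 * \<mu> * (grad u (z + s *\<^sub>R w) \<bullet> w)" for s
  have "hess_form u (P z + 0 *\<^sub>R P w) (P w) + hess_form u (Q z + 0 *\<^sub>R Q w) (Q w) - 2 * \<mu> * hess_form u (z + 0 *\<^sub>R w) w \<le> 0"
  proof (rule second_derivative_at_local_max[OF e])
    show "(\<psi> has_real_derivative \<psi>1 s) (at s)" if "\<bar>s\<bar> < e" for s
      unfolding \<psi>_def \<psi>1_def using that e1 e2 e3
      by (intro DERIV_diff DERIV_add DERIV_cmult hess_form_along_line(1)[OF u S]) (auto simp: e_def)
    show "(\<psi>1 has_real_derivative hess_form u (P z + 0 *\<^sub>R P w) (P w) + hess_form u (Q z + 0 *\<^sub>R Q w) (Q w) - 2 * \<mu> * hess_form u (z + 0 *\<^sub>R w) w) (at 0)"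
      unfolding \<psi>1_def using e e1 e2 e3
      by (intro DERIV_diff DERIV_add DERIV_cmult hess_form_along_line(2)[OF u S]) (auto simp: z Pz Qz)
    show "\<psi> s \<le> \<psi> 0" if "\<bar>s\<bar> < e" for s
      using max[of "z + s *\<^sub>R w"] e4(2)[of s] that by (simp add: \<psi>_def linP linQ e_def)
  qed
  then show ?thesis by simp
qed

lemma sigma_k_pullback:
  fixes A :: "complex^'n^'n"
  assumes J: "complex_structure J" and A: "hermitian A" and r: "\<alpha>\<^sup>2 + \<beta>\<^sup>2 \<noteq> 0" and j: "j \<le> CARD('n)"
  shows "sigma_k j (pullback (similarity_mat J \<alpha> \<beta>) A) = (\<alpha>\<^sup>2 + \<beta>\<^sup>2) ^ j * sigma_k j A"
proof -
  have r': "complex_of_real (\<alpha>\<^sup>2 + \<beta>\<^sup>2) \<noteq> 0" using r by (simp only: of_real_eq_0_iff not_False_eq_True)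
  have "complex_of_real (sigma_k j (pullback (similarity_mat J \<alpha> \<beta>) A)) = of_real ((\<alpha>\<^sup>2 + \<beta>\<^sup>2) ^ j * sigma_k j A)"
    using minor_sum_pullback[OF similarity_mat_unitary[OF J] r' j, of A]
    by (simp add: minor_sum_eq_sigma_k[OF A j] minor_sum_eq_sigma_k[OF hermitian_pullback[OF A] j])
  then show ?thesis by (simp only: of_real_eq_iff)
qed

text \<open>With \<open>r = |z|\<^sup>2\<close> and \<open>x = 2 b t\<close>, the product \<open>(e\<^sup>x r + \<epsilon>\<^sup>2) (e\<^sup>-\<^sup>x r + \<epsilon>\<^sup>2)\<close> exceeds \<open>(r + \<epsilon>\<^sup>2)\<^sup>2\<close> by at most the factor
  \<open>exp (4 t\<^sup>2)\<close>, uniformly in \<open>r\<close> and \<open>\<epsilon>\<close>. Raised to the power \<open>n + 1\<close>, this loss is beaten by the factor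
  \<open>exp (- L t\<^sup>2)\<close> that comes from \<open>1 - L t\<^sup>2 / 2\<close>.\<close>

lemma f_eps_symmetrized_strict:
  fixes z :: "complex^'n"
  assumes J: "complex_structure J" and b: "\<bar>b\<bar> \<le> 1" and K: "0 < c" and \<epsilon>: "0 < \<epsilon>" and k: "1 \<le> k"
    and L: "4 * (real CARD('n) + 1) < L" and t: "t \<noteq> 0" "\<bar>t\<bar> \<le> 1 / 2" and \<mu>: "0 < 1 - L * t\<^sup>2 / 2"
  shows "((1 - L * t\<^sup>2 / 2) ^ k * f_eps c k \<epsilon> z)\<^sup>2 < f_eps c k \<epsilon> (flow J b \<omega> t z) * f_eps c k \<epsilon> (flow J b \<omega> (- t) z)"
proof -
  define m where "m = CARD('n) + 1"
  define r where "r = (norm z)\<^sup>2"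
  define D where "D = c * \<epsilon>\<^sup>2 * (1 + \<epsilon>\<^sup>2) ^ (CARD('n) - k)"
  define x where "x = 2 * b * t"
  define \<mu> where "\<mu> = 1 - L * t\<^sup>2 / 2"
  have D: "0 < D" using K \<epsilon> by (simp add: D_def add_pos_nonneg)
  have r: "0 \<le> r" by (simp add: r_def)
  have e2: "0 < \<epsilon>\<^sup>2" using \<epsilon> by simp
  have rp: "0 < r + \<epsilon>\<^sup>2" using r e2 by linarith
  have fz: "f_eps c k \<epsilon> z = D / (r + \<epsilon>\<^sup>2) ^ m" by (simp add: f_eps_def D_def r_def m_def)
  have ff: "f_eps c k \<epsilon> (flow J b \<omega> s z) = D / (exp (2 * b * s) * r + \<epsilon>\<^sup>2) ^ m" for s
    by (simp add: f_eps_def D_def r_def m_def norm_flow[OF J] power_mult_distrib exp_double mult.assoc)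
  define X where "X = (exp x * r + \<epsilon>\<^sup>2) * (exp (- x) * r + \<epsilon>\<^sup>2)"
  have prod: "f_eps c k \<epsilon> (flow J b \<omega> t z) * f_eps c k \<epsilon> (flow J b \<omega> (- t) z) = D\<^sup>2 / X ^ m"
    by (simp add: ff x_def X_def power_mult_distrib power2_eq_square)
  have X0: "0 < X" unfolding X_def using r e2 by (intro mult_pos_pos add_nonneg_pos) auto
  have x1: "\<bar>x\<bar> \<le> 1"
  proof -
    have "\<bar>b\<bar> * \<bar>t\<bar> \<le> 1 * (1 / 2)" by (intro mult_mono b t) auto
    then show ?thesis by (simp add: x_def abs_mult)
  qed
  have x2: "x\<^sup>2 \<le> 4 * t\<^sup>2"
  proof -
    have "b\<^sup>2 \<le> 1" using b by (simp add: abs_square_le_1)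
    then have "b\<^sup>2 * t\<^sup>2 \<le> 1 * t\<^sup>2" by (intro mult_right_mono) auto
    then show ?thesis by (simp add: x_def power_mult_distrib)
  qed
  have "X = r\<^sup>2 + (\<epsilon>\<^sup>2)\<^sup>2 + r * \<epsilon>\<^sup>2 * (exp x + exp (- x))"
  proof -
    have "exp x * exp (- x) = 1" by (simp add: exp_minus)
    then have "exp x * r * (exp (- x) * r) = r\<^sup>2" by (simp add: power2_eq_square)
    then show ?thesis unfolding X_def by (simp add: algebra_simps power2_eq_square)
  qed
  also have "\<dots> \<le> r\<^sup>2 + (\<epsilon>\<^sup>2)\<^sup>2 + r * \<epsilon>\<^sup>2 * (2 + 2 * x\<^sup>2)"
    using exp_add_exp_minus_le[OF x1] r e2 by (intro add_left_mono mult_left_mono) auto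
  also have "\<dots> \<le> (r + \<epsilon>\<^sup>2)\<^sup>2 * (1 + x\<^sup>2)"
  proof -
    have "(r + \<epsilon>\<^sup>2)\<^sup>2 * (1 + x\<^sup>2) - (r\<^sup>2 + (\<epsilon>\<^sup>2)\<^sup>2 + r * \<epsilon>\<^sup>2 * (2 + 2 * x\<^sup>2)) = (r\<^sup>2 + (\<epsilon>\<^sup>2)\<^sup>2) * x\<^sup>2"
      by (simp add: algebra_simps power2_eq_square)
    moreover have "0 \<le> (r\<^sup>2 + (\<epsilon>\<^sup>2)\<^sup>2) * x\<^sup>2" by simp
    ultimately show ?thesis by linarith
  qed
  also have "\<dots> \<le> (r + \<epsilon>\<^sup>2)\<^sup>2 * exp (4 * t\<^sup>2)"
  proof (rule mult_left_mono)
    have "1 + x\<^sup>2 \<le> exp (x\<^sup>2)" by (rule exp_ge_add_one_self)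
    also have "\<dots> \<le> exp (4 * t\<^sup>2)" using x2 by simp
    finally show "1 + x\<^sup>2 \<le> exp (4 * t\<^sup>2)" .
  qed simp
  finally have Xle: "X \<le> (r + \<epsilon>\<^sup>2)\<^sup>2 * exp (4 * t\<^sup>2)" .
  have mu: "0 < \<mu>" "\<mu> \<le> exp (- (L * t\<^sup>2 / 2))"
    using \<mu> exp_ge_add_one_self[of "- (L * t\<^sup>2 / 2)"] by (simp_all add: \<mu>_def)
  have mu1: "\<mu> \<le> 1"
    using L by (simp add: \<mu>_def)
  have strict: "\<mu> ^ (2 * k) * X ^ m < ((r + \<epsilon>\<^sup>2) ^ m)\<^sup>2"
  proof -
    have "\<mu> ^ (2 * k) \<le> \<mu> ^ 2" by (rule power_decreasing) (use k mu mu1 in auto)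
    also have "\<dots> \<le> (exp (- (L * t\<^sup>2 / 2)))\<^sup>2" using mu by (intro power_mono) auto
    also have "\<dots> = exp (- (L * t\<^sup>2))" by (simp add: exp_double[symmetric])
    finally have m1: "\<mu> ^ (2 * k) \<le> exp (- (L * t\<^sup>2))" .
    have "X ^ m \<le> ((r + \<epsilon>\<^sup>2)\<^sup>2 * exp (4 * t\<^sup>2)) ^ m" using Xle X0 by (intro power_mono) auto
    also have "\<dots> = ((r + \<epsilon>\<^sup>2) ^ m)\<^sup>2 * exp (real m * (4 * t\<^sup>2))"
      by (simp add: power_mult_distrib exp_of_nat_mult power_mult[symmetric] mult.commute)
    finally have m2: "X ^ m \<le> ((r + \<epsilon>\<^sup>2) ^ m)\<^sup>2 * exp (real m * (4 * t\<^sup>2))" .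
    have "\<mu> ^ (2 * k) * X ^ m \<le> exp (- (L * t\<^sup>2)) * (((r + \<epsilon>\<^sup>2) ^ m)\<^sup>2 * exp (real m * (4 * t\<^sup>2)))"
      using m1 m2 X0 by (intro mult_mono) auto
    also have "\<dots> = ((r + \<epsilon>\<^sup>2) ^ m)\<^sup>2 * exp ((real m * 4 - L) * t\<^sup>2)"
    proof -
      have "exp (- (L * t\<^sup>2)) * exp (real m * (4 * t\<^sup>2)) = exp ((real m * 4 - L) * t\<^sup>2)"
        unfolding mult_exp_exp by (simp add: algebra_simps)
      then show ?thesis by (metis mult.left_commute)
    qed
    also have "\<dots> < ((r + \<epsilon>\<^sup>2) ^ m)\<^sup>2 * 1"
    proof (rule mult_strict_left_mono)
      have "(real m * 4 - L) * t\<^sup>2 < 0" using L t(1) by (intro mult_neg_pos) (auto simp: m_def)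
      then show "exp ((real m * 4 - L) * t\<^sup>2) < 1" by simp
      show "0 < ((r + \<epsilon>\<^sup>2) ^ m)\<^sup>2" using rp by (intro zero_less_power)
    qed
    finally show ?thesis by simp
  qed
  have Rm: "0 < ((r + \<epsilon>\<^sup>2) ^ m)\<^sup>2" using rp by (intro zero_less_power)
  have "(\<mu> ^ k * (D / (r + \<epsilon>\<^sup>2) ^ m))\<^sup>2 = D\<^sup>2 * (\<mu> ^ (2 * k) / ((r + \<epsilon>\<^sup>2) ^ m)\<^sup>2)"
    by (simp add: power_mult_distrib power_divide power_mult[symmetric] mult.commute)
  also have "\<dots> < D\<^sup>2 * (1 / X ^ m)"
    using strict D X0 Rm by (intro mult_strict_left_mono) (simp_all add: field_simps)
  finally show ?thesis unfolding prod fz \<mu>_def by simp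
qed

text \<open>At a local maximum the matrix \<open>N = (A\<^sub>t + A\<^sub>-\<^sub>t) / 2\<close>, with \<open>A\<^sub>s\<close> the complex Hessian of \<open>u \<circ> T\<^sub>s\<close>, satisfies
  \<open>N \<le> \<mu> A\<^sub>0\<close>. Log-concavity bounds \<open>\<sigma>\<^sub>k(N)\<^sup>2\<close> from below by \<open>\<sigma>\<^sub>k(A\<^sub>t) \<sigma>\<^sub>k(A\<^sub>-\<^sub>t)\<close>, in which the dilation factors of the
  two maps cancel, and monotonicity bounds \<open>\<sigma>\<^sub>k(N)\<close> from above by \<open>\<mu>\<^sup>k \<sigma>\<^sub>k(A\<^sub>0)\<close>. By the equation this contradicts the
  behaviour of the right-hand side along the flow.\<close>

lemma symmetrized_no_local_max:
  fixes u :: "complex^'n \<Rightarrow> real"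
  assumes u: "C_on 2 u S" and S: "open S" and k: "1 \<le> k" "k \<le> CARD('n)"
    and adm: "\<And>y. y \<in> S \<Longrightarrow> gamma_cone k (complex_hess u y)"
    and eq: "\<And>y. y \<in> S \<Longrightarrow> sigma_k k (complex_hess u y) = f_eps c k \<epsilon> y"
    and c: "0 < c" and \<epsilon>: "0 < \<epsilon>"
    and J: "complex_structure J" and b: "\<bar>b\<bar> \<le> 1"
    and L: "4 * (real CARD('n) + 1) < L" and t: "t \<noteq> 0" "\<bar>t\<bar> \<le> 1 / 2" and \<mu>: "0 < 1 - L * t\<^sup>2 / 2"
    and z: "z \<in> S" "flow J b \<omega> t z \<in> S" "flow J b \<omega> (- t) z \<in> S" and d: "0 < d"
  shows "\<exists>y. dist z y < d \<and>
    u (flow J b \<omega> t z) + u (flow J b \<omega> (- t) z) - 2 * (1 - L * t\<^sup>2 / 2) * u z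
    < u (flow J b \<omega> t y) + u (flow J b \<omega> (- t) y) - 2 * (1 - L * t\<^sup>2 / 2) * u y"
proof (rule ccontr)
  assume "\<not> ?thesis"
  then have max: "u (flow J b \<omega> t y) + u (flow J b \<omega> (- t) y) - 2 * (1 - L * t\<^sup>2 / 2) * u y
    \<le> u (flow J b \<omega> t z) + u (flow J b \<omega> (- t) z) - 2 * (1 - L * t\<^sup>2 / 2) * u z" if "dist z y < d" for y
    using that by force
  define \<mu> where "\<mu> = 1 - L * t\<^sup>2 / 2"
  define T where "T s = similarity_mat J (exp (b * s) * cos (\<omega> * s)) (exp (b * s) * sin (\<omega> * s))" for s
  have flowT: "flow J b \<omega> s x = T s *v x" for s x by (simp add: flow_def T_def similarity_eq_mat)
  define A where "A s = pullback (T s) (complex_hess u (flow J b \<omega> s z))" for s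
  have bl: "bounded_linear (flow J b \<omega> s)" for s
    unfolding flow_def by (rule similarity_bounded_linear)
  have A: "gamma_cone k (A s)" "sigma_k k (A s) = exp (2 * b * s) ^ k * f_eps c k \<epsilon> (flow J b \<omega> s z)"
    if s: "flow J b \<omega> s z \<in> S" for s
  proof -
    have h: "hermitian (complex_hess u (flow J b \<omega> s z))" by (rule complex_hess_hermitian[OF u S s])
    have sig: "sigma_k j (A s) = exp (2 * b * s) ^ j * sigma_k j (complex_hess u (flow J b \<omega> s z))" if "j \<le> CARD('n)" for j
    proof -
      have "(exp (b * s) * cos (\<omega> * s))\<^sup>2 + (exp (b * s) * sin (\<omega> * s))\<^sup>2 \<noteq> 0" unfolding exp_cos_sin by simp
      from sigma_k_pullback[OF J h this that] show ?thesis unfolding A_def T_def exp_cos_sin .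
    qed
    show "gamma_cone k (A s)"
      using adm[OF s] k(2) unfolding gamma_cone_def by (auto simp: sig intro: hermitian_pullback h) (simp add: A_def hermitian_pullback h)
    show "sigma_k k (A s) = exp (2 * b * s) ^ k * f_eps c k \<epsilon> (flow J b \<omega> s z)"
      using sig[OF k(2)] eq[OF s] by simp
  qed
  define N where "N = cscale (of_real (1 / 2)) (A t + A (- t))"
  have AA: "gamma_cone k (A t + A (- t))" by (intro gamma_cone_add A z k)
  then have N: "gamma_cone k N" unfolding N_def by (intro gamma_cone_cscale k) auto
  have hz: "hermitian (complex_hess u z)" by (rule complex_hess_hermitian[OF u S z(1)])
  define P where "P = cscale (of_real \<mu>) (complex_hess u z) + cscale (of_real (- 1)) N"
  have hN: "hermitian N" using N by (simp add: gamma_cone_def)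
  have hP: "hermitian P" unfolding P_def by (intro hermitian_add hermitian_cscale hz hN)
  have hess_le: "hess_form u (flow J b \<omega> t z) (flow J b \<omega> t w) + hess_form u (flow J b \<omega> (- t) z) (flow J b \<omega> (- t) w)
      \<le> 2 * \<mu> * hess_form u z w" for w
    using hess_form_at_local_max[OF u S z(1) bl z(2) bl z(3) d] max unfolding \<mu>_def by blast
  have posP: "0 \<le> qform P w" for w
  proof -
    have qA: "qform (A s) w = (hess_form u (flow J b \<omega> s z) (flow J b \<omega> s w) + hess_form u (flow J b \<omega> s z) (flow J b \<omega> s (\<i> *s w))) / 4"
      if "flow J b \<omega> s z \<in> S" for s
      unfolding A_def qform_pullback qform_complex_hess[OF u S that] flowT[symmetric]
      by (simp add: flow_def similarity_i)
    have "qform P w = \<mu> * qform (complex_hess u z) w - (qform (A t) w + qform (A (- t)) w) / 2"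
      unfolding P_def N_def qform_add qform_cscale by (simp add: field_simps)
    also have "\<dots> \<ge> 0"
      using hess_le[of w] hess_le[of "\<i> *s w"]
      unfolding qA[OF z(2)] qA[OF z(3)] qform_complex_hess[OF u S z(1)] by (simp add: field_simps)
    finally show ?thesis .
  qed
  have NP: "N + P = cscale (of_real \<mu>) (complex_hess u z)"
    unfolding P_def by (simp add: vec_eq_iff)
  have "sigma_k k N \<le> sigma_k k (N + P)" by (rule sigma_k_mono[OF N hP posP k(2)])
  then have Nle: "sigma_k k N \<le> \<mu> ^ k * f_eps c k \<epsilon> z"
    unfolding NP sigma_k_cscale[OF hz k(2)] eq[OF z(1)] .
  have N2: "sigma_k k (A t + A (- t)) = 2 ^ k * sigma_k k N"
  proof -
    have "sigma_k k N = (1 / 2) ^ k * sigma_k k (A t + A (- t))"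
      unfolding N_def by (rule sigma_k_cscale) (use AA k in \<open>auto simp: gamma_cone_def\<close>)
    then show ?thesis by (simp add: power_divide)
  qed
  have "4 ^ k * (sigma_k k (A t) * sigma_k k (A (- t))) \<le> (sigma_k k (A t + A (- t)))\<^sup>2"
    by (intro sigma_k_log_concave A z k)
  also have "\<dots> = 4 ^ k * (sigma_k k N)\<^sup>2"
    unfolding N2 by (simp add: power_mult_distrib power2_eq_square power_mult_distrib[symmetric])
  finally have "sigma_k k (A t) * sigma_k k (A (- t)) \<le> (sigma_k k N)\<^sup>2" by simp
  also have "\<dots> \<le> (\<mu> ^ k * f_eps c k \<epsilon> z)\<^sup>2"
    using Nle gamma_cone_sigma_k_pos[OF N] by (intro power_mono) auto
  also have "sigma_k k (A t) * sigma_k k (A (- t)) = f_eps c k \<epsilon> (flow J b \<omega> t z) * f_eps c k \<epsilon> (flow J b \<omega> (- t) z)"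
  proof -
    have "exp (2 * b * t) ^ k * exp (2 * b * (- t)) ^ k = 1"
      by (simp add: power_mult_distrib[symmetric] mult_exp_exp)
    then show ?thesis unfolding A(2)[OF z(2)] A(2)[OF z(3)] by (simp add: mult_ac)
  qed
  finally show False
    using f_eps_symmetrized_strict[OF J b c \<epsilon> k(1) L t \<mu>, of z \<omega>] unfolding \<mu>_def by simp
qed

lemma continuous_on_hess_form:
  fixes u :: "'a::euclidean_space \<Rightarrow> real"
  assumes u: "C_on 2 u S" and S: "open S" and g: "continuous_on S g"
  shows "continuous_on S (\<lambda>y. hess_form u y (g y))"
  unfolding hess_form_def by (intro continuous_intros C_on_2_hess[OF u S] g)

lemma continuous_on_second_flow_derivative:
  fixes u :: "complex^'n \<Rightarrow> real"
  assumes u: "C_on 2 u S" and S: "open S"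
  shows "continuous_on S (second_flow_derivative J b \<omega> u)"
proof -
  have s: "continuous_on S (\<lambda>y. similarity J b \<omega> (g y))" if "continuous_on S g" for g
    using linear_continuous_on_compose[OF that bounded_linear.linear[OF similarity_bounded_linear]] .
  show ?thesis
    unfolding second_flow_derivative_def grad_inner
    by (intro continuous_intros continuous_on_hess_form[OF u S] s C_on_2_cont_pdiff[OF u S])
qed

text \<open>The set \<open>K\<close> collects the points where the estimate is not known a priori. A short flow line through the maximum point
  \<open>y0\<close> of the symmetrized difference either avoids \<open>K\<close>, and then the known estimate makes the difference nonpositive at \<open>y0\<close>;
  or it meets \<open>K\<close>, and then \<open>y0\<close> is an interior point of the compact neighbourhood on which the maximum is taken, which is
  excluded. The factor \<open>exp p\<close> accounts for the change of \<open>|y|\<^sup>-\<^sup>p\<close> along the flow over times at most one.\<close>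

lemma second_flow_derivative_bound:
  fixes u :: "complex^'n \<Rightarrow> real"
  assumes u: "C_on 2 u S" and S: "open S" and k: "1 \<le> k" "k \<le> CARD('n)"
    and adm: "\<And>y. y \<in> S \<Longrightarrow> gamma_cone k (complex_hess u y)"
    and eq: "\<And>y. y \<in> S \<Longrightarrow> sigma_k k (complex_hess u y) = f_eps c k \<epsilon> y"
    and c: "0 < c" and \<epsilon>: "0 < \<epsilon>"
    and J: "complex_structure J" and b: "\<bar>b\<bar> \<le> 1"
    and L: "4 * (real CARD('n) + 1) < L"
    and K: "compact K" "K \<subseteq> S" and p: "0 \<le> p" and M: "0 \<le> M"
    and outside: "\<And>y. y \<in> S - K \<Longrightarrow> second_flow_derivative J b \<omega> u y \<le> M * norm y powr (- p)"
    and lower: "\<And>y. y \<in> S \<Longrightarrow> M * exp p * norm y powr (- p) \<le> L * (- u y)"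
    and z0: "z0 \<in> S"
  shows "second_flow_derivative J b \<omega> u z0 \<le> L * (- u z0)"
proof (rule ccontr)
  assume neg: "\<not> ?thesis"
  define \<eta> where "\<eta> = second_flow_derivative J b \<omega> u z0 + L * u z0"
  have \<eta>: "0 < \<eta>" using neg by (simp add: \<eta>_def)
  have L0: "0 < L" using L by simp
  let ?F = "flow J b \<omega>"
  define K1 where "K1 = insert z0 K"
  have K1: "compact K1" "K1 \<subseteq> S" using K z0 by (auto simp: K1_def)
  obtain e where e: "0 < e" "(\<Union>x\<in>K1. cball x e) \<subseteq> S"
    using compact_subset_open_imp_cball_epsilon_subset[OF K1(1) S K1(2)] by blast
  define Lc where "Lc = (\<Union>x\<in>K1. cball x e)"
  have Lc: "compact Lc" "Lc \<subseteq> S" using compact_minkowski_sum_cball[OF K1(1)] e by (auto simp: Lc_def)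
  obtain e' where e': "0 < e'" "(\<Union>x\<in>Lc. cball x e') \<subseteq> S"
    using compact_subset_open_imp_cball_epsilon_subset[OF Lc(1) S Lc(2)] by blast
  obtain R where R: "0 < R" "\<And>y. y \<in> Lc \<Longrightarrow> norm y \<le> R"
    using compact_imp_bounded[OF Lc(1)] unfolding bounded_pos by auto
  define r where "r = min (e / 2) e'"
  have r: "0 < r" using e e' by (simp add: r_def)
  \<comment> \<open>for short times the flow is uniformly close to the identity on the compact neighbourhood\<close>
  obtain t1 where t1: "0 < t1" "\<And>s y. \<bar>s\<bar> < t1 \<Longrightarrow> y \<in> Lc \<Longrightarrow> dist y (?F s y) < r"
  proof -
    define h where "h s = (\<bar>exp (b * s) * cos (\<omega> * s) - 1\<bar> + \<bar>exp (b * s) * sin (\<omega> * s)\<bar>) * R" for s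
    have "isCont h 0" unfolding h_def by (intro continuous_intros)
    moreover have "h 0 = 0" by (simp add: h_def)
    ultimately obtain t1 where t1: "0 < t1" "\<And>s. \<bar>s\<bar> < t1 \<Longrightarrow> \<bar>h s\<bar> < r"
      using r unfolding continuous_at_eps_delta by (metis dist_real_def diff_zero dist_commute)
    show ?thesis
    proof (rule that[OF t1(1)])
      fix s y assume s: "\<bar>s\<bar> < t1" and y: "y \<in> Lc"
      have "?F s y - y = (exp (b * s) * cos (\<omega> * s) - 1) *\<^sub>R y + (exp (b * s) * sin (\<omega> * s)) *\<^sub>R (J *v y)"
        by (simp add: flow_def similarity_def algebra_simps)
      then have "norm (?F s y - y) \<le> (\<bar>exp (b * s) * cos (\<omega> * s) - 1\<bar> + \<bar>exp (b * s) * sin (\<omega> * s)\<bar>) * norm y"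
        using norm_triangle_ineq[of "(exp (b * s) * cos (\<omega> * s) - 1) *\<^sub>R y" "(exp (b * s) * sin (\<omega> * s)) *\<^sub>R (J *v y)"]
        by (simp add: complex_structure_norm[OF J] distrib_right)
      also have "\<dots> \<le> h s" unfolding h_def by (intro mult_left_mono R y) auto
      also have "\<dots> < r" using t1(2)[OF s] by linarith
      finally show "dist y (?F s y) < r" by (simp add: dist_norm norm_minus_commute)
    qed
  qed
  have inS: "?F s y \<in> S" if "\<bar>s\<bar> < t1" "y \<in> Lc" for s y
  proof -
    have "?F s y \<in> cball y e'" using t1(2)[OF that] by (auto simp: r_def)
    then show ?thesis using e'(2) that(2) by blast
  qed
  have z0L: "z0 \<in> Lc" using e(1) by (auto simp: Lc_def K1_def)
  have "continuous (at z0) (second_flow_derivative J b \<omega> u)"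
    using continuous_on_second_flow_derivative[OF u S] z0 S continuous_on_eq_continuous_at by blast
  then obtain \<delta> where \<delta>: "0 < \<delta>" "\<And>y. dist y z0 < \<delta> \<Longrightarrow> \<bar>second_flow_derivative J b \<omega> u y - second_flow_derivative J b \<omega> u z0\<bar> < \<eta> / 2"
    using \<eta> unfolding continuous_at_eps_delta by (metis dist_real_def half_gt_zero)
  have "isCont (\<lambda>s. ?F s z0) 0"
    using flow_derivative[OF J, of b \<omega> z0 0] has_vector_derivative_continuous by blast
  then obtain t2 where t2: "0 < t2" "\<And>s. \<bar>s\<bar> < t2 \<Longrightarrow> dist (?F s z0) z0 < \<delta>"
    using \<delta>(1) unfolding continuous_at_eps_delta by (metis dist_real_def diff_zero flow_0)
  \<comment> \<open>the bound \<open>1 / L\<close> keeps \<open>\<mu>\<close> positive, and \<open>1 / 2\<close> is the range of \<open>f_eps_symmetrized_strict\<close>\<close>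
  define m where "m = min (min t1 t2) (min (1 / 2) (1 / L))"
  have m: "0 < m" "m \<le> t1" "m \<le> t2" "m \<le> 1 / 2" "m \<le> 1 / L"
    using t1(1) t2(1) L0 by (simp_all add: m_def)
  define t where "t = m / 2"
  have t: "0 < t" "t < t1" "t < t2" "t \<le> 1 / 2" "t < 1 / L"
    using m unfolding t_def by linarith+
  have \<mu>: "0 < 1 - L * t\<^sup>2 / 2"
  proof -
    have "L * t < 1" using t L0 by (simp add: field_simps)
    then have "L * t * t < 1 * 1" using t by (intro mult_strict_mono) auto
    then show ?thesis by (simp add: power2_eq_square mult.assoc)
  qed
  define W where "W y = u (?F t y) + u (?F (- t) y) - 2 * (1 - L * t\<^sup>2 / 2) * u y" for y
  have d1: "((\<lambda>t. u (?F t y)) has_real_derivative grad u (?F s y) \<bullet> similarity J b \<omega> (?F s y)) (at s)"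
    and d2: "((\<lambda>t. grad u (?F t y) \<bullet> similarity J b \<omega> (?F t y)) has_real_derivative second_flow_derivative J b \<omega> u (?F s y)) (at s)"
    if "\<bar>s\<bar> \<le> t" "y \<in> Lc" for s y
    using flow_derivatives[OF J u S inS[of s y]] that t by auto
  have Wz0: "0 < W z0"
  proof -
    have "- u (?F t z0) + - u (?F (- t) z0) - 2 * (- u (?F 0 z0)) \<le> - (second_flow_derivative J b \<omega> u z0 - \<eta> / 2) * t\<^sup>2"
    proof (rule second_difference_le)
      show "0 \<le> t" using t by simp
      fix s assume s: "\<bar>s\<bar> \<le> t"
      show "((\<lambda>t. - u (?F t z0)) has_real_derivative - (grad u (?F s z0) \<bullet> similarity J b \<omega> (?F s z0))) (at s)"
        by (intro DERIV_minus d1 s z0L)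
      show "((\<lambda>s. - (grad u (?F s z0) \<bullet> similarity J b \<omega> (?F s z0))) has_real_derivative - second_flow_derivative J b \<omega> u (?F s z0)) (at s)"
        by (intro DERIV_minus d2 s z0L)
      show "- second_flow_derivative J b \<omega> u (?F s z0) \<le> - (second_flow_derivative J b \<omega> u z0 - \<eta> / 2)"
      proof -
        have "dist (?F s z0) z0 < \<delta>" by (rule t2(2)) (use s t in auto)
        from \<delta>(2)[OF this] show ?thesis by (simp only: abs_less_iff) linarith
      qed
    qed
    then have "(\<eta> / 2) * t\<^sup>2 \<le> W z0"
      by (simp add: W_def \<eta>_def field_simps)
    moreover have "0 < (\<eta> / 2) * t\<^sup>2" using \<eta> t by simp
    ultimately show ?thesis by linarith
  qed
  have contW: "continuous_on Lc W"
  proof -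
    have cu: "continuous_on S u"
      using C_on_2_grad[OF u S] by (meson continuous_at_imp_continuous_on has_derivative_continuous)
    have "continuous_on Lc (\<lambda>y. u (?F s y))" if "\<bar>s\<bar> < t1" for s
    proof (rule continuous_on_compose2[OF cu])
      show "continuous_on Lc (?F s)" unfolding flow_def
        by (rule linear_continuous_on[OF similarity_bounded_linear])
    qed (use inS that in auto)
    moreover have "continuous_on Lc u" using cu Lc(2) continuous_on_subset by blast
    ultimately show ?thesis unfolding W_def using t by (intro continuous_intros) auto
  qed
  obtain y0 where y0: "y0 \<in> Lc" "\<And>y. y \<in> Lc \<Longrightarrow> W y \<le> W y0"
    using continuous_attains_sup[OF Lc(1) _ contW] z0L by blast
  have Wy0: "0 < W y0" using Wz0 y0(2)[OF z0L] by simp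
  show False
  proof (cases "\<exists>s. \<bar>s\<bar> \<le> t \<and> ?F s y0 \<in> K")
    case True
    then obtain s where s: "\<bar>s\<bar> \<le> t" "?F s y0 \<in> K" by blast
    have "ball y0 (e / 2) \<subseteq> Lc"
    proof
      fix y assume "y \<in> ball y0 (e / 2)"
      moreover have "dist y0 (?F s y0) < e / 2" using t1(2)[of s y0] s t y0 by (auto simp: r_def)
      ultimately have "dist (?F s y0) y \<le> e" using dist_triangle[of "?F s y0" y y0] by (simp add: dist_commute)
      then show "y \<in> Lc" using s by (auto simp: Lc_def K1_def)
    qed
    then have le: "W y \<le> W y0" if "dist y0 y < e / 2" for y using y0(2) that by (auto simp: subset_iff)
    have yS: "y0 \<in> S" using y0 Lc by blast
    have "\<exists>y. dist y0 y < e / 2 \<and> W y0 < W y"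
      unfolding W_def
      by (rule symmetrized_no_local_max[OF u S k adm eq c \<epsilon> J b L _ _ \<mu> yS inS[OF _ y0(1)] inS[OF _ y0(1)]]) (use t e in auto)
    then show False using le by force
  next
    case False
    have "u (?F t y0) + u (?F (- t) y0) - 2 * u (?F 0 y0) \<le> (M * exp p * norm y0 powr (- p)) * t\<^sup>2"
    proof (rule second_difference_le)
      show "0 \<le> t" using t by simp
      fix s assume s: "\<bar>s\<bar> \<le> t"
      show "((\<lambda>t. u (?F t y0)) has_real_derivative grad u (?F s y0) \<bullet> similarity J b \<omega> (?F s y0)) (at s)"
        by (intro d1 s y0)
      show "((\<lambda>t. grad u (?F t y0) \<bullet> similarity J b \<omega> (?F t y0)) has_real_derivative second_flow_derivative J b \<omega> u (?F s y0)) (at s)"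
        by (intro d2 s y0)
      have "second_flow_derivative J b \<omega> u (?F s y0) \<le> M * norm (?F s y0) powr (- p)"
        using outside False s inS[of s y0] t y0 by auto
      also have "norm (?F s y0) powr (- p) = exp (- p * (b * s)) * norm y0 powr (- p)"
        by (simp add: norm_flow[OF J] powr_mult exp_powr_real mult_ac)
      also have "M * (exp (- p * (b * s)) * norm y0 powr (- p)) \<le> M * (exp p * norm y0 powr (- p))"
      proof (intro mult_left_mono mult_right_mono M)
        have "\<bar>b\<bar> * \<bar>s\<bar> \<le> 1 * 1" using b s t by (intro mult_mono) auto
        then have "\<bar>b * s\<bar> \<le> 1" by (simp add: abs_mult)
        then have "p * (- (b * s)) \<le> p * 1" using p by (intro mult_left_mono) auto
        then show "exp (- p * (b * s)) \<le> exp p" by simp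
      qed auto
      finally show "second_flow_derivative J b \<omega> u (?F s y0) \<le> M * exp p * norm y0 powr (- p)" by (simp add: mult.assoc)
    qed
    also have "\<dots> \<le> (L * (- u y0)) * t\<^sup>2"
      using lower[of y0] y0 Lc by (intro mult_right_mono) auto
    finally have "W y0 \<le> 0" by (simp add: W_def algebra_simps)
    with Wy0 show False by simp
  qed
qed

section \<open>Recovering the Hessian\<close>

lemma hess_form_le_hess_norm:
  fixes u :: "'a::euclidean_space \<Rightarrow> real"
  shows "hess_form u y h \<le> hess_norm (hess u y) * (norm h)\<^sup>2"
proof -
  let ?B = "Basis \<times> Basis :: ('a \<times> 'a) set"
  define H where "H p = hess u y (fst p) (snd p)" for p
  define G where "G p = (h \<bullet> fst p) * (h \<bullet> snd p)" for p
  have f: "hess_form u y h = (\<Sum>p\<in>?B. H p * G p)"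
    by (simp add: hess_form_def H_def G_def sum.cartesian_product case_prod_unfold mult.assoc)
  have n: "(hess_norm (hess u y))\<^sup>2 = (\<Sum>p\<in>?B. (H p)\<^sup>2)"
    by (simp add: hess_norm_def H_def sum.cartesian_product case_prod_unfold sum_nonneg)
  have g: "((norm h)\<^sup>2)\<^sup>2 = (\<Sum>p\<in>?B. (G p)\<^sup>2)"
  proof -
    have "(norm h)\<^sup>2 = (\<Sum>b\<in>Basis. (h \<bullet> b)\<^sup>2)"
      unfolding power2_norm_eq_inner by (subst euclidean_inner) (simp add: power2_eq_square)
    then have "((norm h)\<^sup>2)\<^sup>2 = (\<Sum>b\<in>Basis. (h \<bullet> b)\<^sup>2) * (\<Sum>b\<in>Basis. (h \<bullet> b)\<^sup>2)"
      by (simp add: power2_eq_square)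
    then show ?thesis
      by (simp add: sum_product sum.cartesian_product case_prod_unfold G_def power_mult_distrib)
  qed
  have "(hess_form u y h)\<^sup>2 \<le> (hess_norm (hess u y) * (norm h)\<^sup>2)\<^sup>2"
    unfolding f power_mult_distrib[of "hess_norm (hess u y)"] n g by (rule Cauchy_Schwarz_ineq_sum)
  moreover have "0 \<le> hess_norm (hess u y) * (norm h)\<^sup>2"
    by (simp add: hess_norm_def sum_nonneg)
  ultimately show ?thesis by (rule power2_le_imp_le)
qed

text \<open>An upper bound for the quadratic form and a nonnegative trace bound the diagonal entries from both sides; the off-diagonal
  entries then follow by evaluating the form at \<open>b + c\<close> and \<open>b - c\<close>.\<close>

lemma hess_norm_le_of_form_le:
  fixes u :: "'a::euclidean_space \<Rightarrow> real"
  assumes sym: "\<And>b c. b \<in> Basis \<Longrightarrow> c \<in> Basis \<Longrightarrow> hess u y b c = hess u y c b"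
    and tr: "0 \<le> (\<Sum>b\<in>Basis. hess u y b b)"
    and le: "\<And>h. hess_form u y h \<le> M * (norm h)\<^sup>2"
  shows "hess_norm (hess u y) \<le> (real DIM('a))\<^sup>2 * M"
proof -
  let ?D = "real DIM('a)"
  have pair: "hess_form u y (r *\<^sub>R b + s *\<^sub>R c) = r\<^sup>2 * hess u y b b + s\<^sup>2 * hess u y c c + 2 * r * s * hess u y b c"
    if b: "b \<in> Basis" and c: "c \<in> Basis" for b c r s
  proof -
    have "hess_form u y (r *\<^sub>R b + s *\<^sub>R c) = (\<Sum>i\<in>Basis. \<Sum>j\<in>Basis. hess u y i j *
       ((if i = b then r else 0) + (if i = c then s else 0)) * ((if j = b then r else 0) + (if j = c then s else 0)))"
      unfolding hess_form_def using b c
      by (intro sum.cong refl) (simp add: inner_add_left inner_Basis)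
    also have "\<dots> = (\<Sum>i\<in>Basis. (hess u y i b * r + hess u y i c * s) * ((if i = b then r else 0) + (if i = c then s else 0)))"
    proof (intro sum.cong refl)
      fix i :: 'a
      have "(\<Sum>j\<in>Basis. hess u y i j * v * ((if j = b then r else 0) + (if j = c then s else 0))) =
         (\<Sum>j\<in>Basis. (if j = b then hess u y i b * v * r else 0) + (if j = c then hess u y i c * v * s else 0))" for v
        by (intro sum.cong) (auto simp: algebra_simps)
      then show "(\<Sum>j\<in>Basis. hess u y i j * ((if i = b then r else 0) + (if i = c then s else 0)) * ((if j = b then r else 0) + (if j = c then s else 0))) =
        (hess u y i b * r + hess u y i c * s) * ((if i = b then r else 0) + (if i = c then s else 0))"
        using b c by (simp only: sum.distrib sum.delta finite_Basis if_True) (simp add: algebra_simps)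
    qed
    also have "\<dots> = (\<Sum>i\<in>Basis. (if i = b then (hess u y b b * r + hess u y b c * s) * r else 0)
        + (if i = c then (hess u y c b * r + hess u y c c * s) * s else 0))"
      by (intro sum.cong) (auto simp: algebra_simps)
    also have "\<dots> = (hess u y b b * r + hess u y b c * s) * r + (hess u y c b * r + hess u y c c * s) * s"
      using b c by (simp only: sum.distrib sum.delta finite_Basis if_True)
    finally show ?thesis using sym[OF b c] by (simp add: power2_eq_square algebra_simps)
  qed
  have diag: "hess u y b b \<le> M" if b: "b \<in> Basis" for b
    using le[of "1 *\<^sub>R b + 0 *\<^sub>R b"] pair[OF b b, of 1 0] b by simp
  have M: "0 \<le> M"
  proof -
    have "0 \<le> (\<Sum>b\<in>(Basis::'a set). M)" using tr diag by (meson order.trans sum_mono)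
    then show ?thesis by (simp add: zero_le_mult_iff)
  qed
  have diag': "- ((?D - 1) * M) \<le> hess u y b b" if b: "b \<in> Basis" for b
  proof -
    have "(\<Sum>b\<in>Basis. hess u y b b) = hess u y b b + (\<Sum>c\<in>Basis - {b}. hess u y c c)"
      using b by (simp add: sum.remove)
    also have "(\<Sum>c\<in>Basis - {b}. hess u y c c) \<le> (\<Sum>c\<in>Basis - {b}. M)"
      by (intro sum_mono diag) auto
    also have "\<dots> = (?D - 1) * M" using b by (simp add: of_nat_diff)
    finally show ?thesis using tr by simp
  qed
  have entry: "\<bar>hess u y b c\<bar> \<le> ?D * M" if b: "b \<in> Basis" and c: "c \<in> Basis" for b c
  proof (cases "b = c")
    case True
    have "1 \<le> ?D" by (simp add: Suc_leI)
    then have "1 * M \<le> ?D * M" using M by (rule mult_right_mono)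
    then show ?thesis using True diag[OF b] diag'[OF b] M by (simp add: algebra_simps abs_le_iff)
  next
    case False
    then have bc: "b \<bullet> c = 0" using b c by (simp add: inner_Basis)
    have n: "(norm (r *\<^sub>R b + s *\<^sub>R c))\<^sup>2 = r\<^sup>2 + s\<^sup>2" for r s
      unfolding power2_norm_eq_inner using b c bc
      by (simp add: inner_add_left inner_add_right inner_commute[of c b] power2_eq_square)
    have "hess u y b b + hess u y c c + 2 * hess u y b c \<le> M * 2"
      using le[of "1 *\<^sub>R b + 1 *\<^sub>R c"] unfolding pair[OF b c] n by simp
    moreover have "hess u y b b + hess u y c c - 2 * hess u y b c \<le> M * 2"
      using le[of "1 *\<^sub>R b + (-1) *\<^sub>R c"] unfolding pair[OF b c] n by simp
    ultimately show ?thesis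
      using diag'[OF b] diag'[OF c] by (simp add: algebra_simps abs_le_iff)
  qed
  have "(\<Sum>b\<in>Basis. \<Sum>c\<in>Basis. (hess u y b c)\<^sup>2) \<le> (\<Sum>b\<in>(Basis::'a set). \<Sum>c\<in>(Basis::'a set). (?D * M)\<^sup>2)"
  proof (intro sum_mono)
    fix b c :: 'a assume "b \<in> Basis" "c \<in> Basis"
    then show "(hess u y b c)\<^sup>2 \<le> (?D * M)\<^sup>2" using entry[of b c] M by (simp add: abs_le_square_iff[symmetric] abs_mult)
  qed
  also have "\<dots> = (?D\<^sup>2 * M)\<^sup>2" by (simp add: power2_eq_square)
  finally have "hess_norm (hess u y) \<le> sqrt ((?D\<^sup>2 * M)\<^sup>2)"
    unfolding hess_norm_def by (rule real_sqrt_le_mono)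
  then show ?thesis using M by simp
qed

text \<open>On the closure this set is described by a weak inequality between continuous functions, and the strict inequality
  on the boundary keeps it inside \<open>S\<close>.\<close>

lemma compact_large_hessian:
  fixes u :: "'a::euclidean_space \<Rightarrow> real"
  assumes u: "C_on_closure 2 u S" and S: "open S" "bounded S"
    and \<beta>: "continuous_on (closure S) \<beta>"
    and bd: "\<And>x. x \<in> frontier S \<Longrightarrow> hess_norm (hess_ext S u x) < \<beta> x"
  shows "compact {x \<in> S. \<beta> x \<le> hess_norm (hess u x)}"
proof -
  have "\<exists>g. continuous_on (closure S) g \<and> (\<forall>x\<in>S. g x = hess u x b c)" if "b \<in> Basis" "c \<in> Basis" for b c
  proof -
    have "[b, c] \<in> lists Basis" "length [b, c] \<le> 2" using that by auto
    then have "\<exists>g. continuous_on (closure S) g \<and> (\<forall>x\<in>S. g x = pdiffs [b, c] u x)"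
      using u unfolding C_on_closure_def by blast
    then show ?thesis by (simp add: hess_def)
  qed
  then obtain g where g: "\<And>b c. b \<in> Basis \<Longrightarrow> c \<in> Basis \<Longrightarrow> continuous_on (closure S) (g b c)"
    "\<And>b c x. b \<in> Basis \<Longrightarrow> c \<in> Basis \<Longrightarrow> x \<in> S \<Longrightarrow> g b c x = hess u x b c" by metis
  have ext: "hess_ext S u x b c = g b c x" if x: "x \<in> frontier S" and b: "b \<in> Basis" and c: "c \<in> Basis" for x b c
  proof -
    have xc: "x \<in> closure S" and xn: "x \<notin> S"
      using x S(1) by (auto simp: frontier_def interior_open)
    then have lim: "\<not> trivial_limit (at x within S)"
      by (simp add: trivial_limit_within closure_def)
    have "(g b c \<longlongrightarrow> g b c x) (at x within closure S)" using g(1)[OF b c] xc by (simp add: continuous_on)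
    then have "(g b c \<longlongrightarrow> g b c x) (at x within S)" by (rule tendsto_within_subset) (rule closure_subset)
    then have "((\<lambda>y. hess u y b c) \<longlongrightarrow> g b c x) (at x within S)"
      by (rule Lim_transform_within[OF _ zero_less_one]) (simp add: g(2)[OF b c])
    then show ?thesis unfolding hess_ext_def using tendsto_Lim[OF lim] by blast
  qed
  define G where "G x = hess_norm (\<lambda>b c. g b c x)" for x
  have GS: "G x = hess_norm (hess u x)" if "x \<in> S" for x
    using that by (simp add: G_def hess_norm_def g(2))
  have GF: "G x = hess_norm (hess_ext S u x)" if "x \<in> frontier S" for x
    using that by (simp add: G_def hess_norm_def ext)
  have cG: "continuous_on (closure S) G"
    unfolding G_def hess_norm_def by (intro continuous_intros g(1))
  have "{x \<in> S. \<beta> x \<le> hess_norm (hess u x)} = {x \<in> closure S. \<beta> x \<le> G x}"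
  proof -
    have "closure S = S \<union> frontier S" by (rule closure_Un_frontier)
    then show ?thesis using GS GF bd by force
  qed
  also have "compact \<dots>"
  proof -
    have "closedin (top_of_set (closure S)) {x \<in> closure S. \<beta> x \<le> G x}"
      using continuous_on_closed_Collect_le[OF \<beta> cG] by (simp add: closed_subset)
    then show ?thesis
      using S(2) closedin_compact compact_closure by blast
  qed
  finally show ?thesis .
qed

text \<open>Split \<open>h\<close> into its component along \<open>z\<close>, produced by the dilation, and the orthogonal rest, produced by a complex
  structure.\<close>

lemma direction_of_flow:
  fixes z h :: "complex^'n"
  assumes len: "norm h = norm z" and z: "z \<noteq> 0"
  obtains J b \<omega> where "complex_structure J" "b\<^sup>2 + \<omega>\<^sup>2 = 1" "similarity J b \<omega> z = h"
proof -
  define b where "b = (h \<bullet> z) / (norm z)\<^sup>2"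
  define h' where "h' = h - b *\<^sub>R z"
  have nz: "0 < (norm z)\<^sup>2" using z by simp
  have hz: "z \<bullet> h' = 0"
    using nz by (simp add: h'_def b_def inner_diff_right inner_commute power2_norm_eq_inner)
  have "(norm h)\<^sup>2 = (norm h')\<^sup>2 + b\<^sup>2 * (norm z)\<^sup>2"
  proof -
    have "h = h' + b *\<^sub>R z" by (simp add: h'_def)
    then have n: "h \<bullet> h = (h' + b *\<^sub>R z) \<bullet> (h' + b *\<^sub>R z)" by simp
    show ?thesis
      unfolding power2_norm_eq_inner n using hz
      by (simp add: inner_add_left inner_add_right inner_commute[of h' z] power2_eq_square)
  qed
  then have n: "(norm h')\<^sup>2 = (1 - b\<^sup>2) * (norm z)\<^sup>2" using len by (simp add: algebra_simps)
  define \<omega> where "\<omega> = norm h' / norm z"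
  have w: "\<omega>\<^sup>2 = 1 - b\<^sup>2" using n nz by (simp add: \<omega>_def power_divide)
  show ?thesis
  proof (cases "\<omega> = 0")
    case True
    then have "h' = 0" using z by (simp add: \<omega>_def)
    then have "similarity (mat \<i>) b \<omega> z = h" using True by (simp add: similarity_def h'_def)
    then show ?thesis using that[OF complex_structure_i, of b \<omega>] w by simp
  next
    case False
    define \<zeta> where "\<zeta> = (1 / \<omega>) *\<^sub>R h'"
    have "z \<bullet> \<zeta> = 0" using hz by (simp add: \<zeta>_def)
    moreover have "norm \<zeta> = norm z" using False z by (simp add: \<zeta>_def \<omega>_def)
    ultimately obtain J where J: "complex_structure J" "J *v z = \<zeta>" by (rule complex_structure_transitive)
    have "similarity J b \<omega> z = h" using False by (simp add: similarity_def J(2) \<zeta>_def h'_def)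
    then show ?thesis using that[OF J(1), of b \<omega>] w by simp
  qed
qed

text \<open>The constant \<open>L\<close> has to dominate \<open>2 C\<^sub>0\<^sup>2 exp (q - 2)\<close>, so that \<open>L (-u)\<close> exceeds the second flow derivative wherever
  \<open>D\<^sup>2u\<close> is under control, and \<open>4 (n + 1)\<close>, as the variation of the right-hand side requires. The points at which
  \<open>D\<^sup>2u\<close> is not under control form a compact subset of the domain by the boundary estimate.\<close>

lemma hessian_decay:
  fixes u :: "complex^'n \<Rightarrow> real"
  assumes k: "1 \<le> k" "k < CARD('n)" and c: "0 < c" and C0: "0 < C\<^sub>0" and \<epsilon>: "0 < \<epsilon>"
    and S: "open S" "bounded S" "0 \<notin> closure S"
    and u: "C_on_closure 2 u S" and adm: "admissible k S u"
    and eq: "\<And>z. z \<in> S \<Longrightarrow> sigma_k k (complex_hess u z) = f_eps c k \<epsilon> z"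
    and q: "q = 2 * real CARD('n) / real k"
    and C0_est: "\<And>z. z \<in> S \<Longrightarrow> inverse C\<^sub>0 * norm z powr (2 - q) < - u z \<and> - u z < C\<^sub>0 * norm z powr (2 - q)"
    and C1_est: "\<And>z. z \<in> S \<Longrightarrow> norm (grad u z) < C\<^sub>0 * norm z powr (1 - q)"
    and C2_est: "\<And>z. z \<in> frontier S \<Longrightarrow> hess_norm (hess_ext S u z) < C\<^sub>0 * norm z powr (- q)"
    and L: "L = 2 * C\<^sub>0\<^sup>2 * exp (q - 2) + 4 * (real CARD('n) + 1) + 1"
    and z: "z \<in> S"
  shows "hess_norm (hess u z) \<le> (real DIM(complex^'n))\<^sup>2 * ((L + 1) * C\<^sub>0) * norm z powr (- q)"
proof -
  have C2: "C_on 2 u S" using adm by (simp add: admissible_def)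
  have herm: "hermitian (complex_hess u y)" if "y \<in> S" for y
    by (rule complex_hess_hermitian[OF C2 S(1) that])
  have cone: "gamma_cone k (complex_hess u y)" if "y \<in> S" for y
    using adm herm[OF that] that by (auto simp: admissible_def Gamma_cone_def gamma_cone_def sigma_k_def)
  have n0: "y \<noteq> 0" if "y \<in> S" for y using S(3) that closure_subset by blast
  have q2: "2 \<le> q" using k by (simp add: q field_simps)
  have "0 \<le> 2 * C\<^sub>0\<^sup>2 * exp (q - 2)" by simp
  then have L4: "4 * (real CARD('n) + 1) < L" unfolding L by linarith
  moreover have "0 \<le> 4 * (real CARD('n) + 1)" by simp
  ultimately have L0: "0 < L" by linarith
  have pw1: "norm y powr (1 - q) * norm y = norm y powr (2 - q)" if "y \<in> S" for y
    using n0[OF that] powr_add[of "norm y" "1 - q" 1] by simp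
  have pw2: "norm y powr (- q) * (norm y)\<^sup>2 = norm y powr (2 - q)" if "y \<in> S" for y
    using n0[OF that] powr_add[of "norm y" "- q" 2] by (simp add: powr_numeral)
  define K where "K = {x \<in> S. C\<^sub>0 * norm x powr (- q) \<le> hess_norm (hess u x)}"
  have K: "compact K" unfolding K_def
  proof (rule compact_large_hessian[OF u S(1,2) _ C2_est])
    show "continuous_on (closure S) (\<lambda>x. C\<^sub>0 * norm x powr (- q))"
      using S(3) by (intro continuous_intros) auto
  qed
  have gr: "grad u y \<bullet> v \<le> C\<^sub>0 * norm y powr (2 - q)" if y: "y \<in> S" and v: "norm v = norm y" for y v
  proof -
    have "grad u y \<bullet> v \<le> norm (grad u y) * norm v" by (rule norm_cauchy_schwarz)
    also have "\<dots> \<le> (C\<^sub>0 * norm y powr (1 - q)) * norm y"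
      unfolding v using C1_est[OF y] by (intro mult_right_mono) auto
    finally show ?thesis by (simp add: pw1[OF y] mult.assoc)
  qed
  have form: "hess_form u z h \<le> (L + 1) * C\<^sub>0 * norm z powr (2 - q)" if h: "norm h = norm z" for h
  proof -
    obtain J b \<omega> where J: "complex_structure J" "b\<^sup>2 + \<omega>\<^sup>2 = 1" "similarity J b \<omega> z = h"
      using direction_of_flow[OF h n0[OF z]] by blast
    have b: "\<bar>b\<bar> \<le> 1"
    proof -
      have "b\<^sup>2 \<le> 1" using J(2) zero_le_power2[of \<omega>] by linarith
      then show ?thesis by (simp add: abs_square_le_1)
    qed
    have ns: "norm (similarity J b \<omega> y) = norm y" for y by (rule norm_similarity_unit[OF J(1,2)])
    have "second_flow_derivative J b \<omega> u z \<le> L * (- u z)"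
    proof (rule second_flow_derivative_bound[OF C2 S(1) k(1) less_imp_le[OF k(2)] cone eq c \<epsilon> J(1) b L4 K])
      show "K \<subseteq> S" by (auto simp: K_def)
      show "0 \<le> q - 2" using q2 by simp
      show "0 \<le> 2 * C\<^sub>0" using C0 by simp
      show "z \<in> S" by (rule z)
      fix y assume y: "y \<in> S - K"
      then have yS: "y \<in> S" and less: "hess_norm (hess u y) < C\<^sub>0 * norm y powr (- q)" by (auto simp: K_def)
      have "hess_form u y (similarity J b \<omega> y) \<le> hess_norm (hess u y) * (norm y)\<^sup>2"
        using hess_form_le_hess_norm[of u y "similarity J b \<omega> y"] by (simp add: ns)
      also have "\<dots> \<le> C\<^sub>0 * norm y powr (- q) * (norm y)\<^sup>2" using less by (intro mult_right_mono) auto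
      also have "\<dots> = C\<^sub>0 * norm y powr (2 - q)" by (simp add: pw2[OF yS] mult.assoc)
      finally show "second_flow_derivative J b \<omega> u y \<le> 2 * C\<^sub>0 * norm y powr (- (q - 2))"
        using gr[OF yS, of "similarity J b \<omega> (similarity J b \<omega> y)"] by (simp add: second_flow_derivative_def ns)
    next
      fix y assume y: "y \<in> S"
      have "2 * C\<^sub>0 * exp (q - 2) * norm y powr (- (q - 2)) = (2 * C\<^sub>0\<^sup>2 * exp (q - 2)) * (inverse C\<^sub>0 * norm y powr (2 - q))"
        using C0 by (simp add: power2_eq_square field_simps)
      also have "\<dots> \<le> L * (inverse C\<^sub>0 * norm y powr (2 - q))"
        using C0 by (intro mult_right_mono) (auto simp: L)
      also have "\<dots> \<le> L * (- u y)" using C0_est[OF y] L0 by (intro mult_left_mono) auto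
      finally show "2 * C\<^sub>0 * exp (q - 2) * norm y powr (- (q - 2)) \<le> L * (- u y)" .
    qed
    also have "\<dots> \<le> L * (C\<^sub>0 * norm z powr (2 - q))" using C0_est[OF z] L0 by (intro mult_left_mono) auto
    finally have "second_flow_derivative J b \<omega> u z \<le> L * (C\<^sub>0 * norm z powr (2 - q))" .
    moreover have "- (grad u z \<bullet> similarity J b \<omega> (similarity J b \<omega> z)) \<le> C\<^sub>0 * norm z powr (2 - q)"
      using gr[OF z, of "- similarity J b \<omega> (similarity J b \<omega> z)"] by (simp add: ns)
    ultimately show ?thesis by (simp add: second_flow_derivative_def J(3) algebra_simps)
  qed
  have "hess_norm (hess u z) \<le> (real DIM(complex^'n))\<^sup>2 * ((L + 1) * C\<^sub>0 * norm z powr (- q))"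
  proof (rule hess_norm_le_of_form_le)
    show "\<And>b c. b \<in> Basis \<Longrightarrow> c \<in> Basis \<Longrightarrow> hess u z b c = hess u z c b"
      by (rule hess_symmetric[OF C2 S(1) z])
    have "0 < sigma_k 1 (complex_hess u z)" using cone[OF z] k by (simp add: gamma_cone_def)
    then show "0 \<le> (\<Sum>b\<in>Basis. hess u z b b)" by (simp add: sigma_1_complex_hess[OF C2 S(1) z])
    fix h :: "complex^'n"
    show "hess_form u z h \<le> (L + 1) * C\<^sub>0 * norm z powr (- q) * (norm h)\<^sup>2"
    proof (cases "h = 0")
      case True
      then show ?thesis by (simp add: hess_form_def)
    next
      case False
      define r where "r = norm h / norm z"
      define h1 where "h1 = (1 / r) *\<^sub>R h"
      have r: "0 < r" using False n0[OF z] by (simp add: r_def)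
      have h1: "norm h1 = norm z" using False r by (simp add: h1_def r_def)
      have "h = r *\<^sub>R h1" using r by (simp add: h1_def)
      then have "hess_form u z h = r\<^sup>2 * hess_form u z h1"
        by (simp add: hess_form_def sum_distrib_left power2_eq_square mult_ac)
      also have "\<dots> \<le> r\<^sup>2 * ((L + 1) * C\<^sub>0 * norm z powr (2 - q))" by (intro mult_left_mono form h1) simp
      also have "\<dots> = (L + 1) * C\<^sub>0 * norm z powr (- q) * (norm h)\<^sup>2"
        unfolding pw2[OF z, symmetric] r_def using n0[OF z] by (simp add: power_divide)
      finally show ?thesis .
    qed
  qed
  then show ?thesis by (simp add: mult.assoc)
qed

theorem proposition4p2:
  fixes \<Omega> :: "(complex^'n) set" and k :: nat and c C\<^sub>0 \<epsilon>\<^sub>0 R\<^sub>0 :: real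
    and u :: "real \<Rightarrow> real \<Rightarrow> complex^'n \<Rightarrow> real"
  assumes "1 \<le> k" and "k < CARD('n)"
    and "smooth_bounded_strongly_pseudoconvex_domain \<Omega>" and "0 \<in> \<Omega>"
    and "\<exists>r. holomorphically_convex_in (ball 0 r) (closure \<Omega>)"
    and "c > 0" and "C\<^sub>0 > 0" and "\<epsilon>\<^sub>0 > 0" and "closure \<Omega> \<subseteq> ball 0 R\<^sub>0"
    and reg: "\<And>\<epsilon> R. 0 < \<epsilon> \<Longrightarrow> \<epsilon> < \<epsilon>\<^sub>0 \<Longrightarrow> R\<^sub>0 \<le> R \<Longrightarrow>
      C_on 4 (u \<epsilon> R) (Sigma_dom \<Omega> R) \<and> C_on_closure 2 (u \<epsilon> R) (Sigma_dom \<Omega> R)"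
    and adm: "\<And>\<epsilon> R. 0 < \<epsilon> \<Longrightarrow> \<epsilon> < \<epsilon>\<^sub>0 \<Longrightarrow> R\<^sub>0 \<le> R \<Longrightarrow>
      admissible k (Sigma_dom \<Omega> R) (u \<epsilon> R)"
    and eq: "\<And>\<epsilon> R z. 0 < \<epsilon> \<Longrightarrow> \<epsilon> < \<epsilon>\<^sub>0 \<Longrightarrow> R\<^sub>0 \<le> R \<Longrightarrow> z \<in> Sigma_dom \<Omega> R \<Longrightarrow>
      sigma_k k (complex_hess (u \<epsilon> R) z) = f_eps c k \<epsilon> z"
    and bdry: "\<And>\<epsilon> R z. 0 < \<epsilon> \<Longrightarrow> \<epsilon> < \<epsilon>\<^sub>0 \<Longrightarrow> R\<^sub>0 \<le> R \<Longrightarrow> z \<in> frontier \<Omega> \<Longrightarrow> u \<epsilon> R z = - 1"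
    and C0_est: "\<And>\<epsilon> R z. 0 < \<epsilon> \<Longrightarrow> \<epsilon> < \<epsilon>\<^sub>0 \<Longrightarrow> R\<^sub>0 \<le> R \<Longrightarrow> z \<in> Sigma_dom \<Omega> R \<Longrightarrow>
      inverse C\<^sub>0 * norm z powr (2 - 2 * real CARD('n) / real k) < - u \<epsilon> R z \<and>
      - u \<epsilon> R z < C\<^sub>0 * norm z powr (2 - 2 * real CARD('n) / real k)"
    and C1_est: "\<And>\<epsilon> R z. 0 < \<epsilon> \<Longrightarrow> \<epsilon> < \<epsilon>\<^sub>0 \<Longrightarrow> R\<^sub>0 \<le> R \<Longrightarrow> z \<in> Sigma_dom \<Omega> R \<Longrightarrow>
      norm (grad (u \<epsilon> R) z) < C\<^sub>0 * norm z powr (1 - 2 * real CARD('n) / real k)"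
    and C2_bdry_est: "\<And>\<epsilon> R z. 0 < \<epsilon> \<Longrightarrow> \<epsilon> < \<epsilon>\<^sub>0 \<Longrightarrow> R\<^sub>0 \<le> R \<Longrightarrow>
      z \<in> frontier (Sigma_dom \<Omega> R) \<Longrightarrow>
      hess_norm (hess_ext (Sigma_dom \<Omega> R) (u \<epsilon> R) z)
        < C\<^sub>0 * norm z powr (- (2 * real CARD('n) / real k))"
  shows "\<exists>C>0. \<forall>\<epsilon> R. 0 < \<epsilon> \<and> \<epsilon> < \<epsilon>\<^sub>0 \<and> R\<^sub>0 \<le> R \<longrightarrow> (\<forall>z \<in> Sigma_dom \<Omega> R.
    hess_norm (hess (u \<epsilon> R) z) \<le> C * norm z powr (- (2 * real CARD('n) / real k)))"
proof -
  define q where "q = 2 * real CARD('n) / real k"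
  define L where "L = 2 * C\<^sub>0\<^sup>2 * exp (q - 2) + 4 * (real CARD('n) + 1) + 1"
  define C where "C = (real DIM(complex^'n))\<^sup>2 * ((L + 1) * C\<^sub>0)"
  have \<Omega>: "open \<Omega>"
    using assms(3) by (simp add: smooth_bounded_strongly_pseudoconvex_domain_def)
  have "0 \<le> L" by (simp add: L_def)
  then have C: "0 < C" using \<open>C\<^sub>0 > 0\<close> by (simp add: C_def)
  have "hess_norm (hess (u \<epsilon> R) z) \<le> C * norm z powr (- q)"
    if \<epsilon>: "0 < \<epsilon>" "\<epsilon> < \<epsilon>\<^sub>0" and R: "R\<^sub>0 \<le> R" and z: "z \<in> Sigma_dom \<Omega> R" for \<epsilon> R z
    unfolding C_def
  proof (rule hessian_decay[where S = "Sigma_dom \<Omega> R" and c = c and \<epsilon> = \<epsilon> and k = k])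
    show "open (Sigma_dom \<Omega> R)" by (simp add: Sigma_dom_def open_Diff)
    show "bounded (Sigma_dom \<Omega> R)"
      unfolding Sigma_dom_def by (rule bounded_subset[OF bounded_ball]) auto
    show "0 \<notin> closure (Sigma_dom \<Omega> R)"
    proof -
      have "\<Omega> \<inter> Sigma_dom \<Omega> R = {}" using closure_subset by (auto simp: Sigma_dom_def)
      then have "\<Omega> \<inter> closure (Sigma_dom \<Omega> R) = {}" using \<Omega> open_Int_closure_eq_empty by blast
      then show ?thesis using \<open>0 \<in> \<Omega>\<close> by blast
    qed
    show "admissible k (Sigma_dom \<Omega> R) (u \<epsilon> R)" by (rule adm[OF \<epsilon> R])
    show "C_on_closure 2 (u \<epsilon> R) (Sigma_dom \<Omega> R)" using reg[OF \<epsilon> R] by blast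
  qed (use assms(1,2) \<open>c > 0\<close> \<open>C\<^sub>0 > 0\<close> eq[OF \<epsilon> R] C0_est[OF \<epsilon> R] C1_est[OF \<epsilon> R] C2_bdry_est[OF \<epsilon> R] \<epsilon> z
      in \<open>simp_all add: q_def L_def\<close>)
  then show ?thesis using C unfolding q_def by blast
qed

end
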